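(* Let $G$ be a compact Lie group. Let $p\colon E\to B$ be a $G$-fibration with fibre $F$, whose base $B$ is a $G$-CW-complex of dimension at least $2$. If there exists $s\ge 0$ such that the fibre of $p^H\colon E^H\to B^H$ is $(s-1)$-connected for all subgroups $H$ of $G$, then $$\mathrm{secat}_{G}(p)<\frac{\mathrm{hdim}_{G}(B)+1}{s+1}+1.$$
   Context: All spaces are Hausdorff. A $G$-map is a continuous equivariant map; a $G$-homotopy is an equivariant homotopy ($G$ acting trivially on $[0,1]$). A $G$-fibration is a $G$-map with the $G$-homotopy lifting property with respect to every $G$-space. For a $G$-space $X$ and a subgroup $H\le G$, $X^H=\{x\in X: h\cdot x=x\text{ for all }h\in H\}$, and $p^H\colon E^H\to B^H$ is the restriction of $p$. Equivariant sectional category: for a $G$-map $p\colon E\to B$, $\mathrm{secat}_G(p)$ is the least positive integer $k$ such that $B$ has a cover by $G$-invariant open sets $U_1,\dots,U_k$ with $G$-maps $s_i\colon U_i\to E$ such that $p\circ s_i$ is $G$-homotopic to the inclusion $U_i\hookrightarrow B$ ($\infty$ if there is no such $k$). $G$-homotopy dimension: for a $G$-CW-complex $X$, $\mathrm{hdim}_G(X)=\min\{\dim(X') : X'\text{ is a }G\text{-CW-complex } G\text{-homotopy equivalent to }X\}$.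
   Formalization: The G-homotopy dimension of B is assumed finite; otherwise the strict inequality can read ∞ < ∞, as for S^∞ → RP^∞ with trivial G and s = 0. *)

theory Defs
  imports "HOL-Analysis.Analysis" "HOL-Algebra.Left_Coset"
begin

section \<open>Compact Lie groups\<close>

text \<open>
  Manifolds are modelled on \<^const>\<open>Euclidean_space\<close> \<open>n\<close>, the sequences that vanish from index \<open>n\<close> on,
  so that the dimension is an ordinary natural number (possibly \<open>0\<close>: finite groups are Lie groups).
  The function \<open>D \<alpha>\<close> is the iterated partial derivative of \<open>f\<close> along the list of indices \<open>\<alpha>\<close>;
  smooth means that all of these exist and are continuous.
\<close>

definition smooth_on :: "nat \<Rightarrow> (nat \<Rightarrow> real) set \<Rightarrow> ((nat \<Rightarrow> real) \<Rightarrow> real) \<Rightarrow> bool" where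
  "smooth_on n U f \<longleftrightarrow>
     (\<exists>D :: nat list \<Rightarrow> (nat \<Rightarrow> real) \<Rightarrow> real.
        (\<forall>x\<in>U. D [] x = f x) \<and>
        (\<forall>\<alpha>. set \<alpha> \<subseteq> {..<n} \<longrightarrow>
           continuous_map (subtopology (Euclidean_space n) U) euclideanreal (D \<alpha>)) \<and>
        (\<forall>\<alpha> i x. set \<alpha> \<subseteq> {..<n} \<longrightarrow> i < n \<longrightarrow> x \<in> U \<longrightarrow>
           ((\<lambda>t. D \<alpha> (x(i := t))) has_real_derivative D (i # \<alpha>) x) (at (x i))))"

type_synonym 'm chart = "'m set \<times> ('m \<Rightarrow> nat \<Rightarrow> real)"

definition smooth_map ::
  "nat \<Rightarrow> 'm topology \<Rightarrow> 'm chart set \<Rightarrow> nat \<Rightarrow> 'k topology \<Rightarrow> 'k chart set \<Rightarrow> ('m \<Rightarrow> 'k) \<Rightarrow> bool" where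
  "smooth_map m M A n N B f \<longleftrightarrow>
     continuous_map M N f \<and>
     (\<forall>(U, \<phi>)\<in>A. \<forall>(V, \<psi>)\<in>B. \<forall>j<n.
        smooth_on m (\<phi> ` (U \<inter> f -` V)) (\<lambda>x. \<psi> (f (inv_into U \<phi> x)) j))"

text \<open>Smoothness of the identity map says exactly that all changes of coordinates are smooth.\<close>

definition smooth_atlas :: "nat \<Rightarrow> 'm topology \<Rightarrow> 'm chart set \<Rightarrow> bool" where
  "smooth_atlas n M A \<longleftrightarrow>
     (\<Union>(U, \<phi>)\<in>A. U) = topspace M \<and>
     (\<forall>(U, \<phi>)\<in>A. openin M U \<and> openin (Euclidean_space n) (\<phi> ` U) \<and>
        homeomorphic_map (subtopology M U) (subtopology (Euclidean_space n) (\<phi> ` U)) \<phi>) \<and>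
     smooth_map n M A n M A (\<lambda>x. x)"

definition product_atlas :: "nat \<Rightarrow> 'm chart set \<Rightarrow> 'k chart set \<Rightarrow> ('m \<times> 'k) chart set" where
  "product_atlas m A B =
     (\<lambda>((U, \<phi>), (V, \<psi>)). (U \<times> V, \<lambda>(x, y) i. if i < m then \<phi> x i else \<psi> y (i - m))) ` (A \<times> B)"

record 'g top_group = "'g monoid" +
  gtop :: "'g topology"

definition topological_group :: "'g top_group \<Rightarrow> bool" where
  "topological_group G \<longleftrightarrow>
     group G \<and> topspace (gtop G) = carrier G \<and> Hausdorff_space (gtop G) \<and>
     continuous_map (prod_topology (gtop G) (gtop G)) (gtop G) (\<lambda>(x, y). x \<otimes>\<^bsub>G\<^esub> y) \<and>
     continuous_map (gtop G) (gtop G) (\<lambda>x. inv\<^bsub>G\<^esub> x)"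

definition Lie_group :: "'g top_group \<Rightarrow> bool" where
  "Lie_group G \<longleftrightarrow>
     topological_group G \<and> second_countable (gtop G) \<and>
     (\<exists>n A. smooth_atlas n (gtop G) A \<and>
        smooth_map (n + n) (prod_topology (gtop G) (gtop G)) (product_atlas n A A)
          n (gtop G) A (\<lambda>(x, y). x \<otimes>\<^bsub>G\<^esub> y) \<and>
        smooth_map n (gtop G) A n (gtop G) A (\<lambda>x. inv\<^bsub>G\<^esub> x))"

definition compact_Lie_group :: "'g top_group \<Rightarrow> bool" where
  "compact_Lie_group G \<longleftrightarrow> Lie_group G \<and> compact_space (gtop G)"


section \<open>G-spaces, G-maps and G-homotopies\<close>

record ('g, 'a) gspace =
  topo :: "'a topology"
  act :: "'g \<Rightarrow> 'a \<Rightarrow> 'a"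

definition G_space :: "'g top_group \<Rightarrow> ('g, 'a) gspace \<Rightarrow> bool" where
  "G_space G X \<longleftrightarrow>
     Hausdorff_space (topo X) \<and>
     continuous_map (prod_topology (gtop G) (topo X)) (topo X) (\<lambda>(g, x). act X g x) \<and>
     (\<forall>x\<in>topspace (topo X). act X \<one>\<^bsub>G\<^esub> x = x) \<and>
     (\<forall>g\<in>carrier G. \<forall>h\<in>carrier G. \<forall>x\<in>topspace (topo X).
        act X (g \<otimes>\<^bsub>G\<^esub> h) x = act X g (act X h x))"

definition equivariant ::
  "'g top_group \<Rightarrow> ('g, 'a) gspace \<Rightarrow> ('g, 'b) gspace \<Rightarrow> ('a \<Rightarrow> 'b) \<Rightarrow> bool" where
  "equivariant G X Y f \<longleftrightarrow>
     (\<forall>g\<in>carrier G. \<forall>x\<in>topspace (topo X). f (act X g x) = act Y g (f x))"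

definition G_map ::
  "'g top_group \<Rightarrow> ('g, 'a) gspace \<Rightarrow> ('g, 'b) gspace \<Rightarrow> ('a \<Rightarrow> 'b) \<Rightarrow> bool" where
  "G_map G X Y f \<longleftrightarrow> continuous_map (topo X) (topo Y) f \<and> equivariant G X Y f"

definition G_homotopic ::
  "'g top_group \<Rightarrow> ('g, 'a) gspace \<Rightarrow> ('g, 'b) gspace \<Rightarrow> ('a \<Rightarrow> 'b) \<Rightarrow> ('a \<Rightarrow> 'b) \<Rightarrow> bool" where
  "G_homotopic G X Y = homotopic_with (equivariant G X Y) (topo X) (topo Y)"

definition G_homotopy_equivalent ::
  "'g top_group \<Rightarrow> ('g, 'a) gspace \<Rightarrow> ('g, 'b) gspace \<Rightarrow> bool" where
  "G_homotopy_equivalent G X Y \<longleftrightarrow>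
     (\<exists>f h. G_map G X Y f \<and> G_map G Y X h \<and>
        G_homotopic G X X (h \<circ> f) (\<lambda>x. x) \<and> G_homotopic G Y Y (f \<circ> h) (\<lambda>y. y))"

definition invariant :: "'g top_group \<Rightarrow> ('g, 'a) gspace \<Rightarrow> 'a set \<Rightarrow> bool" where
  "invariant G X U \<longleftrightarrow>
     U \<subseteq> topspace (topo X) \<and> (\<forall>g\<in>carrier G. \<forall>x\<in>U. act X g x \<in> U)"

definition gsubspace :: "('g, 'a) gspace \<Rightarrow> 'a set \<Rightarrow> ('g, 'a) gspace" where
  "gsubspace X U = \<lparr>topo = subtopology (topo X) U, act = act X\<rparr>"

definition cylinder :: "('g, 'a) gspace \<Rightarrow> ('g, real \<times> 'a) gspace" where
  "cylinder X = \<lparr>topo = prod_topology (top_of_set {0..1}) (topo X),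
                 act = (\<lambda>g (t, x). (t, act X g x))\<rparr>"

definition fixed_points :: "('g, 'a) gspace \<Rightarrow> 'g set \<Rightarrow> 'a set" where
  "fixed_points X H = {x \<in> topspace (topo X). \<forall>h\<in>H. act X h x = x}"

text \<open>The fibre over \<open>b\<close> of the restriction of \<open>p\<close> to the \<open>H\<close>-fixed points.\<close>

definition fixed_fibre ::
  "('g, 'e) gspace \<Rightarrow> ('e \<Rightarrow> 'b) \<Rightarrow> 'g set \<Rightarrow> 'b \<Rightarrow> 'e topology" where
  "fixed_fibre E p H b = subtopology (topo E) {e \<in> fixed_points E H. p e = b}"

text \<open>
  A space is \<open>k\<close>-connected if it is nonempty and every map into it from a sphere of dimension at most
  \<open>k\<close> is null-homotopic. In particular \<open>(-1)\<close>-connected means nonempty.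
\<close>

definition k_connected :: "int \<Rightarrow> 'a topology \<Rightarrow> bool" where
  "k_connected k X \<longleftrightarrow>
     topspace X \<noteq> {} \<and>
     (\<forall>i f. int i \<le> k \<longrightarrow> continuous_map (nsphere i) X f \<longrightarrow>
        (\<exists>c. homotopic_with (\<lambda>_. True) (nsphere i) X f (\<lambda>_. c)))"


section \<open>G-fibrations\<close>

definition has_GHLP ::
  "'g top_group \<Rightarrow> ('g, 'e) gspace \<Rightarrow> ('g, 'b) gspace \<Rightarrow> ('e \<Rightarrow> 'b) \<Rightarrow> ('g, 'y) gspace \<Rightarrow> bool" where
  "has_GHLP G E B p Y \<longleftrightarrow>
     (\<forall>f h. G_map G Y E f \<longrightarrow> G_map G (cylinder Y) B h \<longrightarrow>
        (\<forall>y\<in>topspace (topo Y). h (0, y) = p (f y)) \<longrightarrow>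
        (\<exists>k. G_map G (cylinder Y) E k \<and>
           (\<forall>y\<in>topspace (topo Y). k (0, y) = f y) \<and>
           (\<forall>z\<in>topspace (topo (cylinder Y)). p (k z) = h z)))"

text \<open>
  The lifting property is demanded for every \<open>G\<close>-space, but a definition cannot quantify over types.
  It is enough to quantify over all \<open>G\<close>-spaces carried by the type \<open>'e \<times> (real \<Rightarrow> 'b)\<close>, because this
  type carries the mapping path space of \<open>p\<close>; lemma \<open>G_fibration_has_GHLP\<close> below proves that
  the lifting property then holds for \<open>G\<close>-spaces over an arbitrary type.
\<close>

definition G_fibration ::
  "'g top_group \<Rightarrow> ('g, 'e) gspace \<Rightarrow> ('g, 'b) gspace \<Rightarrow> ('e \<Rightarrow> 'b) \<Rightarrow> bool" where
  "G_fibration G E B p \<longleftrightarrow>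
     G_map G E B p \<and>
     (\<forall>Y :: ('g, 'e \<times> (real \<Rightarrow> 'b)) gspace. G_space G Y \<longrightarrow> has_GHLP G E B p Y)"

definition path_topology :: "'b topology \<Rightarrow> (real \<Rightarrow> 'b) topology" where
  "path_topology B =
     topology_generated_by
       {{\<gamma>. \<forall>t\<in>K. \<gamma> t \<in> V} | K V. compact K \<and> K \<subseteq> {0..1} \<and> openin B V}"

definition mapping_path_space ::
  "('g, 'e) gspace \<Rightarrow> ('g, 'b) gspace \<Rightarrow> ('e \<Rightarrow> 'b) \<Rightarrow> ('g, 'e \<times> (real \<Rightarrow> 'b)) gspace" where
  "mapping_path_space E B p =
     \<lparr>topo = subtopology (prod_topology (topo E) (path_topology (topo B)))
        {(e, \<gamma>). \<gamma> \<in> extensional {0..1} \<and>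
           continuous_map (top_of_set {0..1}) (topo B) \<gamma> \<and> \<gamma> 0 = p e},
      act = (\<lambda>g (e, \<gamma>). (act E g e, restrict (\<lambda>t. act B g (\<gamma> t)) {0..1}))\<rparr>"

lemma continuous_map_into_path_topology:
  assumes h: "continuous_map (prod_topology (top_of_set {0..1}) Y) B h"
  shows "continuous_map Y (path_topology B) (\<lambda>y. restrict (\<lambda>t. h (t, y)) {0..1})"
  unfolding path_topology_def
proof (rule continuous_on_generated_topo)
  fix W
  assume "W \<in> {{\<gamma>. \<forall>t\<in>K. \<gamma> t \<in> V} | K V. compact K \<and> K \<subseteq> {0..1::real} \<and> openin B V}"
  then obtain K V where W: "W = {\<gamma>. \<forall>t\<in>K. \<gamma> t \<in> V}"
    and K: "compact K" "K \<subseteq> {0..1}" and V: "openin B V"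
    by blast
  have eq: "top_of_set K = subtopology (top_of_set {0..1}) K"
    using K(2) by (simp add: subtopology_subtopology Int_absorb1)
  have hK: "continuous_map (prod_topology (top_of_set K) Y) B h"
    unfolding eq prod_topology_subtopology(1)[of "top_of_set {0..1}"]
    by (rule continuous_map_from_subtopology[OF h])
  let ?C = "{z \<in> topspace (prod_topology (top_of_set K) Y). h z \<in> topspace B - V}"
  have "closedin (prod_topology (top_of_set K) Y) ?C"
    using V by (intro closedin_continuous_map_preimage[OF hK]) auto
  moreover have "compact_space (top_of_set K)"
    using K by (simp add: compact_space_subtopology)
  ultimately have "closedin Y (snd ` ?C)"
    by (meson Abstract_Topological_Spaces.closed_map_snd closed_map_def)
  then have "openin Y (topspace Y - snd ` ?C)"
    by (rule openin_diff[OF openin_topspace])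
  moreover have "topspace Y - snd ` ?C
      = (\<lambda>y. restrict (\<lambda>t. h (t, y)) {0..1}) -` W \<inter> topspace Y"
  proof -
    have hB: "h (t, y) \<in> topspace B" if "t \<in> K" "y \<in> topspace Y" for t y
      using continuous_map_image_subset_topspace[OF hK] that by auto
    have "y \<in> snd ` ?C \<longleftrightarrow> (\<exists>t\<in>K. h (t, y) \<notin> V)" if "y \<in> topspace Y" for y
    proof -
      have "y \<in> snd ` ?C \<longleftrightarrow> (\<exists>t. (t, y) \<in> ?C)"
        by (metis (no_types, lifting) imageE image_eqI prod.collapse snd_conv)
      then show ?thesis
        using that hB by auto
    qed
    moreover have "restrict (\<lambda>t. h (t, y)) {0..1} \<in> W \<longleftrightarrow> (\<forall>t\<in>K. h (t, y) \<in> V)" for y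
    proof -
      have "restrict (\<lambda>t. h (t, y)) {0..1} t = h (t, y)" if "t \<in> K" for t
        using that K(2) by (metis restrict_apply subsetD)
      then show ?thesis
        by (simp add: W)
    qed
    ultimately show ?thesis
      by (auto simp only: Diff_iff Int_iff vimage_eq)
  qed
  ultimately show "openin Y ((\<lambda>y. restrict (\<lambda>t. h (t, y)) {0..1}) -` W \<inter> topspace Y)"
    by (simp only:)
next
  have "UNIV \<in> {{\<gamma>. \<forall>t\<in>K. \<gamma> t \<in> V} | K V. compact K \<and> K \<subseteq> {0..1::real} \<and> openin B V}"
    by (rule CollectI, rule exI[of _ "{}"], rule exI[of _ "{}"]) simp
  then show "(\<lambda>y. restrict (\<lambda>t. h (t, y)) {0..1}) ` topspace Y
      \<subseteq> \<Union>{{\<gamma>. \<forall>t\<in>K. \<gamma> t \<in> V} | K V. compact K \<and> K \<subseteq> {0..1::real} \<and> openin B V}"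
    by (metis (no_types, lifting) UNIV_I UnionI subsetI)
qed

lemma openin_path_topology:
  "compact K \<Longrightarrow> K \<subseteq> {0..1} \<Longrightarrow> openin B V \<Longrightarrow> openin (path_topology B) {\<gamma>. \<forall>t\<in>K. \<gamma> t \<in> V}"
  unfolding path_topology_def by (rule topology_generated_by_Basis) blast

lemma topspace_path_topology [simp]: "topspace (path_topology B) = UNIV"
proof -
  have "{\<gamma>. \<forall>t\<in>{}. \<gamma> t \<in> {}} \<subseteq> topspace (path_topology B)"
    by (rule openin_subset[OF openin_path_topology]) auto
  then show ?thesis
    by auto
qed

lemma in_topspace_mapping_path_space:
  "(e, \<gamma>) \<in> topspace (topo (mapping_path_space E B p)) \<longleftrightarrow>
     e \<in> topspace (topo E) \<and> \<gamma> \<in> extensional {0..1} \<and>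
     continuous_map (top_of_set {0..1}) (topo B) \<gamma> \<and> \<gamma> 0 = p e"
  by (simp add: mapping_path_space_def)

lemma continuous_map_evaluation:
  "continuous_map (prod_topology (top_of_set {0..1}) (topo (mapping_path_space E B p))) (topo B)
     (\<lambda>(t, z). snd z t)"
proof -
  let ?Z = "topo (mapping_path_space E B p)"
  let ?I = "top_of_set {0..1::real}"
  have in_B: "\<gamma> t \<in> topspace (topo B)" if "(e, \<gamma>) \<in> topspace ?Z" "t \<in> {0..1}" for e \<gamma> t
    using that continuous_map_image_subset_topspace[of ?I "topo B" \<gamma>]
    by (auto simp: in_topspace_mapping_path_space)
  have op: "openin (prod_topology ?I ?Z)
      {w \<in> topspace (prod_topology ?I ?Z). (case w of (t, z) \<Rightarrow> snd z t) \<in> V}"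
    if V: "openin (topo B) V" for V
    unfolding openin_prod_topology_alt
  proof (intro allI impI)
    fix t z
    assume *: "(t, z) \<in> {w \<in> topspace (prod_topology ?I ?Z). (case w of (t, z) \<Rightarrow> snd z t) \<in> V}"
    obtain e \<gamma> where z: "z = (e, \<gamma>)"
      by (cases z)
    have t: "t \<in> {0..1}" and zZ: "(e, \<gamma>) \<in> topspace ?Z" and tV: "\<gamma> t \<in> V"
      using * z by auto
    have "continuous_map ?I (topo B) \<gamma>"
      using zZ by (simp add: in_topspace_mapping_path_space)
    then have "openin ?I {u \<in> topspace ?I. \<gamma> u \<in> V}"
      using V by (rule openin_continuous_map_preimage)
    then obtain d where d: "d > 0" "\<And>u. u \<in> {0..1} \<Longrightarrow> dist u t < d \<Longrightarrow> \<gamma> u \<in> V"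
      using t tV by (auto simp: openin_euclidean_subtopology_iff)
    define K where "K = cball t (d/2) \<inter> {0..1}"
    have K: "compact K" "K \<subseteq> {0..1}"
      by (auto simp: K_def compact_Int_closed)
    have K': "\<forall>u\<in>K. \<gamma> u \<in> V"
      using d by (auto simp: K_def dist_commute)
    define W where "W = topspace ?Z \<inter> (topspace (topo E) \<times> {\<gamma>. \<forall>u\<in>K. \<gamma> u \<in> V})"
    have "openin (prod_topology (topo E) (path_topology (topo B)))
            (topspace (topo E) \<times> {\<gamma>. \<forall>u\<in>K. \<gamma> u \<in> V})"
      using openin_path_topology[OF K V] by (simp add: openin_prod_Times_iff)
    then have "openin ?Z W"
      unfolding W_def mapping_path_space_def gspace.simps topspace_subtopology
      by (subst openin_subtopology) (auto dest: openin_subset)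
    moreover have "openin ?I ({0..1} \<inter> ball t (d/2))"
      by (simp add: openin_open_Int)
    moreover have "t \<in> {0..1} \<inter> ball t (d/2)" "z \<in> W"
      using t d(1) zZ K' z by (auto simp: W_def in_topspace_mapping_path_space)
    moreover have "({0..1} \<inter> ball t (d/2)) \<times> W
        \<subseteq> {w \<in> topspace (prod_topology ?I ?Z). (case w of (t, z) \<Rightarrow> snd z t) \<in> V}"
      by (auto simp: W_def K_def)
    ultimately show "\<exists>U Va. openin ?I U \<and> openin ?Z Va \<and> t \<in> U \<and> z \<in> Va \<and>
        U \<times> Va \<subseteq> {w \<in> topspace (prod_topology ?I ?Z). (case w of (t, z) \<Rightarrow> snd z t) \<in> V}"
      by blast
  qed
  show ?thesis
    unfolding continuous_map using in_B op by (force simp: image_subset_iff)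
qed

lemma act_closed:
  assumes "topological_group G" "G_space G X" "g \<in> carrier G" "x \<in> topspace (topo X)"
  shows "act X g x \<in> topspace (topo X)"
  using assms continuous_map_image_subset_topspace
    [of "prod_topology (gtop G) (topo X)" "topo X" "\<lambda>(g, x). act X g x"]
  by (auto simp: G_space_def topological_group_def)

lemma continuous_map_act:
  assumes "topological_group G" "G_space G X" "g \<in> carrier G"
  shows "continuous_map (topo X) (topo X) (act X g)"
proof -
  have "continuous_map (topo X) (prod_topology (gtop G) (topo X)) (\<lambda>x. (g, x))"
    using assms by (simp add: continuous_map_pairedI topological_group_def)
  moreover have "continuous_map (prod_topology (gtop G) (topo X)) (topo X) (\<lambda>(g, x). act X g x)"
    using assms(2) by (simp add: G_space_def)
  ultimately show ?thesis
    by (auto dest: continuous_map_compose simp: o_def)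
qed

lemma fst_mapping_path_space:
  "continuous_map (topo (mapping_path_space E B p)) (topo E) fst"
  by (simp add: mapping_path_space_def continuous_map_from_subtopology continuous_map_fst)

lemma Hausdorff_mapping_path_space:
  assumes "Hausdorff_space (topo E)" "Hausdorff_space (topo B)"
  shows "Hausdorff_space (topo (mapping_path_space E B p))"
proof -
  let ?Z = "topo (mapping_path_space E B p)"
  let ?P = "prod_topology (topo E) (product_topology (\<lambda>_. topo B) {0..1::real})"
  have ev: "continuous_map ?Z (topo B) (\<lambda>z. snd z t)" if "t \<in> {0..1}" for t
  proof -
    have "continuous_map ?Z (prod_topology (top_of_set {0..1}) ?Z) (\<lambda>z. (t, z))"
      using that by (simp add: continuous_map_pairedI)
    from continuous_map_compose[OF this continuous_map_evaluation] show ?thesis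
      by (simp add: o_def)
  qed
  have "continuous_map ?Z (product_topology (\<lambda>_. topo B) {0..1::real}) snd"
    unfolding continuous_map_componentwise
    using ev by (auto simp: in_topspace_mapping_path_space)
  then have "continuous_map ?Z ?P (\<lambda>z. (fst z, snd z))"
    using fst_mapping_path_space by (rule_tac continuous_map_pairedI)
  then have "continuous_map ?Z ?P (\<lambda>z. z)"
    by simp
  moreover have "Hausdorff_space ?P"
    using assms by (simp add: Hausdorff_space_prod_topology Hausdorff_space_product_topology)
  ultimately show ?thesis
    by (metis Hausdorff_space_injective_preimage inj_on_def)
qed

lemma continuous_map_comp:
  "continuous_map X Y f \<Longrightarrow> continuous_map Y Z g \<Longrightarrow> (\<And>x. h x = g (f x)) \<Longrightarrow> continuous_map X Z h"
  by (metis comp_apply continuous_map_compose continuous_map_eq)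

lemma G_space_mapping_path_space:
  assumes G: "topological_group G" and E: "G_space G E" and B: "G_space G B" and p: "G_map G E B p"
  shows "G_space G (mapping_path_space E B p)"
proof -
  let ?Z = "mapping_path_space E B p"
  let ?I = "top_of_set {0..1::real}"
  interpret group G
    using G by (simp add: topological_group_def)
  have carrier: "topspace (gtop G) = carrier G"
    using G by (simp add: topological_group_def)
  have act: "act ?Z g (e, \<gamma>) = (act E g e, restrict (\<lambda>t. act B g (\<gamma> t)) {0..1})" for g e \<gamma>
    by (simp add: mapping_path_space_def)
  have act_eq: "act ?Z g z = (act E g (fst z), restrict (\<lambda>t. act B g (snd z t)) {0..1})" for g z
    by (simp add: mapping_path_space_def case_prod_unfold)
  have in_B: "\<gamma> t \<in> topspace (topo B)" if "(e, \<gamma>) \<in> topspace (topo ?Z)" "t \<in> {0..1}" for e \<gamma> t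
    using that continuous_map_image_subset_topspace[of ?I "topo B" \<gamma>]
    by (auto simp: in_topspace_mapping_path_space)
  have closed: "act ?Z g z \<in> topspace (topo ?Z)" if g: "g \<in> carrier G" and z: "z \<in> topspace (topo ?Z)"
    for g z
  proof -
    obtain e \<gamma> where [simp]: "z = (e, \<gamma>)"
      by (cases z)
    have "continuous_map ?I (topo B) (act B g \<circ> \<gamma>)"
      using z continuous_map_act[OF G B g]
      by (auto simp: in_topspace_mapping_path_space intro: continuous_map_compose)
    then have "continuous_map ?I (topo B) (restrict (\<lambda>t. act B g (\<gamma> t)) {0..1})"
      by (rule continuous_map_eq) auto
    then show ?thesis
      using z g p act_closed[OF G E g]
      by (auto simp: act in_topspace_mapping_path_space G_map_def equivariant_def)
  qed
  have "continuous_map (prod_topology (gtop G) (topo ?Z)) (topo E) (\<lambda>w. act E (fst w) (fst (snd w)))"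
  proof -
    have "continuous_map (prod_topology (gtop G) (topo ?Z)) (prod_topology (gtop G) (topo E))
        (\<lambda>w. (fst w, fst (snd w)))"
      by (intro continuous_map_pairedI continuous_map_fst
          continuous_map_compose[OF continuous_map_snd fst_mapping_path_space, unfolded o_def])
    moreover have "continuous_map (prod_topology (gtop G) (topo E)) (topo E) (\<lambda>(g, x). act E g x)"
      using E by (simp add: G_space_def)
    ultimately show ?thesis
      by (rule continuous_map_comp) simp
  qed
  moreover have "continuous_map (prod_topology (gtop G) (topo ?Z)) (path_topology (topo B))
      (\<lambda>w. restrict (\<lambda>t. act B (fst w) (snd (snd w) t)) {0..1})"
  proof -
    let ?Q = "prod_topology ?I (prod_topology (gtop G) (topo ?Z))"
    have tz: "continuous_map ?Q (prod_topology ?I (topo ?Z)) (\<lambda>u. (fst u, snd (snd u)))"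
      by (intro continuous_map_pairedI continuous_map_fst
          continuous_map_compose[OF continuous_map_snd continuous_map_snd, unfolded o_def])
    have "continuous_map ?Q (topo B) (\<lambda>u. snd (snd (snd u)) (fst u))"
      using continuous_map_compose[OF tz continuous_map_evaluation] by (simp add: o_def)
    then have "continuous_map ?Q (prod_topology (gtop G) (topo B))
        (\<lambda>u. (fst (snd u), snd (snd (snd u)) (fst u)))"
      by (intro continuous_map_pairedI
          continuous_map_compose[OF continuous_map_snd continuous_map_fst, unfolded o_def])
    moreover have "continuous_map (prod_topology (gtop G) (topo B)) (topo B) (\<lambda>(g, x). act B g x)"
      using B by (simp add: G_space_def)
    ultimately have "continuous_map ?Q (topo B)
        (\<lambda>u. act B (fst (snd u)) (snd (snd (snd u)) (fst u)))"
      by (rule continuous_map_comp) simp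
    from continuous_map_into_path_topology[OF this] show ?thesis
      by simp
  qed
  ultimately have "continuous_map (prod_topology (gtop G) (topo ?Z))
      (prod_topology (topo E) (path_topology (topo B))) (\<lambda>w. act ?Z (fst w) (snd w))"
    by (simp add: act_eq continuous_map_pairedI)
  moreover
  have eqZ: "topo ?Z = subtopology (prod_topology (topo E) (path_topology (topo B)))
      (topspace (topo ?Z))"
    by (simp add: mapping_path_space_def subtopology_restrict del: topspace_prod_topology)
  moreover have "(\<lambda>w. act ?Z (fst w) (snd w))
      \<in> topspace (prod_topology (gtop G) (topo ?Z)) \<rightarrow> topspace (topo ?Z)"
    using closed carrier by auto
  ultimately have "continuous_map (prod_topology (gtop G) (topo ?Z))
      (subtopology (prod_topology (topo E) (path_topology (topo B))) (topspace (topo ?Z)))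
      (\<lambda>w. act ?Z (fst w) (snd w))"
    by (intro continuous_map_into_subtopology)
  then have "continuous_map (prod_topology (gtop G) (topo ?Z)) (topo ?Z)
      (\<lambda>w. act ?Z (fst w) (snd w))"
    by (simp only: eqZ[symmetric])
  then have "continuous_map (prod_topology (gtop G) (topo ?Z)) (topo ?Z) (\<lambda>(g, z). act ?Z g z)"
    by (simp add: case_prod_unfold)
  moreover have "Hausdorff_space (topo ?Z)"
    using E B by (simp add: G_space_def Hausdorff_mapping_path_space)
  moreover have "act ?Z \<one>\<^bsub>G\<^esub> z = z" if "z \<in> topspace (topo ?Z)" for z
  proof -
    obtain e \<gamma> where [simp]: "z = (e, \<gamma>)"
      by (cases z)
    have "restrict (\<lambda>t. act B \<one>\<^bsub>G\<^esub> (\<gamma> t)) {0..1} = \<gamma>"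
      using that in_B B
      by (intro extensionalityI[of _ "{0..1}"]) (auto simp: in_topspace_mapping_path_space G_space_def)
    then show ?thesis
      using that E by (simp add: act in_topspace_mapping_path_space G_space_def)
  qed
  moreover have "act ?Z (g \<otimes>\<^bsub>G\<^esub> h) z = act ?Z g (act ?Z h z)"
    if "g \<in> carrier G" "h \<in> carrier G" "z \<in> topspace (topo ?Z)" for g h z
  proof -
    obtain e \<gamma> where z: "z = (e, \<gamma>)"
      by (cases z)
    have "act B (g \<otimes>\<^bsub>G\<^esub> h) (\<gamma> t) = act B g (act B h (\<gamma> t))" if "t \<in> {0..1}" for t
      using B \<open>g \<in> _\<close> \<open>h \<in> _\<close> in_B[OF _ that] \<open>z \<in> _\<close> z by (simp add: G_space_def)
    moreover have "act E (g \<otimes>\<^bsub>G\<^esub> h) e = act E g (act E h e)"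
      using that E z by (simp add: G_space_def in_topspace_mapping_path_space)
    ultimately show ?thesis
      by (auto simp: z act intro: restrict_ext)
  qed
  ultimately show ?thesis
    by (simp add: G_space_def)
qed

lemma G_fibration_has_GHLP:
  fixes E :: "('g, 'e) gspace" and B :: "('g, 'b) gspace" and Y :: "('g, 'y) gspace"
  assumes G: "topological_group G" and E: "G_space G E" and B: "G_space G B"
    and fib: "G_fibration G E B p" and Y: "G_space G Y"
  shows "has_GHLP G E B p Y"
  unfolding has_GHLP_def
proof (intro allI impI)
  fix f h
  assume f: "G_map G Y E f" and h: "G_map G (cylinder Y) B h"
    and start: "\<forall>y\<in>topspace (topo Y). h (0, y) = p (f y)"
  let ?Z = "mapping_path_space E B p"
  let ?I = "top_of_set {0..1::real}"
  define q where "q y = (f y, restrict (\<lambda>t. h (t, y)) {0..1})" for y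
  have p: "G_map G E B p"
    using fib by (simp add: G_fibration_def)
  have hc: "continuous_map (prod_topology ?I (topo Y)) (topo B) h"
    using h by (simp add: G_map_def cylinder_def)
  have fc: "continuous_map (topo Y) (topo E) f"
    using f by (simp add: G_map_def)
  have q_in: "q y \<in> topspace (topo ?Z)" if "y \<in> topspace (topo Y)" for y
  proof -
    have "continuous_map ?I (prod_topology ?I (topo Y)) (\<lambda>t. (t, y))"
      using that by (intro continuous_map_pairedI) auto
    from continuous_map_compose[OF this hc] have "continuous_map ?I (topo B) (\<lambda>t. h (t, y))"
      by (simp add: o_def)
    then have "continuous_map ?I (topo B) (restrict (\<lambda>t. h (t, y)) {0..1})"
      by (rule continuous_map_eq) auto
    then show ?thesis
      using that start continuous_map_image_subset_topspace[OF fc]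
      by (auto simp: q_def in_topspace_mapping_path_space)
  qed
  have "continuous_map (topo Y) (prod_topology (topo E) (path_topology (topo B))) q"
    unfolding q_def by (intro continuous_map_pairedI fc continuous_map_into_path_topology hc)
  then have qc: "continuous_map (topo Y) (topo ?Z) q"
    using q_in by (auto simp: mapping_path_space_def continuous_map_in_subtopology)
  have q_act: "q (act Y g y) = act ?Z g (q y)" if "g \<in> carrier G" "y \<in> topspace (topo Y)" for g y
  proof -
    have "h (t, act Y g y) = act B g (h (t, y))" if "t \<in> {0..1}" for t
      using h that \<open>g \<in> _\<close> \<open>y \<in> _\<close> by (force simp: G_map_def equivariant_def cylinder_def)
    moreover have "f (act Y g y) = act E g (f y)"
      using f that by (simp add: G_map_def equivariant_def)
    ultimately show ?thesis
      by (auto simp: q_def mapping_path_space_def intro: restrict_ext)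
  qed
  have u1: "G_map G ?Z E fst"
    unfolding G_map_def equivariant_def using fst_mapping_path_space
    by (auto simp: mapping_path_space_def)
  have u2: "G_map G (cylinder ?Z) B (\<lambda>(t, z). snd z t)"
    unfolding G_map_def equivariant_def using continuous_map_evaluation
    by (auto simp: cylinder_def mapping_path_space_def)
  have u3: "\<forall>z\<in>topspace (topo ?Z). (\<lambda>(t, z). snd z t) (0, z) = p (fst z)"
    by (auto simp: in_topspace_mapping_path_space)
  have u4: "has_GHLP G E B p ?Z"
    using fib G_space_mapping_path_space[OF G E B p] by (simp add: G_fibration_def)
  obtain k where k: "G_map G (cylinder ?Z) E k"
    and k0: "\<forall>z\<in>topspace (topo ?Z). k (0, z) = fst z"
    and k1: "\<forall>w\<in>topspace (topo (cylinder ?Z)). p (k w) = (\<lambda>(t, z). snd z t) w"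
    using u4[unfolded has_GHLP_def, rule_format, OF u1 u2 u3[rule_format]] by blast
  let ?k = "\<lambda>(t, y). k (t, q y)"
  have "continuous_map (prod_topology ?I (topo Y)) (prod_topology ?I (topo ?Z)) (\<lambda>u. (fst u, q (snd u)))"
    by (intro continuous_map_pairedI continuous_map_fst
        continuous_map_compose[OF continuous_map_snd qc, unfolded o_def])
  moreover have "continuous_map (prod_topology ?I (topo ?Z)) (topo E) k"
    using k by (simp add: G_map_def cylinder_def)
  ultimately have "continuous_map (prod_topology ?I (topo Y)) (topo E) ?k"
    by (rule continuous_map_comp) (simp add: case_prod_unfold)
  moreover have "equivariant G (cylinder Y) E ?k"
    using k q_in q_act by (auto simp: G_map_def equivariant_def cylinder_def)
  ultimately have "G_map G (cylinder Y) E ?k"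
    by (simp add: G_map_def cylinder_def)
  moreover have "\<forall>y\<in>topspace (topo Y). ?k (0, y) = f y"
    using k0 q_in by (simp add: q_def)
  moreover have "\<forall>z\<in>topspace (topo (cylinder Y)). p (?k z) = h z"
    using k1 q_in by (auto simp: cylinder_def) (auto simp: q_def)
  ultimately show "\<exists>k. G_map G (cylinder Y) E k \<and> (\<forall>y\<in>topspace (topo Y). k (0, y) = f y) \<and>
      (\<forall>z\<in>topspace (topo (cylinder Y)). p (k z) = h z)"
    by blast
qed


section \<open>G-CW-complexes\<close>

text \<open>
  The orbit \<open>G/H\<close> is the set of left cosets with the quotient topology; \<open>\<Union>S\<close> is the preimage
  of \<open>S\<close> under the projection from \<open>G\<close>.
\<close>

definition orbit_topology :: "'g top_group \<Rightarrow> 'g set \<Rightarrow> 'g set topology" where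
  "orbit_topology G H = topology (\<lambda>S. S \<subseteq> lcosets\<^bsub>G\<^esub> H \<and> openin (gtop G) (\<Union>S))"

lemma openin_orbit_topology:
  assumes "group G" "subgroup H G"
  shows "openin (orbit_topology G H) S \<longleftrightarrow> S \<subseteq> lcosets\<^bsub>G\<^esub> H \<and> openin (gtop G) (\<Union>S)"
proof -
  have "\<Union>(S \<inter> T) = \<Union>S \<inter> \<Union>T" if "S \<subseteq> lcosets\<^bsub>G\<^esub> H" "T \<subseteq> lcosets\<^bsub>G\<^esub> H" for S T
    using that group.lcos_disjoint[OF assms]
    unfolding pairwise_def disjnt_def by blast
  moreover have "\<Union>(\<Union>\<K>) = (\<Union>K\<in>\<K>. \<Union>K)" for \<K> :: "'a set set set"
    by blast
  ultimately have "istopology (\<lambda>S. S \<subseteq> lcosets\<^bsub>G\<^esub> H \<and> openin (gtop G) (\<Union>S))"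
    by (auto simp: istopology_def openin_Int)
  then show ?thesis
    by (simp add: orbit_topology_def topology_inverse')
qed

definition disc :: "nat \<Rightarrow> (nat \<Rightarrow> real) set" where
  "disc n = {x \<in> topspace (Euclidean_space n). (\<Sum>i<n. x i ^ 2) \<le> 1}"

definition disc_boundary :: "nat \<Rightarrow> (nat \<Rightarrow> real) set" where
  "disc_boundary n = {x \<in> topspace (Euclidean_space n). (\<Sum>i<n. x i ^ 2) = 1}"

definition G_cell :: "'g top_group \<Rightarrow> 'g set \<Rightarrow> nat \<Rightarrow> ('g, 'g set \<times> (nat \<Rightarrow> real)) gspace" where
  "G_cell G H n =
     \<lparr>topo = prod_topology (orbit_topology G H) (subtopology (Euclidean_space n) (disc n)),
      act = (\<lambda>g (c, x). (g <#\<^bsub>G\<^esub> c, x))\<rparr>"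

text \<open>
  The set \<open>Xn\<close> is obtained from \<open>A\<close> by attaching \<open>G\<close>-\<open>n\<close>-cells: each element \<open>(H, \<Phi>)\<close> of \<open>C\<close>
  is a cell of type \<open>G/H \<times> D\<^sup>n\<close> with characteristic map \<open>\<Phi>\<close>, and \<open>Xn\<close> is the pushout of \<open>A\<close> and
  the cells along the restrictions of the \<open>\<Phi>\<close> to \<open>G/H \<times> S\<^sup>n\<^sup>-\<^sup>1\<close>, both as a set and as a space.
  Since distinct cells have distinct characteristic maps, a set \<open>C\<close> suffices to index them.
\<close>

definition attaches_G_cells ::
  "'g top_group \<Rightarrow> ('g, 'a) gspace \<Rightarrow> nat \<Rightarrow> 'a set \<Rightarrow> 'a set \<Rightarrow> bool" where
  "attaches_G_cells G X n A Xn \<longleftrightarrow>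
     (\<exists>C :: ('g set \<times> ('g set \<times> (nat \<Rightarrow> real) \<Rightarrow> 'a)) set.
        (\<forall>(H, \<Phi>)\<in>C. subgroup H G \<and> closedin (gtop G) H \<and>
           G_map G (G_cell G H n) (gsubspace X Xn) \<Phi> \<and>
           \<Phi> ` ((lcosets\<^bsub>G\<^esub> H) \<times> disc_boundary n) \<subseteq> A) \<and>
        bij_betw (\<lambda>((H, \<Phi>), z). \<Phi> z)
          (Sigma C (\<lambda>(H, \<Phi>). (lcosets\<^bsub>G\<^esub> H) \<times> (disc n - disc_boundary n))) (Xn - A) \<and>
        (\<forall>S\<subseteq>Xn. closedin (subtopology (topo X) Xn) S \<longleftrightarrow>
           closedin (subtopology (topo X) A) (S \<inter> A) \<and>
           (\<forall>(H, \<Phi>)\<in>C. closedin (topo (G_cell G H n))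
              {z \<in> topspace (topo (G_cell G H n)). \<Phi> z \<in> S})))"

text \<open>\<open>sk n\<close> is the \<open>n\<close>-skeleton; the skeleton below dimension \<open>0\<close> is empty.\<close>

definition skeleton_below :: "(nat \<Rightarrow> 'a set) \<Rightarrow> nat \<Rightarrow> 'a set" where
  "skeleton_below sk n = (if n = 0 then {} else sk (n - 1))"

definition G_CW_complex ::
  "'g top_group \<Rightarrow> ('g, 'a) gspace \<Rightarrow> (nat \<Rightarrow> 'a set) \<Rightarrow> bool" where
  "G_CW_complex G X sk \<longleftrightarrow>
     G_space G X \<and>
     (\<Union>n. sk n) = topspace (topo X) \<and>
     (\<forall>n. skeleton_below sk n \<subseteq> sk n \<and> invariant G X (sk n) \<and>
        attaches_G_cells G X n (skeleton_below sk n) (sk n)) \<and>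
     (\<forall>S\<subseteq>topspace (topo X). closedin (topo X) S \<longleftrightarrow>
        (\<forall>n. closedin (subtopology (topo X) (sk n)) (S \<inter> sk n)))"

definition CW_dim :: "(nat \<Rightarrow> 'a set) \<Rightarrow> enat" where
  "CW_dim sk = (SUP n\<in>{n. sk n \<noteq> skeleton_below sk n}. enat n)"


section \<open>Equivariant homotopy dimension and sectional category\<close>

text \<open>
  The minimum in \<^emph>\<open>hdim\<close> runs over complexes on arbitrary carriers, but a definition cannot quantify
  over types, so the carrier type \<open>'x\<close> of the competing complexes is an argument. An upper bound in
  terms of \<open>hdim TYPE('x)\<close> that holds for every type \<open>'x\<close> is a bound by the minimum over all of them.
  The infimum in \<^typ>\<open>enat\<close> is attained unless it is over the empty set, when it is \<open>\<infinity>\<close>.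
\<close>

definition hdim :: "'x itself \<Rightarrow> 'g top_group \<Rightarrow> ('g, 'a) gspace \<Rightarrow> enat" where
  "hdim _ G X =
     Inf {CW_dim sk | (X' :: ('g, 'x) gspace) sk.
            G_CW_complex G X' sk \<and> G_homotopy_equivalent G X' X}"

definition secat ::
  "'g top_group \<Rightarrow> ('g, 'e) gspace \<Rightarrow> ('g, 'b) gspace \<Rightarrow> ('e \<Rightarrow> 'b) \<Rightarrow> enat" where
  "secat G E B p =
     Inf {enat k | k. k \<ge> 1 \<and>
       (\<exists>U. (\<Union>i<k. U i) = topspace (topo B) \<and>
          (\<forall>i<k. openin (topo B) (U i) \<and> invariant G B (U i) \<and>
             (\<exists>s. G_map G (gsubspace B (U i)) E s \<and>
                G_homotopic G (gsubspace B (U i)) B (p \<circ> s) (\<lambda>x. x))))}"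

end

theory Submission
  imports Defs
begin

text \<open>
  Let \<open>n\<close> be the homotopy dimension of the base and let \<open>k\<close> be the least integer with \<open>n < k (s + 1)\<close>;
  this \<open>k\<close> is smaller than \<open>(n + 1) / (s + 1) + 1\<close>, so a cover of \<open>B\<close> by \<open>k\<close> sets is what is needed.
  Choose a \<open>G\<close>-homotopy equivalence \<open>f\<close> from an \<open>n\<close>-dimensional \<open>G\<close>-CW-complex \<open>X\<close> to \<open>B\<close>. Suppose
  that there are invariant functions \<open>t\<^sub>0, \<dots>, t\<^sub>k\<^sub>-\<^sub>1 \<ge> 0\<close> on \<open>X\<close> without common zero and \<open>G\<close>-maps
  \<open>\<sigma>\<^sub>i\<close> from \<open>{t\<^sub>i > 0}\<close> to \<open>E\<close> that lift \<open>f\<close>. Pulling the open sets \<open>{t\<^sub>i > 0}\<close> back along a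
  homotopy inverse of \<open>f\<close> then gives the cover (\<open>secat_le\<close>). Up to scaling, such data \<open>(t, \<sigma>)\<close> are a
  section of the \<open>k\<close>-fold fibrewise join of the pullback of \<open>p\<close>, and the fibres of this join on fixed
  points are \<open>(k (s + 1) - 2)\<close>-connected. So obstruction theory constructs the data one skeleton at a
  time (\<open>partial_lifts_attach\<close>, \<open>partial_lifts_skeleton\<close>).

  On a cell \<open>G/H \<times> D\<^sup>m\<close> an equivariant map is determined by its restriction to \<open>D\<^sup>m\<close>, which may be any
  map into \<open>H\<close>-fixed points, and \<open>p\<close> restricted to \<open>H\<close>-fixed points still lifts homotopies
  (\<open>fixed_points_lift_homotopies\<close>). Lifting along the radii of the contractible disc reduces the cell
  problem to one in a single fibre \<open>F\<close> (\<open>lift_extension\<close>).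

  What remains is \<open>join_extension\<close>: functions \<open>t\<^sub>i\<close> and maps \<open>\<sigma>\<^sub>i\<close> from \<open>{t\<^sub>i > 0}\<close> to \<open>F\<close> on the
  sphere \<open>S\<^sup>m\<^sup>-\<^sup>1\<close> extend to \<open>D\<^sup>m\<close> if \<open>m < k (s + 1)\<close> and \<open>F\<close> is \<open>(s - 1)\<close>-connected. This is the
  connectivity of joins, proved here without homology. Take a fine cubical grid on \<open>\<real>\<^sup>m\<close> and let \<open>R\<^sub>d\<close>
  be the distance to its \<open>(d - 1)\<close>-skeleton, with \<open>R\<^sub>0 = 1\<close>. The differences
  \<open>R\<^bsub>i(s+1)\<^esub> - R\<^bsub>(i+1)(s+1)\<^esub>\<close> for \<open>i < k\<close> add up to \<open>1\<close>, so each point has an index \<open>i\<close> for which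
  the difference is positive. Such a point is strictly closer to the skeleton of dimension
  \<open>i (s + 1) + s\<close> than to the one of dimension \<open>i (s + 1) - 1\<close>. Pushing it towards the former and away
  from the latter moves it, within its cell of the grid of half the mesh, into the \<open>s\<close>-skeleton of
  that finer grid (\<open>cell_dim_stretch\<close>), and maps into \<open>F\<close> can be chosen freely on complexes of
  dimension \<open>s\<close> (\<open>grid_skeleton_extension\<close>).
\<close>

section \<open>Cells of the integer grid\<close>

lemma Euclidean_space_top_of_set: "Euclidean_space m = top_of_set {x. \<forall>i\<ge>m. x i = 0}"
  by (simp add: Euclidean_space_def euclidean_product_topology)

text \<open>
  The smallest closed cell of the integer grid that contains \<open>x\<close>: it is degenerate in the directions in
  which \<open>x\<close> has integer coordinates, so that its dimension is the number of non-integer coordinates.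
  Naming a cell by a point in its interior avoids a separate type of cells.
\<close>

definition grid_cell :: "(nat \<Rightarrow> real) \<Rightarrow> (nat \<Rightarrow> real) set" where
  "grid_cell x = {y. \<forall>j. of_int \<lfloor>x j\<rfloor> \<le> y j \<and> y j \<le> of_int \<lceil>x j\<rceil>}"

definition cell_dim :: "(nat \<Rightarrow> real) \<Rightarrow> nat" where
  "cell_dim x = card {j. x j \<notin> \<int>}"

lemma grid_cell_self: "x \<in> grid_cell x"
  by (simp add: grid_cell_def)

lemma grid_cell_mono: "y \<in> grid_cell x \<Longrightarrow> grid_cell y \<subseteq> grid_cell x"
  unfolding grid_cell_def
  by (smt (verit) ceiling_mono floor_mono floor_of_int ceiling_of_int mem_Collect_eq of_int_le_iff subsetI)

lemma grid_cell_integer: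
  assumes "y \<in> grid_cell x" "x j \<in> \<int>"
  shows "y j = x j"
proof -
  obtain z where "x j = of_int z"
    using assms(2) by (rule Ints_cases)
  moreover have "of_int \<lfloor>x j\<rfloor> \<le> y j" "y j \<le> of_int \<lceil>x j\<rceil>"
    using assms(1) by (simp_all add: grid_cell_def)
  ultimately show ?thesis
    by simp
qed

lemma finite_non_integers:
  fixes x :: "nat \<Rightarrow> real"
  assumes "\<forall>i\<ge>m. x i = 0"
  shows "finite {j. x j \<notin> \<int>}"
proof (rule finite_subset)
  show "{j. x j \<notin> \<int>} \<subseteq> {..<m}"
  proof
    fix j assume "j \<in> {j. x j \<notin> \<int>}"
    then have "x j \<noteq> 0"
      by auto
    then show "j \<in> {..<m}"
      using assms by (metis lessThan_iff not_le)
  qed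
qed simp

lemma grid_cell_support: "y \<in> grid_cell x \<Longrightarrow> \<forall>i\<ge>m. x i = (0::real) \<Longrightarrow> \<forall>i\<ge>m. y i = 0"
  using grid_cell_integer[of y x] by simp

lemma cell_dim_mono:
  assumes "y \<in> grid_cell x" "\<forall>i\<ge>m. x i = 0"
  shows "cell_dim y \<le> cell_dim x"
  unfolding cell_dim_def
  by (rule card_mono[OF finite_non_integers[OF assms(2)]]) (use grid_cell_integer[OF assms(1)] in auto)

lemma grid_cell_eqI:
  assumes y: "y \<in> grid_cell x" and x: "\<forall>i\<ge>m. x i = 0" and dim: "cell_dim x \<le> cell_dim y"
  shows "grid_cell y = grid_cell x"
proof -
  have "{j. y j \<notin> \<int>} = {j. x j \<notin> \<int>}"
    using dim unfolding cell_dim_def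
    by (intro card_seteq finite_non_integers[OF x]) (use grid_cell_integer[OF y] in auto)
  then have int: "y j \<in> \<int> \<longleftrightarrow> x j \<in> \<int>" for j
    by blast
  have "\<lfloor>y j\<rfloor> = \<lfloor>x j\<rfloor> \<and> \<lceil>y j\<rceil> = \<lceil>x j\<rceil>" for j
  proof (cases "x j \<in> \<int>")
    case True
    then show ?thesis using grid_cell_integer[OF y] by simp
  next
    case False
    have b: "of_int \<lfloor>x j\<rfloor> \<le> y j" "y j \<le> of_int \<lceil>x j\<rceil>" "\<lceil>x j\<rceil> = \<lfloor>x j\<rfloor> + 1"
      using y False Ints_of_int[of "\<lfloor>x j\<rfloor>", where 'a = real]
      by (auto simp: grid_cell_def ceiling_altdef simp del: Ints_of_int)
    have "y j \<noteq> of_int \<lceil>x j\<rceil>" "y j \<noteq> of_int \<lfloor>x j\<rfloor>"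
      using int[of j] False by auto
    then have "\<lfloor>y j\<rfloor> = \<lfloor>x j\<rfloor>"
      using b by linarith
    moreover have "\<lceil>y j\<rceil> = \<lceil>x j\<rceil>"
      using b \<open>y j \<noteq> of_int \<lfloor>x j\<rfloor>\<close> by linarith
    ultimately show ?thesis by simp
  qed
  then show ?thesis
    by (simp add: grid_cell_def)
qed

lemma closed_grid_cell: "closed (grid_cell x)"
proof -
  have "grid_cell x = (\<Inter>j. {y. of_int \<lfloor>x j\<rfloor> \<le> y j} \<inter> {y. y j \<le> of_int \<lceil>x j\<rceil>})"
    by (auto simp: grid_cell_def)
  also have "closed \<dots>"
    by (intro closed_INT ballI closed_Int closed_Collect_le continuous_intros continuous_on_product_coordinates)
  finally show ?thesis .
qed

text \<open>The cells form a locally finite family of closed sets, so that continuity can be tested on each of them.\<close>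

lemma continuous_map_grid_cells:
  assumes S: "S \<subseteq> {x. \<forall>i\<ge>m. x i = 0}"
    and cont: "\<And>x. x \<in> S \<Longrightarrow> continuous_map (top_of_set (S \<inter> grid_cell x)) Y g"
  shows "continuous_map (top_of_set S) Y g"
proof (rule pasting_lemma_locally_finite[where I = "grid_cell ` S" and T = "\<lambda>c. S \<inter> c" and f = "\<lambda>_. g"])
  fix x assume "x \<in> topspace (top_of_set S)"
  then have x: "x \<in> S" by simp
  define V where "V = S \<inter> (\<Inter>j\<in>{..<m}. {y. x j - 1 < y j} \<inter> {y. y j < x j + 1})"
  have "open (\<Inter>j\<in>{..<m}. {y. x j - 1 < y j} \<inter> {y. y j < x j + 1})"
    by (intro open_INT finite_lessThan ballI open_Int open_Collect_less continuous_intros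
        continuous_on_product_coordinates)
  then have V: "openin (top_of_set S) V"
    unfolding V_def by (rule openin_open_Int)
  obtain M where M: "\<And>j. j < m \<Longrightarrow> \<bar>x j\<bar> \<le> M"
    using finite_imageI[OF finite_lessThan, of "\<lambda>j. \<bar>x j\<bar>" m]
    by (metis (no_types, lifting) Max_ge finite_imageI finite_lessThan imageI lessThan_iff)
  define N where "N = \<lceil>M\<rceil> + 3"
  define Z where "Z = {f :: nat \<Rightarrow> int. \<forall>j. (j \<in> {..<m} \<longrightarrow> f j \<in> {-N..N}) \<and> (j \<notin> {..<m} \<longrightarrow> f j = 0)}"
  have "finite Z"
    unfolding Z_def by (intro finite_set_of_finite_funs) auto
  have "c \<in> (\<lambda>(a, b). {y. \<forall>j. of_int (a j) \<le> y j \<and> y j \<le> of_int (b j)}) ` (Z \<times> Z)"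
    if c: "c \<in> grid_cell ` S" "(S \<inter> c) \<inter> V \<noteq> {}" for c
  proof -
    obtain z y where z: "z \<in> S" "c = grid_cell z" and y: "y \<in> grid_cell z" "y \<in> V"
      using c by blast
    have "\<bar>z j\<bar> < M + 2" if "j < m" for j
    proof -
      have "x j - 1 < y j" "y j < x j + 1" "of_int \<lfloor>z j\<rfloor> \<le> y j" "y j \<le> of_int \<lceil>z j\<rceil>"
        using y that by (auto simp: V_def grid_cell_def)
      then show ?thesis
        using M[OF that] by linarith
    qed
    then have "\<lfloor>z j\<rfloor> \<in> {-N..N} \<and> \<lceil>z j\<rceil> \<in> {-N..N}" if "j < m" for j
      using that[THEN \<open>\<And>j. j < m \<Longrightarrow> \<bar>z j\<bar> < M + 2\<close>] unfolding N_def atLeastAtMost_iff by linarith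
    moreover have "z j = 0" if "\<not> j < m" for j
      using z S that by auto
    ultimately have "(\<lambda>j. \<lfloor>z j\<rfloor>) \<in> Z" "(\<lambda>j. \<lceil>z j\<rceil>) \<in> Z"
      unfolding Z_def by auto
    then show ?thesis
      using z by (auto simp: grid_cell_def intro!: image_eqI[where x = "(\<lambda>j. \<lfloor>z j\<rfloor>, \<lambda>j. \<lceil>z j\<rceil>)"])
  qed
  then have "{c \<in> grid_cell ` S. (S \<inter> c) \<inter> V \<noteq> {}}
      \<subseteq> (\<lambda>(a, b). {y. \<forall>j. of_int (a j) \<le> y j \<and> y j \<le> of_int (b j)}) ` (Z \<times> Z)"
    by blast
  then have "finite {c \<in> grid_cell ` S. (S \<inter> c) \<inter> V \<noteq> {}}"
    by (rule finite_subset) (simp add: \<open>finite Z\<close>)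
  moreover have "x \<in> V"
    using x by (simp add: V_def)
  ultimately show "\<exists>V. openin (top_of_set S) V \<and> x \<in> V \<and> finite {c \<in> grid_cell ` S. (S \<inter> c) \<inter> V \<noteq> {}}"
    using V by blast
next
  fix c assume "c \<in> grid_cell ` S"
  then show "closedin (top_of_set S) (S \<inter> c)"
    using closed_grid_cell by (auto simp: closedin_closed)
next
  fix c assume "c \<in> grid_cell ` S"
  then obtain x where x: "x \<in> S" "c = grid_cell x"
    by blast
  show "continuous_map (subtopology (top_of_set S) (S \<inter> c)) Y g"
    using cont[OF x(1)] by (simp add: x(2) subtopology_subtopology Int_assoc[symmetric])
next
  fix x assume "x \<in> topspace (top_of_set S)"
  then show "\<exists>c. c \<in> grid_cell ` S \<and> x \<in> S \<inter> c \<and> g x = g x"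
    using grid_cell_self[of x] by auto
qed auto

lemma continuous_on_Max:
  fixes f :: "'i \<Rightarrow> 'a::topological_space \<Rightarrow> real"
  assumes "finite I" "I \<noteq> {}" "\<And>i. i \<in> I \<Longrightarrow> continuous_on S (f i)"
  shows "continuous_on S (\<lambda>x. Max ((\<lambda>i. f i x) ` I))"
  using assms
proof (induction I rule: finite_ne_induct)
  case (insert i I)
  have "continuous_on S (\<lambda>x. max (f i x) (Max ((\<lambda>i. f i x) ` I)))"
    using insert by (intro continuous_on_max) auto
  then show ?case
    using insert by simp
qed simp

lemma continuous_on_Min:
  fixes f :: "'i \<Rightarrow> 'a::topological_space \<Rightarrow> real"
  assumes "finite I" "I \<noteq> {}" "\<And>i. i \<in> I \<Longrightarrow> continuous_on S (f i)"
  shows "continuous_on S (\<lambda>x. Min ((\<lambda>i. f i x) ` I))"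
  using assms
proof (induction I rule: finite_ne_induct)
  case (insert i I)
  have "continuous_on S (\<lambda>x. min (f i x) (Min ((\<lambda>i. f i x) ` I)))"
    using insert by (intro continuous_on_min) auto
  then show ?case
    using insert by simp
qed simp

lemma continuous_on_coordinate: "continuous_on S (\<lambda>x. x j)"
  by (rule continuous_on_subset[OF continuous_on_product_coordinates]) simp

lemma continuous_map_if_le:
  assumes "continuous_on S p" "continuous_on S q"
    and "continuous_map (top_of_set {x \<in> S. p x \<le> q x}) Y f"
    and "continuous_map (top_of_set {x \<in> S. q x \<le> p x}) Y g"
    and "\<And>x. x \<in> S \<Longrightarrow> p x = q x \<Longrightarrow> f x = g x"
  shows "continuous_map (top_of_set S) Y (\<lambda>x. if p x \<le> (q x :: real) then f x else g x)"
proof (rule continuous_map_cases_le)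
  have "subtopology (top_of_set S) {x \<in> topspace (top_of_set S). P x} = top_of_set {x \<in> S. P x}" for P
    unfolding subtopology_subtopology by (rule arg_cong[where f = top_of_set]) auto
  with assms(3,4)
  show "continuous_map (subtopology (top_of_set S) {x \<in> topspace (top_of_set S). p x \<le> q x}) Y f"
    "continuous_map (subtopology (top_of_set S) {x \<in> topspace (top_of_set S). q x \<le> p x}) Y g"
    by simp_all
qed (use assms in auto)

lemma nsphere_top_of_set: "nsphere n = top_of_set {x. (\<Sum>i\<le>n. x i ^ 2) = 1 \<and> (\<forall>i>n. x i = 0)}"
  by (simp add: nsphere euclidean_product_topology)

section \<open>Extending maps over skeleta of the grid\<close>

text \<open>
  A \<open>(d + 1)\<close>-cube and its boundary form the pair of a disc and a sphere, so this is
  the extension of a null-homotopic map from the sphere to the disc.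
\<close>

lemma grid_cell_boundary_extension:
  fixes F :: "'e topology"
  assumes conn: "k_connected (int s - 1) F"
    and x: "\<forall>i\<ge>m. x i = 0" and dim: "cell_dim x \<le> s"
    and g: "continuous_map (top_of_set {y \<in> grid_cell x. cell_dim y < cell_dim x}) F g"
  obtains g' where "continuous_map (top_of_set (grid_cell x)) F g'"
    and "\<And>y. y \<in> grid_cell x \<Longrightarrow> cell_dim y < cell_dim x \<Longrightarrow> g' y = g y"
proof (cases "cell_dim x")
  case 0
  obtain c where "c \<in> topspace F"
    using conn unfolding k_connected_def by blast
  then show ?thesis
    using 0 by (intro that[of "\<lambda>_. c"]) auto
next
  case (Suc d)
  define J where "J = {j. x j \<notin> \<int>}"
  have "finite J" "card J = Suc d"
    using finite_non_integers[OF x] Suc by (simp_all add: J_def cell_dim_def)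
  then obtain e where e: "bij_betw e {..d} J"
    by (metis card_atMost finite_atMost finite_same_card_bij)
  define l where "l = the_inv_into {..d} e"
  have l: "l j \<le> d" "e (l j) = j" if "j \<in> J" for j
    using that e f_the_inv_into_f_bij_betw[OF e] the_inv_into_into[of e "{..d}" j "{..d}"]
    by (auto simp: l_def bij_betw_def)
  have le: "l (e i) = i" "e i \<in> J" if "i \<le> d" for i
    using that e by (auto simp: l_def bij_betw_def the_inv_into_f_f)
  \<comment> \<open>The coordinates \<open>w\<close> identify the cell with the cube of side \<open>2\<close> centred at the origin, \<open>mx\<close> is the sup
    norm on it, and \<open>\<psi>\<close> is the radial homeomorphism from the round sphere onto the boundary of the cell.\<close>
  define c where "c j = (of_int \<lfloor>x j\<rfloor> + of_int \<lceil>x j\<rceil>) / (2::real)" for j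
  have ceil: "\<lceil>x j\<rceil> = \<lfloor>x j\<rfloor> + 1" if "j \<in> J" for j
    using that unfolding J_def mem_Collect_eq ceiling_altdef by (metis Ints_of_int)
  have c: "of_int \<lfloor>x j\<rfloor> = c j - 1/2" "of_int \<lceil>x j\<rceil> = c j + 1/2" if "j \<in> J" for j
    using ceil[OF that] by (simp_all add: c_def field_simps)
  define w where "w y i = 2 * (y (e i) - c (e i))" for y :: "nat \<Rightarrow> real" and i
  define mx where "mx z = Max ((\<lambda>i. \<bar>z i\<bar>) ` {..d})" for z :: "nat \<Rightarrow> real"
  define nr where "nr z = sqrt (\<Sum>i\<le>d. z i ^ 2)" for z :: "nat \<Rightarrow> real"
  define \<psi> where "\<psi> z j = (if j \<in> J then c j + z (l j) / (2 * mx z) else x j)" for z j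
  define S where "S = {z :: nat \<Rightarrow> real. (\<Sum>i\<le>d. z i ^ 2) = 1 \<and> (\<forall>i>d. z i = 0)}"
  have mx_ge: "\<bar>z i\<bar> \<le> mx z" if "i \<le> d" for z i
    unfolding mx_def using that by (intro Max_ge) auto
  have mx_eq: "\<exists>i\<le>d. \<bar>z i\<bar> = mx z" for z
  proof -
    have "mx z \<in> (\<lambda>i. \<bar>z i\<bar>) ` {..d}"
      unfolding mx_def by (rule Max_in) auto
    then show ?thesis
      by (metis atMost_iff imageE)
  qed
  have nr_pos: "nr z > 0" if "mx z > 0" for z
  proof -
    obtain i where i: "i \<le> d" "\<bar>z i\<bar> = mx z"
      using mx_eq by blast
    then have "z i \<noteq> 0"
      using that by auto
    with i have "0 < (\<Sum>i\<le>d. z i ^ 2)"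
      by (intro sum_pos2[of _ i]) auto
    then show ?thesis
      by (simp add: nr_def)
  qed
  have mx_pos: "mx z > 0" if "z \<in> S" for z
  proof (rule ccontr)
    assume "\<not> mx z > 0"
    then have "z i = 0" if "i \<le> d" for i
      using mx_ge[OF that, of z] by linarith
    then have "(\<Sum>i\<le>d. z i ^ 2) = 0"
      by (intro sum.neutral) auto
    then show False
      using \<open>z \<in> S\<close> by (simp add: S_def)
  qed
  have mx_cont: "continuous_on A mx" for A
    unfolding mx_def by (intro continuous_on_Max continuous_on_rabs continuous_on_coordinate) auto
  have \<psi>_in: "\<psi> z \<in> grid_cell x \<and> cell_dim (\<psi> z) < cell_dim x" if z: "z \<in> S" for z
  proof -
    have "\<bar>z (l j) / (2 * mx z)\<bar> \<le> 1/2" if "j \<in> J" for j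
      using mx_ge[OF l(1)[OF that], of z] mx_pos[OF z] by (simp add: field_simps)
    then have "of_int \<lfloor>x j\<rfloor> \<le> \<psi> z j \<and> \<psi> z j \<le> of_int \<lceil>x j\<rceil>" for j
      using c[of j] unfolding \<psi>_def by (smt (verit) le_of_int_ceiling of_int_floor_le)
    then have in_cell: "\<psi> z \<in> grid_cell x"
      by (simp add: grid_cell_def)
    obtain i where i: "i \<le> d" "\<bar>z i\<bar> = mx z"
      using mx_eq by blast
    then have "z i = mx z \<or> z i = - mx z"
      by linarith
    then have "z i / (2 * mx z) = 1/2 \<or> z i / (2 * mx z) = - 1/2"
      using mx_pos[OF z] by auto
    then have "\<psi> z (e i) = c (e i) + 1/2 \<or> \<psi> z (e i) = c (e i) - 1/2"
      using le[OF i(1)] by (auto simp: \<psi>_def)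
    then have "\<psi> z (e i) \<in> \<int>"
      by (elim disjE) (simp_all only: c[OF le(2)[OF i(1)], symmetric] Ints_of_int)
    then have "{j. \<psi> z j \<notin> \<int>} \<subset> J"
      using grid_cell_integer[OF in_cell] le(2)[OF i(1)] by (auto simp: J_def)
    then have "cell_dim (\<psi> z) < cell_dim x"
      using psubset_card_mono[OF \<open>finite J\<close>] by (simp add: cell_dim_def J_def)
    with in_cell show ?thesis ..
  qed
  have "continuous_on S \<psi>"
  proof (rule continuous_on_coordinatewise_then_product)
    fix j
    show "continuous_on S (\<lambda>z. \<psi> z j)"
      by (cases "j \<in> J") (auto simp: \<psi>_def dest: mx_pos intro!: continuous_intros continuous_on_coordinate mx_cont)
  qed
  then have "continuous_map (nsphere d) (top_of_set {y \<in> grid_cell x. cell_dim y < cell_dim x}) \<psi>"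
    using \<psi>_in by (auto simp: nsphere_top_of_set S_def[symmetric])
  then have "continuous_map (nsphere d) F (g \<circ> \<psi>)"
    using g by (rule continuous_map_compose)
  moreover have "int d \<le> int s - 1"
    using dim Suc by simp
  ultimately obtain c0 where "homotopic_with (\<lambda>_. True) (nsphere d) F (g \<circ> \<psi>) (\<lambda>_. c0)"
    using conn unfolding k_connected_def by blast
  then obtain h where h: "continuous_map (prod_topology (top_of_set {0..1::real}) (nsphere d)) F h"
    and h01: "\<forall>z. h (0, z) = g (\<psi> z)" "\<forall>z. h (1, z) = c0"
    unfolding homotopic_with_def o_def by blast
  note h0 = h01(1)[rule_format] and h1 = h01(2)[rule_format]
  have nS: "nsphere d = top_of_set S"
    by (simp add: nsphere_top_of_set S_def)
  have hc: "continuous_map (top_of_set ({0..1::real} \<times> S)) F h"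
    using h unfolding nS prod_topology_subtopology_eu .
  define nw where "nw y = (\<lambda>i. if i \<le> d then w y i / nr (w y) else 0)" for y
  have nw_S: "nw y \<in> S" if "mx (w y) > 0" for y
  proof -
    have "(\<Sum>i\<le>d. nw y i ^ 2) = (\<Sum>i\<le>d. w y i ^ 2) / (nr (w y))\<^sup>2"
      by (simp add: nw_def power_divide sum_divide_distrib)
    also have "\<dots> = 1"
      using nr_pos[OF that] by (simp add: nr_def sum_nonneg)
    finally show ?thesis
      by (simp add: S_def nw_def)
  qed
  \<comment> \<open>The null-homotopy is spread over the outer half of the cube; on the inner half the map is constant,
    so nothing has to be checked at the centre, where radial projection is undefined.\<close>
  define g' where "g' y = (if mx (w y) \<le> 1/2 then c0 else h (2 - 2 * mx (w y), nw y))" for y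
  have w_cont: "continuous_on A w" for A
    unfolding w_def by (intro continuous_on_coordinatewise_then_product continuous_intros continuous_on_coordinate)
  have mw_cont: "continuous_on A (\<lambda>y. mx (w y))" for A
    by (rule continuous_on_compose2[OF mx_cont[of UNIV] w_cont]) simp
  have nrw_cont: "continuous_on A (\<lambda>y. nr (w y))" for A
    unfolding nr_def w_def by (intro continuous_intros continuous_on_coordinate)
  have w_le: "mx (w y) \<le> 1" if "y \<in> grid_cell x" for y
  proof -
    obtain i where i: "i \<le> d" "\<bar>w y i\<bar> = mx (w y)"
      using mx_eq by blast
    have "of_int \<lfloor>x (e i)\<rfloor> \<le> y (e i)" "y (e i) \<le> of_int \<lceil>x (e i)\<rceil>"
      using that by (simp_all add: grid_cell_def)
    then have "c (e i) - 1/2 \<le> y (e i)" "y (e i) \<le> c (e i) + 1/2"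
      unfolding c[OF le(2)[OF i(1)]] .
    then have "\<bar>w y i\<bar> \<le> 1"
      by (simp add: w_def abs_le_iff)
    with i(2) show ?thesis
      by simp
  qed
  have c0: "c0 \<in> topspace F"
  proof -
    obtain z where "z \<in> S"
      using in_topspace_nsphere[of d] unfolding nS topspace_euclidean_subtopology by blast
    then have "h (1, z) \<in> topspace F"
      using funcset_mem[OF continuous_map_funspace[OF hc], of "(1, z)"] by simp
    then show ?thesis using h1 by simp
  qed
  have "continuous_map (top_of_set (grid_cell x)) F g'"
    unfolding g'_def
  proof (rule continuous_map_if_le)
    let ?T = "{y \<in> grid_cell x. 1/2 \<le> mx (w y)}"
    have "continuous_on ?T nw"
    proof (rule continuous_on_coordinatewise_then_product)
      fix i
      show "continuous_on ?T (\<lambda>y. nw y i)"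
        unfolding nw_def
      proof (cases "i \<le> d")
        case True
        have "nr (w y) \<noteq> 0" if "y \<in> ?T" for y
          using nr_pos[of "w y"] that by force
        moreover have "continuous_on ?T (\<lambda>y. w y i)"
          by (rule continuous_on_product_then_coordinatewise[OF w_cont])
        ultimately show "continuous_on ?T (\<lambda>y. if i \<le> d then w y i / nr (w y) else 0)"
          using True by (simp add: continuous_on_divide nrw_cont)
      qed simp
    qed
    then have "continuous_on ?T (\<lambda>y. (2 - 2 * mx (w y), nw y))"
      by (rule continuous_on_Pair[OF continuous_on_diff[OF continuous_on_const continuous_on_mult_left[OF mw_cont]]])
    moreover have "(2 - 2 * mx (w y), nw y) \<in> {0..1} \<times> S" if "y \<in> ?T" for y
      using that w_le[of y] nw_S[of y] by auto
    ultimately have "continuous_map (top_of_set ?T) (top_of_set ({0..1} \<times> S)) (\<lambda>y. (2 - 2 * mx (w y), nw y))"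
      unfolding continuous_map_subtopology_eu by blast
    from continuous_map_compose[OF this hc]
    show "continuous_map (top_of_set ?T) F (\<lambda>y. h (2 - 2 * mx (w y), nw y))"
      by (simp only: o_def)
  next
    fix y assume "mx (w y) = 1/2"
    then have "2 - 2 * mx (w y) = 1"
      by simp
    then show "c0 = h (2 - 2 * mx (w y), nw y)"
      by (simp only: h1)
  qed (use c0 mw_cont in auto)
  moreover have "g' y = g y" if y: "y \<in> grid_cell x" "cell_dim y < cell_dim x" for y
  proof -
    have "\<exists>j\<in>J. y j \<in> \<int>"
    proof (rule ccontr)
      assume "\<not> ?thesis"
      then have "J \<subseteq> {j. y j \<notin> \<int>}"
        by blast
      then have "card J \<le> cell_dim y"
        unfolding cell_dim_def by (rule card_mono[OF finite_non_integers[OF grid_cell_support[OF y(1) x]]])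
      then show False
        using y(2) by (simp add: J_def cell_dim_def)
    qed
    then obtain j where j: "j \<in> J" "y j \<in> \<int>"
      by blast
    then obtain n where n: "y j = of_int n"
      by (auto elim: Ints_cases)
    have "of_int \<lfloor>x j\<rfloor> \<le> y j" "y j \<le> of_int \<lceil>x j\<rceil>"
      using y by (simp_all add: grid_cell_def)
    then have "n = \<lfloor>x j\<rfloor> \<or> n = \<lceil>x j\<rceil>"
      using ceil[OF j(1)] unfolding n by linarith
    then have "\<bar>w y (l j)\<bar> = 1"
      using c[OF j(1)] l[OF j(1)] by (auto simp: w_def n)
    then have mw: "mx (w y) = 1"
      using mx_ge[OF l(1)[OF j(1)], of "w y"] w_le[OF y(1)] by simp
    have nr0: "nr (w y) > 0"
      by (rule nr_pos) (simp add: mw)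
    have "mx (nw y) = 1 / nr (w y)"
    proof -
      obtain i where i: "i \<le> d" "\<bar>w y i\<bar> = 1"
        using mx_eq[of "w y"] mw by auto
      obtain i' where i': "i' \<le> d" "\<bar>nw y i'\<bar> = mx (nw y)"
        using mx_eq by blast
      have "1 / nr (w y) \<le> mx (nw y)"
        using mx_ge[OF i(1), of "nw y"] i nr0 by (simp add: nw_def)
      moreover have "mx (nw y) \<le> 1 / nr (w y)"
      proof -
        have "mx (nw y) = \<bar>w y i'\<bar> / nr (w y)"
          using i' nr0 by (simp add: nw_def)
        then show ?thesis
          using mx_ge[OF i'(1), of "w y"] nr0 mw by (simp add: divide_right_mono)
      qed
      ultimately show ?thesis by simp
    qed
    then have "\<psi> (nw y) = y"
    proof (intro ext)
      fix i
      assume m: "mx (nw y) = 1 / nr (w y)"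
      show "\<psi> (nw y) i = y i"
      proof (cases "i \<in> J")
        case True
        then show ?thesis
          using l[OF True] nr0 m by (simp add: \<psi>_def nw_def w_def field_simps)
      next
        case False
        then show ?thesis
          using grid_cell_integer[OF y(1), of i] by (simp add: \<psi>_def J_def)
      qed
    qed
    then show ?thesis
      using h0[of "nw y"] by (simp add: g'_def mw)
  qed
  ultimately show ?thesis
    by (rule that)
qed

text \<open>
  The new map may be prescribed on all cells inside \<open>W\<close>: these form a subcomplex, and only the remaining
  cells have to be filled, in the order of their dimensions.
\<close>

lemma grid_skeleton_extension:
  fixes F :: "'e topology"
  assumes conn: "k_connected (int s - 1) F"
    and \<sigma>: "continuous_map (top_of_set W) F \<sigma>"
  obtains g where "continuous_map (top_of_set {x. (\<forall>i\<ge>m. x i = 0) \<and> cell_dim x \<le> s}) F g"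
    and "\<And>x. \<lbrakk>\<forall>i\<ge>m. x i = 0; cell_dim x \<le> s; grid_cell x \<subseteq> W\<rbrakk> \<Longrightarrow> g x = \<sigma> x"
proof -
  define A where "A d = {x. (\<forall>i\<ge>m. x i = 0) \<and> (cell_dim x < d \<or> grid_cell x \<subseteq> W)}" for d
  have A_cell: "grid_cell x \<subseteq> A d" if "x \<in> A d" for x d
  proof
    fix y assume y: "y \<in> grid_cell x"
    show "y \<in> A d"
      using that grid_cell_mono[OF y] grid_cell_support[OF y] cell_dim_mono[OF y, of m]
      unfolding A_def by auto
  qed
  have "\<exists>g. continuous_map (top_of_set (A d)) F g \<and>
      (\<forall>x. (\<forall>i\<ge>m. x i = 0) \<longrightarrow> grid_cell x \<subseteq> W \<longrightarrow> g x = \<sigma> x)" if "d \<le> Suc s" for d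
    using that
  proof (induction d)
    case 0
    have "A 0 \<subseteq> W"
      using grid_cell_self by (auto simp: A_def)
    then have "continuous_map (top_of_set (A 0)) F \<sigma>"
      using \<sigma> continuous_map_from_subtopology_mono by blast
    then show ?case
      by blast
  next
    case (Suc d)
    then obtain g where g: "continuous_map (top_of_set (A d)) F g"
      and gW: "\<And>x. (\<forall>i\<ge>m. x i = 0) \<Longrightarrow> grid_cell x \<subseteq> W \<Longrightarrow> g x = \<sigma> x"
      by auto
    define C where "C = grid_cell ` {x. (\<forall>i\<ge>m. x i = 0) \<and> cell_dim x = d}"
    have "\<exists>g'. continuous_map (top_of_set c) F g' \<and> (\<forall>y\<in>c. cell_dim y < d \<longrightarrow> g' y = g y)" if "c \<in> C" for c
    proof -
      obtain x where x: "c = grid_cell x" "\<forall>i\<ge>m. x i = 0" "cell_dim x = d"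
        using \<open>c \<in> C\<close> by (auto simp: C_def)
      have "{y \<in> grid_cell x. cell_dim y < cell_dim x} \<subseteq> A d"
        using grid_cell_support[OF _ x(2)] x(3) by (auto simp: A_def)
      then have "continuous_map (top_of_set {y \<in> grid_cell x. cell_dim y < cell_dim x}) F g"
        using g continuous_map_from_subtopology_mono by blast
      from grid_cell_boundary_extension[OF conn x(2) _ this] show ?thesis
        using x Suc.prems by (metis Suc_le_mono)
    qed
    then obtain G where G: "\<And>c. c \<in> C \<Longrightarrow> continuous_map (top_of_set c) F (G c)"
      and Gg: "\<And>c y. c \<in> C \<Longrightarrow> y \<in> c \<Longrightarrow> cell_dim y < d \<Longrightarrow> G c y = g y"
      by metis
    define g' where "g' y = (if y \<in> A d then g y else G (grid_cell y) y)" for y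
    have "continuous_map (top_of_set (A (Suc d))) F g'"
    proof (rule continuous_map_grid_cells)
      show "A (Suc d) \<subseteq> {x. \<forall>i\<ge>m. x i = 0}"
        by (auto simp: A_def)
      fix x assume x: "x \<in> A (Suc d)"
      show "continuous_map (top_of_set (A (Suc d) \<inter> grid_cell x)) F g'"
      proof (cases "x \<in> A d")
        case True
        have "continuous_map (top_of_set (A (Suc d) \<inter> grid_cell x)) F g"
          using g A_cell[OF True] continuous_map_from_subtopology_mono by blast
        then show ?thesis
          by (rule continuous_map_eq) (use A_cell[OF True] in \<open>auto simp: g'_def\<close>)
      next
        case False
        then have xd: "cell_dim x = d" "\<forall>i\<ge>m. x i = 0" "\<not> grid_cell x \<subseteq> W"
          using x by (auto simp: A_def)
        then have xC: "grid_cell x \<in> C"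
          by (auto simp: C_def)
        have "G (grid_cell x) y = g' y" if y: "y \<in> grid_cell x" for y
        proof (cases "cell_dim y < d")
          case True
          then show ?thesis
            using Gg[OF xC y] grid_cell_support[OF y xd(2)] by (simp add: g'_def A_def)
        next
          case False
          then have "grid_cell y = grid_cell x"
            using grid_cell_eqI[OF y xd(2)] xd(1) by simp
          then show ?thesis
            using False xd(3) by (simp add: g'_def A_def)
        qed
        moreover have "continuous_map (top_of_set (A (Suc d) \<inter> grid_cell x)) F (G (grid_cell x))"
          using G[OF xC] continuous_map_from_subtopology_mono by blast
        ultimately show ?thesis
          by (elim continuous_map_eq) auto
      qed
    qed
    moreover have "g' x = \<sigma> x" if "\<forall>i\<ge>m. x i = 0" "grid_cell x \<subseteq> W" for x
      using gW[OF that] that by (simp add: g'_def A_def)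
    ultimately show ?case
      by blast
  qed
  from this[of "Suc s"] obtain g where g: "continuous_map (top_of_set (A (Suc s))) F g"
    and gW: "\<And>x. (\<forall>i\<ge>m. x i = 0) \<Longrightarrow> grid_cell x \<subseteq> W \<Longrightarrow> g x = \<sigma> x"
    by auto
  have "{x. (\<forall>i\<ge>m. x i = 0) \<and> cell_dim x \<le> s} \<subseteq> A (Suc s)"
    by (auto simp: A_def)
  then have "continuous_map (top_of_set {x. (\<forall>i\<ge>m. x i = 0) \<and> cell_dim x \<le> s}) F g"
    using g continuous_map_from_subtopology_mono by blast
  then show ?thesis
    using gW that by blast
qed

section \<open>Distances to skeleta of the coarse grid\<close>

text \<open>
  The coarse grid has the even integers as coordinates, so that each of its cells is subdivided by the
  cells of the integer grid. The function \<open>even_dist\<close> is the distance to the nearest even integer.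
\<close>

definition even_dist :: "real \<Rightarrow> real" where
  "even_dist y = (if even \<lfloor>y\<rfloor> then y - of_int \<lfloor>y\<rfloor> else of_int \<lfloor>y\<rfloor> + 1 - y)"

text \<open>
  On each unit interval, points with \<open>even_dist\<close> at most \<open>u\<close> go to the even end, points with
  \<open>even_dist\<close> at least \<open>v\<close> go to the odd end, and the part in between is stretched linearly.
\<close>

definition stretch :: "real \<Rightarrow> real \<Rightarrow> real \<Rightarrow> real" where
  "stretch u v y =
     (let d = max 0 (min 1 ((even_dist y - u) / (v - u)))
      in if even \<lfloor>y\<rfloor> then of_int \<lfloor>y\<rfloor> + d else of_int \<lfloor>y\<rfloor> + 1 - d)"

lemma floor_cases:
  assumes "of_int a \<le> y" "y \<le> of_int a + 1"
  obtains "\<lfloor>y\<rfloor> = a" | "\<lfloor>y\<rfloor> = a + 1" "y = of_int a + (1::real)"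
proof (cases "y = of_int a + 1")
  case True
  then have "\<lfloor>y\<rfloor> = a + 1"
    by linarith
  with True that(2) show ?thesis by blast
next
  case False
  then have "\<lfloor>y\<rfloor> = a"
    using assms by linarith
  with that(1) show ?thesis by blast
qed

lemma even_dist_between:
  assumes "of_int a \<le> y" "y \<le> of_int a + 1"
  shows "even_dist y = (if even a then y - of_int a else of_int a + 1 - y)"
  using assms by (cases rule: floor_cases[OF assms]) (auto simp: even_dist_def)

lemma stretch_between:
  assumes "of_int a \<le> y" "y \<le> of_int a + 1" and uv: "0 \<le> u" "u < v" "v \<le> 1"
  shows "stretch u v y =
    (let d = max 0 (min 1 ((even_dist y - u) / (v - u))) in if even a then of_int a + d else of_int a + 1 - d)"
proof (cases rule: floor_cases[OF assms(1,2)])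
  case 1
  then show ?thesis by (simp add: stretch_def Let_def)
next
  case 2
  have "even_dist y = (if even a then 1 else 0)"
    using even_dist_between[OF assms(1,2)] 2 by simp
  moreover have "1 \<le> (1 - u) / (v - u)" "(0 - u) / (v - u) \<le> 0"
    using uv by (simp_all add: field_simps)
  ultimately show ?thesis
    using 2 by (auto simp: stretch_def Let_def)
qed

lemma stretch_floor: "of_int \<lfloor>y\<rfloor> \<le> stretch u v y" "stretch u v y \<le> of_int \<lfloor>y\<rfloor> + 1"
  by (auto simp: stretch_def Let_def)

lemma stretch_near: "\<bar>stretch u v y - y\<bar> \<le> 1"
  using stretch_floor[where u = u and v = v and y = y] by linarith

lemma stretch_of_int:
  assumes "0 \<le> u" "u < v" "v \<le> 1" "y \<in> \<int>"
  shows "stretch u v y = y"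
proof -
  obtain a where a: "y = of_int a"
    using assms(4) by (rule Ints_cases)
  have "1 \<le> (1 - u) / (v - u)" "(0 - u) / (v - u) \<le> 0"
    using assms by (simp_all add: field_simps)
  then show ?thesis
    by (auto simp: stretch_def Let_def a even_dist_def)
qed

lemma stretch_le: "u < v \<Longrightarrow> even_dist y \<le> u \<Longrightarrow> stretch u v y \<in> \<int>"
proof -
  assume "u < v" "even_dist y \<le> u"
  then have "(even_dist y - u) / (v - u) \<le> 0"
    by (simp add: divide_le_0_iff)
  then show ?thesis
    by (auto simp: stretch_def Let_def)
qed

lemma stretch_ge: "u < v \<Longrightarrow> v \<le> even_dist y \<Longrightarrow> stretch u v y \<in> \<int>"
proof -
  assume "u < v" "v \<le> even_dist y"
  then have "1 \<le> (even_dist y - u) / (v - u)"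
    by (simp add: field_simps)
  then show ?thesis
    by (auto simp: stretch_def Let_def)
qed

lemma stretch_in_grid_cell:
  assumes "0 \<le> u" "u < v" "v \<le> 1"
  shows "(\<lambda>j. stretch u v (x j)) \<in> grid_cell x"
  unfolding grid_cell_def mem_Collect_eq
proof
  fix j
  show "of_int \<lfloor>x j\<rfloor> \<le> stretch u v (x j) \<and> stretch u v (x j) \<le> of_int \<lceil>x j\<rceil>"
  proof (cases "x j \<in> \<int>")
    case True
    then show ?thesis
      using stretch_of_int[OF assms True] by simp
  next
    case False
    then have "\<lceil>x j\<rceil> = \<lfloor>x j\<rfloor> + 1"
      unfolding ceiling_altdef by (metis Ints_of_int)
    then show ?thesis
      using stretch_floor[where y = "x j" and u = u and v = v] by simp
  qed
qed

lemma grid_cell_between: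
  assumes "y \<in> grid_cell x"
  shows "of_int \<lfloor>x j\<rfloor> \<le> y j \<and> y j \<le> of_int \<lfloor>x j\<rfloor> + 1"
proof -
  have "of_int \<lfloor>x j\<rfloor> \<le> y j" "y j \<le> of_int \<lceil>x j\<rceil>" "\<lceil>x j\<rceil> \<le> \<lfloor>x j\<rfloor> + 1"
    using assms by (auto simp: grid_cell_def ceiling_altdef)
  then show ?thesis
    by linarith
qed

lemma continuous_on_grid_cells:
  fixes g :: "(nat \<Rightarrow> real) \<Rightarrow> 'a::topological_space"
  assumes "S \<subseteq> {x. \<forall>i\<ge>m. x i = 0}"
    and "\<And>x. x \<in> S \<Longrightarrow> continuous_on (S \<inter> grid_cell x) g"
  shows "continuous_on S g"
  using continuous_map_grid_cells[OF assms(1), of euclidean g] assms(2) by simp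

lemma continuous_on_even_dist:
  fixes S :: "(nat \<Rightarrow> real) set"
  assumes "S \<subseteq> {x. \<forall>i\<ge>m. x i = 0}"
  shows "continuous_on S (\<lambda>x. even_dist (x j))"
proof (rule continuous_on_grid_cells[OF assms])
  fix x :: "nat \<Rightarrow> real"
  let ?a = "\<lfloor>x j\<rfloor>"
  have "continuous_on (S \<inter> grid_cell x) (\<lambda>y. if even ?a then y j - of_int ?a else of_int ?a + 1 - y j)"
    by (cases "even ?a") (auto intro!: continuous_intros continuous_on_coordinate)
  then show "continuous_on (S \<inter> grid_cell x) (\<lambda>y. even_dist (y j))"
  proof (rule continuous_on_eq)
    fix y assume "y \<in> S \<inter> grid_cell x"
    then show "(if even ?a then y j - of_int ?a else of_int ?a + 1 - y j) = even_dist (y j)"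
      using grid_cell_between[of y x j] even_dist_between[of ?a "y j"] by simp
  qed
qed

lemma continuous_on_stretch:
  fixes S :: "(nat \<Rightarrow> real) set"
  assumes S: "S \<subseteq> {x. \<forall>i\<ge>m. x i = 0}"
    and u: "continuous_on S u" and v: "continuous_on S v"
    and uv: "\<And>x. x \<in> S \<Longrightarrow> 0 \<le> u x \<and> u x < v x \<and> v x \<le> 1"
  shows "continuous_on S (\<lambda>x j. stretch (u x) (v x) (x j))"
proof (rule continuous_on_coordinatewise_then_product, rule continuous_on_grid_cells[OF S])
  fix j and x :: "nat \<Rightarrow> real"
  let ?a = "\<lfloor>x j\<rfloor>" and ?T = "S \<inter> grid_cell x"
  have T: "?T \<subseteq> S" by simp
  let ?d = "\<lambda>y. max 0 (min 1 ((even_dist (y j) - u y) / (v y - u y)))"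
  have "continuous_on ?T (\<lambda>y. even_dist (y j))"
    by (rule continuous_on_subset[OF continuous_on_even_dist[OF S] T])
  moreover have "v y - u y \<noteq> 0" if "y \<in> ?T" for y
    using uv[of y] that by auto
  ultimately have d: "continuous_on ?T ?d"
    by (intro continuous_on_max continuous_on_min continuous_on_const continuous_on_divide
        continuous_on_diff continuous_on_subset[OF u T] continuous_on_subset[OF v T]) auto
  have "continuous_on ?T (\<lambda>y. if even ?a then of_int ?a + ?d y else of_int ?a + 1 - ?d y)"
    by (cases "even ?a") (simp_all add: continuous_on_add continuous_on_diff d)
  then show "continuous_on ?T (\<lambda>y. stretch (u y) (v y) (y j))"
  proof (rule continuous_on_eq)
    fix y assume "y \<in> ?T"
    then show "(if even ?a then of_int ?a + ?d y else of_int ?a + 1 - ?d y) = stretch (u y) (v y) (y j)"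
      using stretch_between[of ?a "y j" "u y" "v y"] uv[of y] grid_cell_between[of y x j] by (simp add: Let_def)
  qed
qed

text \<open>
  For \<open>d > 0\<close> this is the sup-norm distance from \<open>x\<close> to the \<open>(d - 1)\<close>-skeleton of the coarse grid on
  \<open>\<real>\<^sup>m\<close>: a point lies on that skeleton when \<open>m + 1 - d\<close> of its coordinates are even integers. The extra
  element \<open>1\<close> is the largest possible distance, and it is the value for the empty skeleton, \<open>d = 0\<close>.
\<close>

definition skeleton_dist :: "nat \<Rightarrow> nat \<Rightarrow> (nat \<Rightarrow> real) \<Rightarrow> real" where
  "skeleton_dist m d x =
     Min (insert 1 ((\<lambda>J. Max (insert 0 ((\<lambda>j. even_dist (x j)) ` J))) ` {J. J \<subseteq> {..<m} \<and> card J = m + 1 - d}))"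

lemma finite_index_sets: "finite {J :: nat set. J \<subseteq> {..<m} \<and> card J = n}"
  by (rule finite_subset[of _ "Pow {..<m}"]) auto

lemma skeleton_dist_bounds: "0 \<le> skeleton_dist m d x" "skeleton_dist m d x \<le> 1"
proof -
  let ?A = "(\<lambda>J. Max (insert 0 ((\<lambda>j. even_dist (x j)) ` J))) ` {J. J \<subseteq> {..<m} \<and> card J = m + 1 - d}"
  have "0 \<le> r" if r: "r \<in> insert 1 ?A" for r
  proof (cases "r = 1")
    case False
    then obtain J where J: "J \<subseteq> {..<m}" "r = Max (insert 0 ((\<lambda>j. even_dist (x j)) ` J))"
      using r by auto
    then have "finite J"
      using finite_subset by blast
    then show ?thesis
      unfolding J(2) by (intro Max_ge) simp_all
  qed simp
  then show "0 \<le> skeleton_dist m d x"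
    unfolding skeleton_dist_def by (subst Min_ge_iff) (simp_all only: finite_insert finite_imageI finite_index_sets, simp_all)
qed (simp add: skeleton_dist_def finite_index_sets)

lemma skeleton_dist_0: "skeleton_dist m 0 x = 1"
proof -
  have "{J. J \<subseteq> {..<m} \<and> card J = m + 1 - 0} = {}"
  proof -
    have "\<not> (J \<subseteq> {..<m} \<and> card J = m + 1 - 0)" for J :: "nat set"
      using card_mono[OF finite_lessThan[of m], of J] by auto
    then show ?thesis
      by blast
  qed
  then show ?thesis
    by (simp only: skeleton_dist_def) simp
qed

lemma skeleton_dist_top: "m < d \<Longrightarrow> skeleton_dist m d x = 0"
proof -
  assume "m < d"
  then have "{J. J \<subseteq> {..<m} \<and> card J = m + 1 - d} = {{}}"
    using finite_subset[OF _ finite_lessThan] by auto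
  then show ?thesis
    by (simp only: skeleton_dist_def) simp
qed

lemma skeleton_dist_less:
  assumes "skeleton_dist m d x < 1"
  obtains J where "J \<subseteq> {..<m}" "card J = m + 1 - d" "\<And>j. j \<in> J \<Longrightarrow> even_dist (x j) \<le> skeleton_dist m d x"
proof -
  let ?A = "(\<lambda>J. Max (insert 0 ((\<lambda>j. even_dist (x j)) ` J))) ` {J. J \<subseteq> {..<m} \<and> card J = m + 1 - d}"
  have "skeleton_dist m d x \<in> insert 1 ?A"
    unfolding skeleton_dist_def by (rule Min_in) (simp_all add: finite_index_sets)
  then have "skeleton_dist m d x \<in> ?A"
    using assms by auto
  then obtain J where J: "J \<subseteq> {..<m}" "card J = m + 1 - d"
    and eq: "skeleton_dist m d x = Max (insert 0 ((\<lambda>j. even_dist (x j)) ` J))"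
    by blast
  have "finite J"
    using J(1) finite_subset by blast
  then have "even_dist (x j) \<le> skeleton_dist m d x" if "j \<in> J" for j
    unfolding eq using that by (intro Max_ge) auto
  with J that show ?thesis by blast
qed

lemma skeleton_dist_witness:
  assumes "J \<subseteq> {..<m}" "card J = m + 1 - d" "0 < skeleton_dist m d x"
  shows "\<exists>j\<in>J. skeleton_dist m d x \<le> even_dist (x j)"
proof -
  have fin: "finite J"
    using assms(1) finite_subset by blast
  have "skeleton_dist m d x \<le> Max (insert 0 ((\<lambda>j. even_dist (x j)) ` J))"
    unfolding skeleton_dist_def using assms(1,2) by (intro Min_le) (auto simp: finite_index_sets)
  moreover have "Max (insert 0 ((\<lambda>j. even_dist (x j)) ` J)) \<in> insert 0 ((\<lambda>j. even_dist (x j)) ` J)"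
    using fin by (intro Max_in) auto
  ultimately show ?thesis
    using assms(3) by auto
qed

lemma continuous_on_skeleton_dist:
  assumes "S \<subseteq> {x. \<forall>i\<ge>m. x i = 0}"
  shows "continuous_on S (skeleton_dist n d)"
proof -
  have fin: "finite {J :: nat set. J \<subseteq> {..<n} \<and> card J = n + 1 - d}" (is "finite ?\<J>")
    by (rule finite_index_sets)
  have 1: "skeleton_dist n d x = Min ((\<lambda>K. case K of None \<Rightarrow> 1
       | Some J \<Rightarrow> Max ((\<lambda>l. case l of None \<Rightarrow> 0 | Some j \<Rightarrow> even_dist (x j)) ` insert None (Some ` J))) ` insert None (Some ` ?\<J>))" for x
    by (simp add: skeleton_dist_def image_image)
  show ?thesis
    unfolding 1
  proof (rule continuous_on_Min)
    fix K assume K: "K \<in> insert None (Some ` ?\<J>)"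
    show "continuous_on S (\<lambda>x. case K of None \<Rightarrow> 1
       | Some J \<Rightarrow> Max ((\<lambda>l. case l of None \<Rightarrow> 0 | Some j \<Rightarrow> even_dist (x j)) ` insert None (Some ` J)))"
    proof (cases K)
      case (Some J)
      have "finite J"
        using K Some finite_subset[of J "{..<n}"] by auto
      then have "continuous_on S (\<lambda>x. Max ((\<lambda>l. case l of None \<Rightarrow> 0 | Some j \<Rightarrow> even_dist (x j)) ` insert None (Some ` J)))"
        by (intro continuous_on_Max) (auto intro: continuous_on_even_dist[OF assms])
      then show ?thesis
        using Some by simp
    qed simp
  qed (use fin in auto)
qed

text \<open>
  At least \<open>m - d - s\<close> coordinates are within the smaller distance \<open>u\<close> of an even integer and at most \<open>m - d\<close>
  are nearer than the larger distance \<open>v\<close>. Stretching makes the former even and all those beyond \<open>v\<close>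
  odd, which leaves at most \<open>s\<close> coordinates that are not integers.
\<close>

lemma cell_dim_stretch:
  assumes x: "\<forall>i\<ge>m. x i = 0"
    and less: "skeleton_dist m (d + s + 1) x < skeleton_dist m d x"
  shows "cell_dim (\<lambda>j. stretch (skeleton_dist m (d + s + 1) x) (skeleton_dist m d x) (x j)) \<le> s"
proof -
  define u where "u = skeleton_dist m (d + s + 1) x"
  define v where "v = skeleton_dist m d x"
  have uv: "0 \<le> u" "u < v" "v \<le> 1"
    using less skeleton_dist_bounds by (simp_all add: u_def v_def)
  define N where "N = {j. stretch u v (x j) \<notin> \<int>}"
  define T where "T = {j. j < m \<and> even_dist (x j) < v}"
  obtain J where J: "J \<subseteq> {..<m}" "card J = m + 1 - (d + s + 1)" "\<And>j. j \<in> J \<Longrightarrow> even_dist (x j) \<le> u"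
    using skeleton_dist_less[of m "d + s + 1" x] uv unfolding u_def v_def by (metis less_le_trans)
  have "d \<le> m"
    using skeleton_dist_top[of m d x] uv unfolding v_def by force
  have "card T \<le> m - d"
  proof (rule ccontr)
    assume "\<not> ?thesis"
    then have "m + 1 - d \<le> card T"
      by simp
    then obtain K where K: "K \<subseteq> T" "card K = m + 1 - d"
      by (metis obtain_subset_with_card_n)
    then have "\<exists>j\<in>K. v \<le> even_dist (x j)"
      using skeleton_dist_witness[of K m d x] uv unfolding v_def T_def by force
    then show False
      using K(1) by (force simp: T_def)
  qed
  have "N \<subseteq> T - J"
  proof
    fix j assume "j \<in> N"
    then have "stretch u v (x j) \<notin> \<int>"
      by (simp add: N_def)
    moreover from this have "x j \<notin> \<int>"
      using stretch_of_int[OF uv] by metis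
    ultimately show "j \<in> T - J"
      using x stretch_le[OF uv(2)] stretch_ge[OF uv(2)] J(3) unfolding T_def
      by (metis (mono_tags, lifting) DiffI Ints_0 linorder_not_le mem_Collect_eq)
  qed
  have "J \<subseteq> T"
    using J uv unfolding T_def by force
  have "finite T"
    by (simp add: T_def)
  have "card N \<le> card (T - J)"
    using \<open>N \<subseteq> T - J\<close> \<open>finite T\<close> by (intro card_mono) auto
  also have "\<dots> = card T - card J"
    using \<open>J \<subseteq> T\<close> \<open>finite T\<close> finite_subset by (intro card_Diff_subset) auto
  also have "\<dots> \<le> s"
    using \<open>card T \<le> m - d\<close> J(2) by simp
  finally show ?thesis
    by (simp add: cell_dim_def N_def u_def v_def)
qed

text \<open>At a zero of \<open>f\<close> the product is small because \<open>g\<close> is bounded; elsewhere \<open>g\<close> is continuous.\<close>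

lemma continuous_on_mult_bounded:
  fixes f g :: "'a::topological_space \<Rightarrow> real"
  assumes f: "continuous_on S f" and g: "continuous_on {x \<in> S. f x \<noteq> 0} g"
    and M: "\<And>x. x \<in> S \<Longrightarrow> \<bar>g x\<bar> \<le> M"
  shows "continuous_on S (\<lambda>x. f x * g x)"
  unfolding continuous_on_def
proof
  fix x assume x: "x \<in> S"
  have fx: "(f \<longlongrightarrow> f x) (at x within S)"
    using f x by (simp add: continuous_on_def)
  show "((\<lambda>x. f x * g x) \<longlongrightarrow> f x * g x) (at x within S)"
  proof (cases "f x = 0")
    case True
    have "((\<lambda>x. f x * g x) \<longlongrightarrow> 0) (at x within S)"
    proof (rule Lim_null_comparison)
      show "\<forall>\<^sub>F x in at x within S. norm (f x * g x) \<le> \<bar>f x\<bar> * M"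
      proof -
        have "norm (f y * g y) \<le> \<bar>f y\<bar> * M" if "y \<in> S" for y
          using M[OF that] by (simp add: abs_mult mult_left_mono)
        then show ?thesis
          unfolding eventually_at_topological by blast
      qed
      show "((\<lambda>x. \<bar>f x\<bar> * M) \<longlongrightarrow> 0) (at x within S)"
        using tendsto_mult_right[OF tendsto_rabs[OF fx], of M] True by simp
    qed
    then show ?thesis
      using True by simp
  next
    case False
    have "\<exists>U. open U \<and> U \<inter> S = (f -` (- {0})) \<inter> S"
      using f unfolding continuous_on_open_invariant by (metis open_Compl closed_singleton)
    then obtain U where U: "open U" "U \<inter> S = (f -` (- {0})) \<inter> S"
      by blast
    have "{x \<in> S. f x \<noteq> 0} = S \<inter> U"
      using U(2) by auto
    moreover have "x \<in> U"
      using U(2) x False by auto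
    ultimately have "at x within {x \<in> S. f x \<noteq> 0} = at x within S"
      using at_within_nhd[OF \<open>x \<in> U\<close> U(1), of "S \<inter> U" S] by auto
    moreover have "(g \<longlongrightarrow> g x) (at x within {x \<in> S. f x \<noteq> 0})"
      using g x False by (simp add: continuous_on_def)
    ultimately show ?thesis
      using fx by (auto intro: tendsto_mult)
  qed
qed

section \<open>Connectivity of joins\<close>

lemma disc_L2_set: "disc m = {x. (\<forall>i\<ge>m. x i = 0) \<and> L2_set x {..<m} \<le> 1}"
  by (auto simp: disc_def topspace_Euclidean_space L2_set_def)

lemma disc_boundary_L2_set: "disc_boundary m = {x. (\<forall>i\<ge>m. x i = 0) \<and> L2_set x {..<m} = 1}"
  by (auto simp: disc_boundary_def topspace_Euclidean_space L2_set_def)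

lemma continuous_on_L2_set: "continuous_on S (\<lambda>x. L2_set x {..<m})"
  unfolding L2_set_def by (intro continuous_intros continuous_on_coordinate)

definition direction :: "nat \<Rightarrow> (nat \<Rightarrow> real) \<Rightarrow> nat \<Rightarrow> real" where
  "direction m x = (\<lambda>i. x i / L2_set x {..<m})"

lemma L2_set_scale: "0 \<le> c \<Longrightarrow> L2_set (\<lambda>i. c * x i) {..<m} = c * L2_set x {..<m}"
  by (simp add: L2_set_right_distrib)

lemma direction_scale: "0 < c \<Longrightarrow> direction m (\<lambda>i. c * x i) = direction m x"
  by (simp add: direction_def L2_set_scale)

lemma direction_in_boundary:
  assumes "\<forall>i\<ge>m. x i = 0" "0 < L2_set x {..<m}"
  shows "direction m x \<in> disc_boundary m"
  using assms L2_set_scale[of "inverse (L2_set x {..<m})" x m]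
  by (simp add: direction_def disc_boundary_L2_set divide_inverse mult.commute)

lemma direction_boundary: "x \<in> disc_boundary m \<Longrightarrow> direction m x = x"
  by (simp add: direction_def disc_boundary_L2_set)

lemma continuous_on_direction:
  assumes "\<And>x. x \<in> S \<Longrightarrow> L2_set x {..<m} \<noteq> 0"
  shows "continuous_on S (direction m)"
proof (rule continuous_on_coordinatewise_then_product)
  fix i
  show "continuous_on S (\<lambda>x. direction m x i)"
    unfolding direction_def
    by (rule continuous_on_divide[OF continuous_on_coordinate continuous_on_L2_set]) (use assms in blast)
qed

lemma abs_le_L2_set:
  fixes x :: "nat \<Rightarrow> real"
  assumes "i < m"
  shows "\<bar>x i\<bar> \<le> L2_set x {..<m}"
proof -
  have "\<bar>x i\<bar> \<le> L2_set (\<lambda>i. \<bar>x i\<bar>) {..<m}"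
    using assms by (intro member_le_L2_set) auto
  then show ?thesis
    by (simp add: L2_set_def)
qed

lemma compact_disc_boundary: "compact (disc_boundary m)"
proof -
  have "compactin (product_topology (\<lambda>_. euclideanreal) UNIV) (PiE UNIV (\<lambda>_. {-1..1::real}))"
    by (simp add: compactin_PiE)
  then have "compact (PiE UNIV (\<lambda>_::nat. {-1..1::real}))"
    by (simp add: euclidean_product_topology)
  moreover have "closed (disc_boundary m)"
  proof -
    have "disc_boundary m = (\<Inter>i\<in>{m..}. {x. x i = 0}) \<inter> {x. L2_set x {..<m} = 1}"
      by (auto simp: disc_boundary_L2_set)
    then show ?thesis
      by (auto intro!: closed_INT closed_Int closed_Collect_eq continuous_on_coordinate continuous_on_L2_set continuous_on_const)
  qed
  moreover have "disc_boundary m \<subseteq> PiE UNIV (\<lambda>_. {-1..1})"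
  proof
    fix x assume x: "x \<in> disc_boundary m"
    have "\<bar>x i\<bar> \<le> 1" for i
    proof (cases "i < m")
      case True
      then show ?thesis
        using x abs_le_L2_set[OF True, of x] by (simp add: disc_boundary_L2_set)
    next
      case False
      then show ?thesis
        using x by (simp add: disc_boundary_L2_set)
    qed
    then have "- 1 \<le> x i \<and> x i \<le> 1" for i
      by (simp add: abs_le_iff minus_le_iff)
    then show "x \<in> PiE UNIV (\<lambda>_. {-1..1})"
      by auto
  qed
  ultimately show ?thesis
    by (metis compact_Int_closed inf.absorb2)
qed

text \<open>
  Uniform continuity in a form adapted to grids: a mesh \<open>1 / n\<close> that is fine enough keeps \<open>f\<close> positive on
  every grid cell that meets the disc in a point where \<open>f\<close> is at least \<open>\<epsilon>\<close>.
\<close>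

lemma positive_near_disc:
  fixes f :: "(nat \<Rightarrow> real) \<Rightarrow> real"
  assumes f: "continuous_on {x. \<forall>i\<ge>m. x i = 0} f" and "0 < \<epsilon>"
  obtains N :: real where "1 \<le> N"
    and "\<And>x y n. \<lbrakk>N \<le> n; x \<in> disc m; \<epsilon> \<le> f x; \<forall>i\<ge>m. y i = 0; \<And>i. \<bar>y i - x i\<bar> \<le> 1 / n\<rbrakk> \<Longrightarrow> 0 < f y"
proof -
  define K where "K = PiE UNIV (\<lambda>i. if i < m then {-2..2::real} else {0})"
  have "compactin (product_topology (\<lambda>_. euclideanreal) UNIV) K"
    unfolding K_def by (subst compactin_PiE) auto
  then have K: "compact K"
    by (simp add: euclidean_product_topology)
  have "K \<subseteq> {x. \<forall>i\<ge>m. x i = 0}"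
    by (auto simp: K_def PiE_iff) (metis not_le singletonD)
  then have "uniformly_continuous_on K f"
    using compact_uniformly_continuous[OF continuous_on_subset[OF f] K] by blast
  then obtain \<delta> where \<delta>: "0 < \<delta>" "\<And>x y. x \<in> K \<Longrightarrow> y \<in> K \<Longrightarrow> dist y x < \<delta> \<Longrightarrow> dist (f y) (f x) < \<epsilon>"
    using \<open>0 < \<epsilon>\<close> unfolding uniformly_continuous_on_def by metis
  obtain M where M: "(1/2)^M < \<delta> / 2"
    using real_arch_pow_inv[of "\<delta>/2" "1/2"] \<delta> by auto
  define N where "N = max 1 (5 / \<delta>)"
  show ?thesis
  proof (rule that)
    show "1 \<le> N"
      by (simp add: N_def)
    fix x y and n :: real
    assume n: "N \<le> n" and x: "x \<in> disc m" "\<epsilon> \<le> f x" and y: "\<forall>i\<ge>m. y i = 0" and xy: "\<And>i. \<bar>y i - x i\<bar> \<le> 1 / n"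
    have "1 \<le> n" "5 / \<delta> \<le> n"
      using n by (auto simp: N_def)
    then have n': "1 / n \<le> 1" "1 / n \<le> \<delta> / 5"
      using \<delta>(1) by (simp_all add: field_simps)
    have xb: "\<bar>x i\<bar> \<le> 1" if "i < m" for i
      using x(1) abs_le_L2_set[OF that, of x] by (simp add: disc_L2_set)
    have "x i \<in> {-2..2} \<and> y i \<in> {-2..2}" if "i < m" for i
    proof -
      have "\<bar>y i - x i\<bar> \<le> 1"
        using xy[of i] n'(1) by linarith
      then show ?thesis
        using xb[OF that] by auto
    qed
    then have "x \<in> K" "y \<in> K"
      using x y by (auto simp: K_def PiE_iff disc_L2_set)
    moreover have "dist y x < \<delta>"
    proof -
      have fin: "finite {dist (y (from_nat k)) (x (from_nat k)) |k. k \<le> M}" (is "finite ?D")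
        by simp
      have "Max ?D \<le> 1 / n"
        using xy by (subst Max_le_iff[OF fin]) (auto simp: dist_real_def)
      then have "dist y x \<le> 2 * (1 / n) + (1/2)^M"
        using dist_fun_le_dist_first_terms[of y x M] by linarith
      also have "\<dots> < \<delta>"
        using M n'(2) \<delta>(1) by linarith
      finally show ?thesis .
    qed
    ultimately have "dist (f y) (f x) < \<epsilon>"
      by (rule \<delta>(2))
    then show "0 < f y"
      using x(2) unfolding dist_real_def by linarith
  qed
qed


text \<open>
  The \<open>k\<close>-fold join of an \<open>(s - 1)\<close>-connected space is \<open>(k (s + 1) - 2)\<close>-connected; a map into the join is
  represented by its join coordinates \<open>t\<^sub>i\<close> and its components \<open>\<sigma>\<^sub>i\<close>, the latter defined where
  \<open>t\<^sub>i > 0\<close>. Two such data are available on the disc: near the boundary the radial extension of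
  \<open>(t, \<sigma>)\<close>, and in the interior the data obtained from the grid. They are combined by adding the
  join coordinates. Where both components are defined they are connected by the image under \<open>\<sigma>\<close> of a straight
  segment inside a grid cell.
\<close>

lemma join_extension:
  fixes F :: "'e topology" and t :: "nat \<Rightarrow> (nat \<Rightarrow> real) \<Rightarrow> real"
  assumes conn: "k_connected (int s - 1) F" and dim: "m < k * (s + 1)"
    and t: "\<And>i. i < k \<Longrightarrow> continuous_on (disc_boundary m) (t i)"
    and t_nonneg: "\<And>i x. i < k \<Longrightarrow> x \<in> disc_boundary m \<Longrightarrow> 0 \<le> t i x"
    and cover: "\<And>x. x \<in> disc_boundary m \<Longrightarrow> \<exists>i<k. 0 < t i x"
    and \<sigma>: "\<And>i. i < k \<Longrightarrow> continuous_map (top_of_set {x \<in> disc_boundary m. 0 < t i x}) F (\<sigma> i)"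
  obtains T \<tau> where "\<And>i. i < k \<Longrightarrow> continuous_on (disc m) (T i)"
    and "\<And>i x. i < k \<Longrightarrow> x \<in> disc m \<Longrightarrow> 0 \<le> T i x"
    and "\<And>x. x \<in> disc m \<Longrightarrow> \<exists>i<k. 0 < T i x"
    and "\<And>i. i < k \<Longrightarrow> continuous_map (top_of_set {x \<in> disc m. 0 < T i x}) F (\<tau> i)"
    and "\<And>i x. i < k \<Longrightarrow> x \<in> disc_boundary m \<Longrightarrow> T i x = t i x"
    and "\<And>i x. i < k \<Longrightarrow> x \<in> disc_boundary m \<Longrightarrow> 0 < t i x \<Longrightarrow> \<tau> i x = \<sigma> i x"
proof -
  define E where "E = {x :: nat \<Rightarrow> real. \<forall>i\<ge>m. x i = 0}"
  define r where "r x = L2_set x {..<m}" for x :: "nat \<Rightarrow> real"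
  have discE: "disc m \<subseteq> E"
    by (auto simp: disc_L2_set E_def)
  have r_cont: "continuous_on S r" for S
    unfolding r_def by (rule continuous_on_L2_set)
  have r_le: "r x \<le> 1" if "x \<in> disc m" for x
    using that by (simp add: disc_L2_set r_def)
  have r_bd: "r x = 1" if "x \<in> disc_boundary m" for x
    using that by (simp add: disc_boundary_L2_set r_def)
  have dir: "direction m x \<in> disc_boundary m" if "x \<in> E" "0 < r x" for x
    using direction_in_boundary that by (simp add: E_def r_def)
  have "0 < k"
    using dim by (cases k) auto
  obtain \<epsilon> where "0 < \<epsilon>" and \<epsilon>: "\<And>x. x \<in> disc_boundary m \<Longrightarrow> \<exists>i<k. 4 * \<epsilon> \<le> t i x"
  proof (cases "disc_boundary m = {}")
    case True
    then show ?thesis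
      using that[of 1] by simp
  next
    case False
    define mx where "mx x = Max ((\<lambda>i. t i x) ` {..<k})" for x
    have "continuous_on (disc_boundary m) mx"
      unfolding mx_def using \<open>0 < k\<close> by (intro continuous_on_Max t) auto
    then obtain x0 where x0: "x0 \<in> disc_boundary m" "\<And>x. x \<in> disc_boundary m \<Longrightarrow> mx x0 \<le> mx x"
      using continuous_attains_inf[OF compact_disc_boundary False] by blast
    have mx_in: "\<exists>i<k. mx x = t i x" for x
    proof -
      have "mx x \<in> (\<lambda>i. t i x) ` {..<k}"
        unfolding mx_def using \<open>0 < k\<close> by (intro Max_in) auto
      then show ?thesis by auto
    qed
    obtain i where "i < k" "0 < t i x0"
      using cover[OF x0(1)] by blast
    moreover from this have "t i x0 \<le> mx x0"
      unfolding mx_def by (intro Max_ge) auto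
    ultimately have "0 < mx x0"
      by linarith
    moreover have "\<exists>i<k. 4 * (mx x0 / 4) \<le> t i x" if "x \<in> disc_boundary m" for x
      using x0(2)[OF that] mx_in[of x] by auto
    ultimately show ?thesis
      using that[of "mx x0 / 4"] by simp
  qed
  \<comment> \<open>The radial extension of \<open>t\<close>, damped so that it is continuous at the centre.\<close>
  define f where "f i x = (if r x \<le> 1/2 then 0 else (2 * r x - 1) * t i (direction m x))" for i x
  have f_cont: "continuous_on E (f i)" if "i < k" for i
  proof -
    have "continuous_map (top_of_set E) euclideanreal (\<lambda>x. if r x \<le> 1/2 then 0 else (2 * r x - 1) * t i (direction m x))"
    proof (rule continuous_map_if_le)
      let ?S = "{x \<in> E. 1/2 \<le> r x}"
      have "continuous_on ?S (direction m)"
        by (rule continuous_on_direction) (auto simp: r_def)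
      moreover have "direction m ` ?S \<subseteq> disc_boundary m"
        using dir by force
      ultimately have "continuous_on ?S (\<lambda>x. t i (direction m x))"
        by (rule continuous_on_compose2[OF t[OF that]])
      then have "continuous_on ?S (\<lambda>x. (2 * r x - 1) * t i (direction m x))"
        by (intro continuous_intros r_cont)
      then show "continuous_map (top_of_set ?S) euclideanreal (\<lambda>x. (2 * r x - 1) * t i (direction m x))"
        by simp
    qed (use r_cont in auto)
    then show ?thesis
      by (simp add: f_def)
  qed
  have f_pos: "1/2 < r x \<and> 0 < t i (direction m x)" if "0 < f i x" for i x
    using that by (auto simp: f_def zero_less_mult_iff split: if_splits)
  have f_bd: "f i x = t i x" if "x \<in> disc_boundary m" for i x
    using r_bd[OF that] direction_boundary[OF that] by (simp add: f_def)
  have f_large: "\<exists>i<k. \<epsilon> < f i x" if "x \<in> E" "3/4 \<le> r x" for x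
  proof -
    obtain i where i: "i < k" "4 * \<epsilon> \<le> t i (direction m x)"
      using \<epsilon>[OF dir] \<open>x \<in> E\<close> \<open>3/4 \<le> r x\<close> by force
    have "1/2 * (4 * \<epsilon>) \<le> (2 * r x - 1) * t i (direction m x)"
      using i(2) \<open>3/4 \<le> r x\<close> \<open>0 < \<epsilon>\<close> by (intro mult_mono) auto
    then show ?thesis
      using i(1) \<open>3/4 \<le> r x\<close> \<open>0 < \<epsilon>\<close> by (auto simp: f_def intro!: exI[of _ i])
  qed
  have "\<forall>i\<in>{..<k}. \<exists>N\<ge>1. \<forall>x y n. N \<le> n \<longrightarrow> x \<in> disc m \<longrightarrow> \<epsilon> \<le> f i x \<longrightarrow> y \<in> E \<longrightarrow>
      (\<forall>j. \<bar>y j - x j\<bar> \<le> 1 / n) \<longrightarrow> 0 < f i y"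
    using positive_near_disc[OF f_cont[unfolded E_def] \<open>0 < \<epsilon>\<close>]
    by (smt (verit) E_def lessThan_iff mem_Collect_eq)
  then obtain N0 where N0: "\<And>i. i < k \<Longrightarrow> 1 \<le> N0 i"
    "\<And>i x y n. \<lbrakk>i < k; N0 i \<le> n; x \<in> disc m; \<epsilon> \<le> f i x; y \<in> E; \<And>j. \<bar>y j - x j\<bar> \<le> 1 / n\<rbrakk> \<Longrightarrow> 0 < f i y"
    by (metis lessThan_iff)
  define N where "N = Max (N0 ` {..<k})"
  have N: "N0 i \<le> N" if "i < k" for i
    unfolding N_def using that by (intro Max_ge) auto
  then have "1 \<le> N"
    using N0(1) \<open>0 < k\<close> by fastforce
  \<comment> \<open>Rather than refining the grid, the disc is enlarged by the factor \<open>N\<close>.\<close>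
  define sc where "sc x = (\<lambda>j. N * x j)" for x :: "nat \<Rightarrow> real"
  have sc_E: "sc x \<in> E" if "x \<in> E" for x
    using that by (simp add: sc_def E_def)
  have sc_cont: "continuous_on S sc" for S
    unfolding sc_def by (rule continuous_on_coordinatewise_then_product)
      (intro continuous_on_mult_left continuous_on_coordinate)
  define W where "W i = {y \<in> E. 0 < f i (\<lambda>j. y j / N)}" for i
  have div_r: "r (\<lambda>j. y j / N) = r y / N" and div_dir: "direction m (\<lambda>j. y j / N) = direction m y" for y
    using L2_set_scale[of "inverse N" y m] direction_scale[of "inverse N" m y] \<open>1 \<le> N\<close>
    by (simp_all add: r_def divide_inverse mult.commute)
  have W: "0 < r y \<and> 0 < t i (direction m y)" if "y \<in> W i" for i y
    using f_pos[of i "\<lambda>j. y j / N"] that \<open>1 \<le> N\<close> unfolding W_def div_r div_dir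
    by (auto simp: field_simps intro: order_less_trans[rotated])
  have \<sigma>_cont: "continuous_map (top_of_set (W i)) F (\<lambda>y. \<sigma> i (direction m y))" if "i < k" for i
  proof -
    have "continuous_on (W i) (direction m)"
      by (rule continuous_on_direction) (use W in \<open>force simp: r_def\<close>)
    moreover have "direction m y \<in> {x \<in> disc_boundary m. 0 < t i x}" if "y \<in> W i" for y
      using W[OF that] dir[of y] that by (auto simp: W_def)
    ultimately have "continuous_map (top_of_set (W i)) (top_of_set {x \<in> disc_boundary m. 0 < t i x}) (direction m)"
      unfolding continuous_map_subtopology_eu by blast
    from continuous_map_compose[OF this \<sigma>[OF that]] show ?thesis
      by (simp only: o_def)
  qed
  have cell_W: "grid_cell (sc x) \<subseteq> W i" if i: "i < k" and x: "x \<in> disc m" "\<epsilon> \<le> f i x" for i x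
  proof
    fix y assume y: "y \<in> grid_cell (sc x)"
    have "y \<in> E"
      using grid_cell_support[OF y, of m] sc_E x(1) discE by (auto simp: E_def)
    have "\<bar>y j / N - x j\<bar> \<le> 1 / N" for j
    proof -
      have "\<bar>y j - N * x j\<bar> \<le> 1"
        using grid_cell_between[OF y, of j] unfolding sc_def by linarith
      moreover have "y j / N - x j = (y j - N * x j) / N"
        using \<open>1 \<le> N\<close> by (simp add: field_simps)
      ultimately show ?thesis
        using \<open>1 \<le> N\<close> by (simp add: divide_right_mono)
    qed
    then have "0 < f i (\<lambda>j. y j / N)"
      using \<open>y \<in> E\<close> by (intro N0(2)[OF i N[OF i] x]) (auto simp: E_def)
    then show "y \<in> W i"
      using \<open>y \<in> E\<close> by (simp add: W_def)
  qed
  have "\<exists>g. continuous_map (top_of_set {x \<in> E. cell_dim x \<le> s}) F g \<and>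
      (\<forall>x. x \<in> E \<longrightarrow> cell_dim x \<le> s \<longrightarrow> grid_cell x \<subseteq> W i \<longrightarrow> g x = \<sigma> i (direction m x))" if "i < k" for i
  proof (rule grid_skeleton_extension[OF conn \<sigma>_cont[OF that], of m])
    fix h
    assume "continuous_map (top_of_set {x. (\<forall>i\<ge>m. x i = 0) \<and> cell_dim x \<le> s}) F h"
      "\<And>x. \<lbrakk>\<forall>i\<ge>m. x i = 0; cell_dim x \<le> s; grid_cell x \<subseteq> W i\<rbrakk> \<Longrightarrow> h x = \<sigma> i (direction m x)"
    then show ?thesis
      unfolding E_def mem_Collect_eq by blast
  qed
  then obtain g where g: "\<And>i. i < k \<Longrightarrow> continuous_map (top_of_set {x \<in> E. cell_dim x \<le> s}) F (g i)"
    and g\<sigma>: "\<And>i x. \<lbrakk>i < k; x \<in> E; cell_dim x \<le> s; grid_cell x \<subseteq> W i\<rbrakk> \<Longrightarrow> g i x = \<sigma> i (direction m x)"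
    by metis
  \<comment> \<open>Join coordinates \<open>a\<close> from the boundary data and \<open>b\<close> from the grid. The subtracted multiple of \<open>\<epsilon>\<close>
    vanishes on the sphere, where \<open>a\<close> has to equal \<open>t\<close>; for radius at most \<open>3/4\<close> it is \<open>\<epsilon>\<close>,
    so that wherever \<open>a\<close> and \<open>b\<close> are both positive the whole grid cell lies in the domain of \<open>\<sigma>\<close>. The point
    \<open>ln\<close> runs on a segment from \<open>sc x\<close>, where \<open>b = 0\<close>, to the stretched point \<open>\<rho>\<close>, where \<open>a = 0\<close>.\<close>
  define u where "u i x = skeleton_dist m (i * (s + 1) + s + 1) (sc x)" for i x
  define v where "v i x = skeleton_dist m (i * (s + 1)) (sc x)" for i x
  have uv_bounds: "0 \<le> u i x" "v i x \<le> 1" for i x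
    by (simp_all add: u_def v_def skeleton_dist_bounds)
  have uv_cont: "continuous_on S (u i)" "continuous_on S (v i)" if "S \<subseteq> E" for S i
  proof -
    have "sc ` S \<subseteq> E"
      using sc_E that by blast
    then have "continuous_on (sc ` S) (skeleton_dist m d)" for d
      unfolding E_def by (rule continuous_on_skeleton_dist)
    from continuous_on_compose2[OF this sc_cont]
    show "continuous_on S (u i)" "continuous_on S (v i)"
      unfolding u_def v_def by auto
  qed
  define a where "a i x = max 0 (f i x - \<epsilon> * min 1 (4 * (1 - r x)))" for i x
  define b where "b i x = max 0 (3/4 - r x) * max 0 (v i x - u i x)" for i x
  define T where "T i x = a i x + b i x" for i x
  define c where "c i x = b i x / (a i x + b i x)" for i x
  define \<rho> where "\<rho> i x = (\<lambda>j. stretch (u i x) (v i x) (sc x j))" for i x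
  define ln where "ln i x = (\<lambda>j. sc x j + c i x * (\<rho> i x j - sc x j))" for i x
  define \<tau> where "\<tau> i x = (if 0 \<le> max (r x - 3/4) (f i x - \<epsilon>) then \<sigma> i (direction m (ln i x)) else g i (\<rho> i x))" for i x
  have ab: "0 \<le> a i x" "0 \<le> b i x" for i x
    by (simp_all add: a_def b_def)
  have a_cont: "continuous_on (disc m) (a i)" if "i < k" for i
    unfolding a_def by (intro continuous_intros r_cont continuous_on_subset[OF f_cont[OF that] discE])
  have b_cont: "continuous_on (disc m) (b i)" for i
    unfolding b_def by (intro continuous_intros r_cont uv_cont discE)
  have T_cont: "continuous_on (disc m) (T i)" if "i < k" for i
    unfolding T_def by (intro continuous_on_add a_cont b_cont that)
  have b_pos: "r x < 3/4 \<and> u i x < v i x" if "0 < b i x" for i x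
    using that by (auto simp: b_def zero_less_mult_iff max_def split: if_splits)
  have a_inner: "a i x = max 0 (f i x - \<epsilon>)" if "r x \<le> 3/4" for i x
    using that by (simp add: a_def)
  have T_cover: "\<exists>i<k. 0 < T i x" if x: "x \<in> disc m" for x
  proof (cases "3/4 \<le> r x")
    case True
    then obtain i where i: "i < k" "\<epsilon> < f i x"
      using f_large x discE by blast
    have "\<epsilon> * min 1 (4 * (1 - r x)) \<le> \<epsilon> * 1"
      using \<open>0 < \<epsilon>\<close> by (intro mult_left_mono) auto
    then have "0 < a i x"
      using i(2) by (simp add: a_def)
    then show ?thesis
      using i(1) ab(2)[of i x] by (auto simp: T_def intro!: exI[of _ i])
  next
    case False
    have "\<exists>i<k. u i x < v i x"
    proof (rule ccontr)
      assume *: "\<not> ?thesis"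
      \<comment> \<open>Otherwise the distances would not decrease from \<open>1\<close> at index \<open>0\<close> to \<open>0\<close> at index \<open>k (s + 1)\<close>.\<close>
      have "skeleton_dist m 0 (sc x) \<le> skeleton_dist m (i * (s + 1)) (sc x)" if "i \<le> k" for i
        using that
      proof (induction i)
        case (Suc i)
        have "v i x \<le> u i x"
          using * Suc.prems by (meson Suc_le_lessD not_le)
        moreover have "Suc i * (s + 1) = i * (s + 1) + s + 1"
          by simp
        ultimately show ?case
          using Suc.IH Suc.prems unfolding u_def v_def by (metis Suc_leD order_trans)
      qed simp
      from this[of k] show False
        using skeleton_dist_top[OF dim, of "sc x"] skeleton_dist_0[of m "sc x"] by simp
    qed
    then obtain i where "i < k" "u i x < v i x"
      by blast
    then have "0 < b i x"
      using False by (simp add: b_def)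
    then show ?thesis
      using \<open>i < k\<close> ab(1)[of i x] by (auto simp: T_def intro!: exI[of _ i])
  qed
  have \<rho>_E: "\<rho> i x \<in> grid_cell (sc x)" "\<rho> i x \<in> E" "cell_dim (\<rho> i x) \<le> s" if "x \<in> disc m" "0 < b i x" for i x
  proof -
    have uv: "u i x < v i x"
      using b_pos[OF that(2)] by simp
    have scE: "\<forall>j\<ge>m. sc x j = 0"
      using sc_E that(1) discE by (auto simp: E_def)
    show *: "\<rho> i x \<in> grid_cell (sc x)"
      unfolding \<rho>_def by (rule stretch_in_grid_cell) (use uv uv_bounds in auto)
    show "\<rho> i x \<in> E"
      using grid_cell_support[OF * scE] by (simp add: E_def)
    show "cell_dim (\<rho> i x) \<le> s"
      using cell_dim_stretch[OF scE, of "i * (s + 1)" s] uv unfolding \<rho>_def u_def v_def by simp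
  qed
  have \<rho>_cont: "continuous_on {x \<in> disc m. 0 < b i x} (\<rho> i)" for i
  proof -
    let ?S = "{x \<in> disc m. 0 < b i x}"
    let ?u = "skeleton_dist m (i * (s + 1) + s + 1)" and ?v = "skeleton_dist m (i * (s + 1))"
    have "sc ` ?S \<subseteq> {x. \<forall>i\<ge>m. x i = 0}"
      using sc_E discE by (auto simp: E_def)
    then have "continuous_on (sc ` ?S) (\<lambda>x j. stretch (?u x) (?v x) (x j))"
      using b_pos[of i] skeleton_dist_bounds
      by (intro continuous_on_stretch continuous_on_skeleton_dist) (auto simp: u_def v_def)
    from continuous_on_compose2[OF this sc_cont] show ?thesis
      unfolding \<rho>_def u_def v_def by auto
  qed
  define D where "D i = {x \<in> disc m. 0 < T i x}" for i
  have D: "D i \<subseteq> disc m" for i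
    by (auto simp: D_def)
  have c_cont: "continuous_on (D i) (c i)" if "i < k" for i
    unfolding c_def
    by (intro continuous_on_divide continuous_on_add continuous_on_subset[OF a_cont[OF that] D]
        continuous_on_subset[OF b_cont D]) (auto simp: D_def T_def)
  have c_bounds: "0 \<le> c i x" "c i x \<le> 1" for i x
    using ab[of i x] by (auto simp: c_def divide_le_eq_1)
  have ln_cont: "continuous_on (D i) (ln i)" if i: "i < k" for i
  proof (rule continuous_on_coordinatewise_then_product)
    fix j
    have sub: "{x \<in> D i. c i x \<noteq> 0} \<subseteq> {x \<in> disc m. 0 < b i x}"
      using ab(2) by (auto simp: D_def c_def less_le)
    have scj: "continuous_on S (\<lambda>x. sc x j)" for S
      by (rule continuous_on_product_then_coordinatewise[OF sc_cont])
    \<comment> \<open>Where \<open>c = 0\<close> the point \<open>\<rho>\<close> need not depend continuously on \<open>x\<close>, but its distance from \<open>sc x\<close> is bounded.\<close>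
    have "continuous_on (D i) (\<lambda>x. c i x * (\<rho> i x j - sc x j))"
    proof (rule continuous_on_mult_bounded[OF c_cont[OF i]])
      show "continuous_on {x \<in> D i. c i x \<noteq> 0} (\<lambda>x. \<rho> i x j - sc x j)"
        by (rule continuous_on_diff[OF
              continuous_on_product_then_coordinatewise[OF continuous_on_subset[OF \<rho>_cont sub]] scj])
      show "\<bar>\<rho> i x j - sc x j\<bar> \<le> 1" for x
        unfolding \<rho>_def by (rule stretch_near)
    qed
    then show "continuous_on (D i) (\<lambda>x. ln i x j)"
      unfolding ln_def by (intro continuous_on_add scj)
  qed
  have ln_cell: "ln i x \<in> grid_cell (sc x)" if x: "x \<in> disc m" for i x
  proof (cases "0 < b i x")
    case True
    have "of_int \<lfloor>sc x j\<rfloor> \<le> ln i x j \<and> ln i x j \<le> of_int \<lceil>sc x j\<rceil>" for j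
    proof -
      let ?l = "real_of_int \<lfloor>sc x j\<rfloor>" and ?h = "real_of_int \<lceil>sc x j\<rceil>"
      have r: "?l \<le> \<rho> i x j" "\<rho> i x j \<le> ?h" "?l \<le> sc x j" "sc x j \<le> ?h"
        using \<rho>_E(1)[OF x True] by (auto simp: grid_cell_def)
      have eq: "ln i x j = (1 - c i x) * sc x j + c i x * \<rho> i x j"
        by (simp add: ln_def algebra_simps)
      have "(1 - c i x) * ?l + c i x * ?l \<le> ln i x j" "ln i x j \<le> (1 - c i x) * ?h + c i x * ?h"
        unfolding eq using r c_bounds by (intro add_mono mult_left_mono; simp)+
      then show ?thesis
        by (simp add: algebra_simps)
    qed
    then show ?thesis
      by (simp add: grid_cell_def)
  next
    case False
    then have "c i x = 0"
      using ab(2)[of i x] by (simp add: c_def)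
    then show ?thesis
      using grid_cell_self by (simp add: ln_def)
  qed
  have \<tau>_cont: "continuous_map (top_of_set (D i)) F (\<tau> i)" if i: "i < k" for i
    unfolding \<tau>_def
  proof (rule continuous_map_if_le)
    show "continuous_on (D i) (\<lambda>x. max (r x - 3/4) (f i x - \<epsilon>))"
      using continuous_on_subset[OF f_cont[OF i]] D discE
      by (auto intro!: continuous_on_max continuous_on_diff r_cont continuous_on_const)
    let ?A = "{x \<in> D i. 0 \<le> max (r x - 3/4) (f i x - \<epsilon>)}"
    let ?B = "{x \<in> D i. max (r x - 3/4) (f i x - \<epsilon>) \<le> 0}"
    have "ln i x \<in> W i" if x: "x \<in> ?A" for x
    proof (cases "3/4 \<le> r x")
      case True
      then have b0: "b i x = 0"
        by (simp add: b_def)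
      then have "0 < a i x"
        using x by (simp add: D_def T_def)
      moreover have "0 \<le> \<epsilon> * min 1 (4 * (1 - r x))"
        using r_le[of x] x \<open>0 < \<epsilon>\<close> D by (intro mult_nonneg_nonneg) auto
      ultimately have "0 < f i x"
        by (auto simp: a_def max_def split: if_splits)
      moreover have "ln i x = sc x" "sc x \<in> E"
        using b0 x D discE sc_E by (auto simp: ln_def c_def)
      moreover have "(\<lambda>j. sc x j / N) = x"
        using \<open>1 \<le> N\<close> by (simp add: sc_def)
      ultimately show ?thesis
        by (simp add: W_def)
    next
      case False
      then have "\<epsilon> \<le> f i x"
        using x by (auto simp: max_def split: if_splits)
      then show ?thesis
        using cell_W[OF i] ln_cell x D by blast
    qed
    then have "continuous_map (top_of_set ?A) (top_of_set (W i)) (ln i)"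
      unfolding continuous_map_subtopology_eu using continuous_on_subset[OF ln_cont[OF i]] by auto
    from continuous_map_compose[OF this \<sigma>_cont[OF i]]
    show "continuous_map (top_of_set ?A) F (\<lambda>x. \<sigma> i (direction m (ln i x)))"
      by (simp only: o_def)
    have B: "a i x = 0 \<and> 0 < b i x" if "x \<in> D i" "max (r x - 3/4) (f i x - \<epsilon>) \<le> 0" for x
    proof -
      have "a i x = 0"
        using that(2) a_inner[of x i] by auto
      then show ?thesis
        using that(1) by (simp add: D_def T_def)
    qed
    then have B_sub: "?B \<subseteq> {x \<in> disc m. 0 < b i x}"
      using D by auto
    moreover have "\<rho> i x \<in> {x \<in> E. cell_dim x \<le> s}" if "x \<in> {x \<in> disc m. 0 < b i x}" for x
      using \<rho>_E(2,3)[of x i] that by simp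
    ultimately have "\<rho> i \<in> ?B \<rightarrow> {x \<in> E. cell_dim x \<le> s}"
      by (meson Pi_I subsetD)
    then have "continuous_map (top_of_set ?B) (top_of_set {x \<in> E. cell_dim x \<le> s}) (\<rho> i)"
      unfolding continuous_map_subtopology_eu using continuous_on_subset[OF \<rho>_cont B_sub] by simp
    from continuous_map_compose[OF this g[OF i]]
    show "continuous_map (top_of_set ?B) F (\<lambda>x. g i (\<rho> i x))"
      by (simp only: o_def)
    fix x assume "x \<in> D i" and eq: "0 = max (r x - 3/4) (f i x - \<epsilon>)"
    then have x: "x \<in> D i" "x \<in> disc m"
      using D by auto
    then have B': "a i x = 0" "0 < b i x"
      using B[OF x(1)] unfolding eq[symmetric] by auto
    then have "\<epsilon> = f i x"
      using b_pos[of i x] eq by (auto simp: max_def split: if_splits)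
    then have "grid_cell (sc x) \<subseteq> W i"
      using cell_W[OF i x(2)] by simp
    then have "grid_cell (\<rho> i x) \<subseteq> W i"
      using grid_cell_mono[OF \<rho>_E(1)[OF x(2) B'(2)]] by blast
    moreover have "ln i x = \<rho> i x"
      using B' by (simp add: ln_def c_def)
    ultimately show "\<sigma> i (direction m (ln i x)) = g i (\<rho> i x)"
      using g\<sigma>[OF i \<rho>_E(2,3)[OF x(2) B'(2)]] by simp
  qed simp
  have bd: "a i x = t i x \<and> b i x = 0" if "i < k" "x \<in> disc_boundary m" for i x
    using t_nonneg[OF that] f_bd[OF that(2)] r_bd[OF that(2)] by (simp add: a_def b_def)
  show ?thesis
  proof (rule that[of T \<tau>])
    fix i x assume i: "i < k" and x: "x \<in> disc_boundary m"
    show "T i x = t i x"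
      using bd[OF i x] by (simp add: T_def)
    have "ln i x = sc x"
      using bd[OF i x] by (simp add: ln_def c_def)
    moreover have "direction m (sc x) = x"
      using direction_scale[of N m x] direction_boundary[OF x] \<open>1 \<le> N\<close> by (simp add: sc_def)
    ultimately show "\<tau> i x = \<sigma> i x"
      using r_bd[OF x] by (simp add: \<tau>_def le_max_iff_disj)
  next
    show "continuous_map (top_of_set {x \<in> disc m. 0 < T i x}) F (\<tau> i)" if "i < k" for i
      using \<tau>_cont[OF that] by (simp add: D_def)
  qed (use T_cont T_cover ab in \<open>auto simp: T_def\<close>)
qed

section \<open>Extending partial lifts over a disc\<close>

lemma continuous_map_scale_disc:
  assumes c: "continuous_map X euclideanreal c" and y: "continuous_map X (top_of_set (disc m)) y"
    and c01: "\<And>x. x \<in> topspace X \<Longrightarrow> 0 \<le> c x \<and> c x \<le> 1"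
  shows "continuous_map X (top_of_set (disc m)) (\<lambda>x j. c x * y x j)"
proof -
  have y': "continuous_map X (powertop_real UNIV) y"
    using y by (simp add: continuous_map_in_subtopology euclidean_product_topology)
  have "continuous_map X (powertop_real UNIV) (\<lambda>x j. c x * y x j)"
    using y' unfolding continuous_map_componentwise_UNIV by (auto intro: continuous_map_real_mult c)
  moreover have "(\<lambda>j. c x * y x j) \<in> disc m" if x: "x \<in> topspace X" for x
  proof -
    have "y x \<in> disc m"
      using y x by (auto simp: continuous_map_in_subtopology)
    moreover have "c x * L2_set (y x) {..<m} \<le> 1 * 1"
      using calculation c01[OF x] by (intro mult_mono) (auto simp: disc_L2_set)
    ultimately show ?thesis
      using c01[OF x] by (simp add: disc_L2_set L2_set_scale)
  qed
  ultimately show ?thesis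
    by (auto simp: continuous_map_in_subtopology euclidean_product_topology)
qed

definition lifts_homotopies :: "'y topology \<Rightarrow> 'e topology \<Rightarrow> 'b topology \<Rightarrow> ('e \<Rightarrow> 'b) \<Rightarrow> bool" where
  "lifts_homotopies Y E B p \<longleftrightarrow>
     (\<forall>f h. continuous_map Y E f \<longrightarrow>
        continuous_map (prod_topology (top_of_set {0..1::real}) Y) B h \<longrightarrow>
        (\<forall>y\<in>topspace Y. h (0, y) = p (f y)) \<longrightarrow>
        (\<exists>k. continuous_map (prod_topology (top_of_set {0..1}) Y) E k \<and>
           (\<forall>y\<in>topspace Y. k (0, y) = f y) \<and>
           (\<forall>t\<in>{0..1}. \<forall>y\<in>topspace Y. p (k (t, y)) = h (t, y))))"

text \<open>
  Contracting the disc to its centre moves the boundary data into the fibre over the centre, where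
  \<open>join_extension\<close> applies. This gives lifts of the map that is \<open>\<phi>\<close> of the centre on the inner half of the disc
  and sweeps out \<open>\<phi>\<close> on the outer half. One more application of the lifting property corrects
  the map to \<open>\<phi>\<close>.
\<close>

lemma lift_extension:
  fixes E :: "'e topology" and B :: "'b topology" and t :: "nat \<Rightarrow> (nat \<Rightarrow> real) \<Rightarrow> real"
  assumes lift: "\<And>V :: (nat \<Rightarrow> real) set. lifts_homotopies (top_of_set V) E B p"
    and \<phi>: "continuous_map (top_of_set (disc m)) B \<phi>"
    and conn: "k_connected (int s - 1) (subtopology E {e. p e = \<phi> (\<lambda>_. 0)})"
    and dim: "m < k * (s + 1)"
    and t: "\<And>i. i < k \<Longrightarrow> continuous_on (disc_boundary m) (t i)"
    and t_nonneg: "\<And>i x. i < k \<Longrightarrow> x \<in> disc_boundary m \<Longrightarrow> 0 \<le> t i x"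
    and cover: "\<And>x. x \<in> disc_boundary m \<Longrightarrow> \<exists>i<k. 0 < t i x"
    and \<sigma>: "\<And>i. i < k \<Longrightarrow> continuous_map (top_of_set {x \<in> disc_boundary m. 0 < t i x}) E (\<sigma> i)"
    and p\<sigma>: "\<And>i x. i < k \<Longrightarrow> x \<in> disc_boundary m \<Longrightarrow> 0 < t i x \<Longrightarrow> p (\<sigma> i x) = \<phi> x"
  obtains T \<tau> where "\<And>i. i < k \<Longrightarrow> continuous_on (disc m) (T i)"
    and "\<And>i x. i < k \<Longrightarrow> x \<in> disc m \<Longrightarrow> 0 \<le> T i x"
    and "\<And>x. x \<in> disc m \<Longrightarrow> \<exists>i<k. 0 < T i x"
    and "\<And>i. i < k \<Longrightarrow> continuous_map (top_of_set {x \<in> disc m. 0 < T i x}) E (\<tau> i)"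
    and "\<And>i x. i < k \<Longrightarrow> x \<in> disc m \<Longrightarrow> 0 < T i x \<Longrightarrow> p (\<tau> i x) = \<phi> x"
    and "\<And>i x. i < k \<Longrightarrow> x \<in> disc_boundary m \<Longrightarrow> T i x = t i x"
    and "\<And>i x. i < k \<Longrightarrow> x \<in> disc_boundary m \<Longrightarrow> 0 < t i x \<Longrightarrow> \<tau> i x = \<sigma> i x"
proof -
  let ?I = "{0..1::real}"
  define r where "r x = L2_set x {..<m}" for x :: "nat \<Rightarrow> real"
  have r_cont: "continuous_on S r" for S
    unfolding r_def by (rule continuous_on_L2_set)
  have r_disc: "0 \<le> r x \<and> r x \<le> 1" if "x \<in> disc m" for x
    using that by (simp add: disc_L2_set r_def)
  have r_bd: "x \<in> disc m \<and> r x = 1" if "x \<in> disc_boundary m" for x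
    using that by (simp add: disc_boundary_L2_set disc_L2_set r_def)
  have dir: "direction m x \<in> disc_boundary m" if "x \<in> disc m" "0 < r x" for x
    using direction_in_boundary that by (simp add: disc_L2_set r_def)
  have dir_scale: "r x * direction m x j = x j" if "0 < r x" for x j
    using that by (simp add: direction_def r_def)
  define W where "W i = {x \<in> disc_boundary m. 0 < t i x}" for i
  have W_disc: "W i \<subseteq> disc m" for i
    using r_bd by (auto simp: W_def)
  have radial: "continuous_map (top_of_set S) B (\<lambda>z. \<phi> (\<lambda>j. c z * snd z j))"
    if "S \<subseteq> ?I \<times> disc m" "continuous_on S c" "\<And>z. z \<in> S \<Longrightarrow> 0 \<le> c z \<and> c z \<le> 1" for S c
  proof -
    have "continuous_map (top_of_set S) (top_of_set (disc m)) snd"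
      unfolding continuous_map_subtopology_eu using that(1) by (auto intro: continuous_on_snd continuous_on_id)
    then have "continuous_map (top_of_set S) (top_of_set (disc m)) (\<lambda>z j. c z * snd z j)"
      using that by (intro continuous_map_scale_disc) auto
    from continuous_map_compose[OF this \<phi>] show ?thesis
      by (simp only: o_def)
  qed
  have fst_cont: "continuous_on S fst" for S :: "(real \<times> (nat \<Rightarrow> real)) set"
    by (intro continuous_on_fst continuous_on_id)
  have r_snd: "continuous_on S (\<lambda>z. r (snd z))" for S :: "(real \<times> (nat \<Rightarrow> real)) set"
    by (rule continuous_on_compose2[OF r_cont continuous_on_snd[OF continuous_on_id] subset_UNIV])

  have "\<exists>\<kappa>. continuous_map (top_of_set (?I \<times> W i)) E \<kappa> \<and> (\<forall>x\<in>W i. \<kappa> (0, x) = \<sigma> i x) \<and>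
      (\<forall>a\<in>?I. \<forall>x\<in>W i. p (\<kappa> (a, x)) = \<phi> (\<lambda>j. (1 - a) * x j))" if i: "i < k" for i
  proof -
    have h: "continuous_map (prod_topology (top_of_set ?I) (top_of_set (W i))) B (\<lambda>z. \<phi> (\<lambda>j. (1 - fst z) * snd z j))"
      unfolding prod_topology_subtopology_eu using W_disc[of i]
      by (intro radial continuous_on_diff continuous_on_const fst_cont) auto
    have f: "continuous_map (top_of_set (W i)) E (\<sigma> i)"
      using \<sigma>[OF i] by (simp add: W_def)
    have "\<forall>y\<in>topspace (top_of_set (W i)). \<phi> (\<lambda>j. (1 - fst (0::real, y)) * snd (0::real, y) j) = p (\<sigma> i y)"
      using p\<sigma>[OF i] by (simp add: W_def)
    with lift[of "W i", unfolded lifts_homotopies_def] f h show ?thesis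
      unfolding prod_topology_subtopology_eu topspace_euclidean_subtopology by fastforce
  qed
  then obtain \<kappa> where \<kappa>: "\<And>i. i < k \<Longrightarrow> continuous_map (top_of_set (?I \<times> W i)) E (\<kappa> i)"
    and \<kappa>0: "\<And>i x. \<lbrakk>i < k; x \<in> W i\<rbrakk> \<Longrightarrow> \<kappa> i (0, x) = \<sigma> i x"
    and p\<kappa>: "\<And>i a x. \<lbrakk>i < k; a \<in> ?I; x \<in> W i\<rbrakk> \<Longrightarrow> p (\<kappa> i (a, x)) = \<phi> (\<lambda>j. (1 - a) * x j)"
    by metis
  let ?F = "subtopology E {e. p e = \<phi> (\<lambda>_. 0)}"
  have "continuous_map (top_of_set {x \<in> disc_boundary m. 0 < t i x}) ?F (\<lambda>x. \<kappa> i (1, x))" if i: "i < k" for i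
  proof -
    have "continuous_map (top_of_set (W i)) (top_of_set (?I \<times> W i)) (\<lambda>x. (1, x))"
      unfolding continuous_map_subtopology_eu by (auto intro: continuous_on_Pair continuous_on_const continuous_on_id)
    from continuous_map_compose[OF this \<kappa>[OF i]] show ?thesis
      using p\<kappa>[OF i, of 1] by (auto simp: W_def o_def continuous_map_in_subtopology)
  qed
  note \<sigma>F = this
  obtain T0 \<tau>0 where T0: "\<And>i. i < k \<Longrightarrow> continuous_on (disc m) (T0 i)"
    and T0_nonneg: "\<And>i x. i < k \<Longrightarrow> x \<in> disc m \<Longrightarrow> 0 \<le> T0 i x"
    and T0_cover: "\<And>x. x \<in> disc m \<Longrightarrow> \<exists>i<k. 0 < T0 i x"
    and \<tau>0: "\<And>i. i < k \<Longrightarrow> continuous_map (top_of_set {x \<in> disc m. 0 < T0 i x}) ?F (\<tau>0 i)"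
    and T0_bd: "\<And>i x. i < k \<Longrightarrow> x \<in> disc_boundary m \<Longrightarrow> T0 i x = t i x"
    and \<tau>0_bd: "\<And>i x. i < k \<Longrightarrow> x \<in> disc_boundary m \<Longrightarrow> 0 < t i x \<Longrightarrow> \<tau>0 i x = \<kappa> i (1, x)"
    by (rule join_extension[OF conn dim t t_nonneg cover \<sigma>F]; (assumption | blast))

  define dbl where "dbl x = (\<lambda>j. 2 * x j)" for x :: "nat \<Rightarrow> real"
  have dbl_cont: "continuous_on S dbl" for S
    unfolding dbl_def by (rule continuous_on_coordinatewise_then_product)
      (intro continuous_on_mult_left continuous_on_coordinate)
  have dbl_disc: "dbl x \<in> disc m" if "x \<in> disc m" "r x \<le> 1/2" for x
    using that L2_set_scale[of 2 x m] by (simp add: disc_L2_set dbl_def r_def)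
  have dbl_half: "dbl x = direction m x" if "r x = 1/2" for x
  proof -
    have "direction m x = (\<lambda>i. x i / (1/2))"
      using that by (simp only: direction_def r_def)
    then show ?thesis
      by (simp add: dbl_def mult.commute)
  qed
  \<comment> \<open>Lifts of \<open>\<phi>\<close> precomposed with multiplication by the factor \<open>\<mu>\<close> below: the fibre data on the inner half of the disc,
    and on the outer half the lifted contraction, run backwards.\<close>
  define T where "T i x = (if r x \<le> 1/2 then T0 i (dbl x) else t i (direction m x))" for i x
  define V where "V i = {x \<in> disc m. 0 < T i x}" for i
  have dir_cont: "continuous_on S (direction m)" if "\<And>x. x \<in> S \<Longrightarrow> 1/2 \<le> r x" for S
    by (rule continuous_on_direction) (use that in \<open>force simp: r_def\<close>)
  have T_cont: "continuous_on (disc m) (T i)" if i: "i < k" for i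
  proof -
    have 1: "continuous_on {x \<in> disc m. r x \<le> 1/2} (\<lambda>x. T0 i (dbl x))"
      by (rule continuous_on_compose2[OF T0[OF i] dbl_cont]) (use dbl_disc in auto)
    have 2: "continuous_on {x \<in> disc m. 1/2 \<le> r x} (\<lambda>x. t i (direction m x))"
      by (rule continuous_on_compose2[OF t[OF i] dir_cont]) (use dir in force)+
    have 3: "T0 i (dbl x) = t i (direction m x)" if "x \<in> disc m" "r x = 1/2" for x
      using that dir[of x] T0_bd[OF i] dbl_half by simp
    have "continuous_map (top_of_set (disc m)) euclideanreal (\<lambda>x. if r x \<le> 1/2 then T0 i (dbl x) else t i (direction m x))"
      by (rule continuous_map_if_le) (use r_cont 1 2 3 in auto)
    then show ?thesis
      by (simp add: T_def)
  qed
  have dirW: "direction m x \<in> W i" if "i < k" "x \<in> disc m" "1/2 \<le> r x" "0 < T i x" for i x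
    using that dir[of x] T0_bd[of i "direction m x"] dbl_half[of x] by (auto simp: T_def W_def split: if_splits)
  have T_nonneg: "0 \<le> T i x" if "i < k" "x \<in> disc m" for i x
    using that T0_nonneg dbl_disc t_nonneg dir[of x] by (auto simp: T_def)
  have T_cover: "\<exists>i<k. 0 < T i x" if "x \<in> disc m" for x
    using that T0_cover[OF dbl_disc] cover[OF dir] by (cases "r x \<le> 1/2") (auto simp: T_def)
  define \<mu> where "\<mu> x = max 0 (2 * r x - 1)" for x
  define s1 where "s1 i x = (if r x \<le> 1/2 then \<tau>0 i (dbl x) else \<kappa> i (1 - (2 * r x - 1) * r x, direction m x))" for i x
  have time: "1 - (2 * r x - 1) * r x \<in> ?I" if "x \<in> disc m" "1/2 \<le> r x" for x
  proof -
    have "(2 * r x - 1) * r x \<le> 1 * 1" "0 \<le> (2 * r x - 1) * r x"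
      using that r_disc[of x] by (intro mult_mono mult_nonneg_nonneg; simp)+
    then show ?thesis by simp
  qed
  have s1_cont: "continuous_map (top_of_set (V i)) E (s1 i)" if i: "i < k" for i
    unfolding s1_def
  proof (rule continuous_map_if_le)
    have "dbl x \<in> {x \<in> disc m. 0 < T0 i x}" if "x \<in> {x \<in> V i. r x \<le> 1/2}" for x
      using that dbl_disc by (auto simp: V_def T_def split: if_splits)
    then have "continuous_map (top_of_set {x \<in> V i. r x \<le> 1/2}) (top_of_set {x \<in> disc m. 0 < T0 i x}) dbl"
      unfolding continuous_map_subtopology_eu using dbl_cont by blast
    from continuous_map_compose[OF this continuous_map_into_fulltopology[OF \<tau>0[OF i]]]
    show "continuous_map (top_of_set {x \<in> V i. r x \<le> 1/2}) E (\<lambda>x. \<tau>0 i (dbl x))"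
      by (simp only: o_def)
    let ?S = "{x \<in> V i. 1/2 \<le> r x}"
    have "(1 - (2 * r x - 1) * r x, direction m x) \<in> ?I \<times> W i" if "x \<in> ?S" for x
      using time[of x] dirW[OF i, of x] that unfolding V_def by blast
    moreover have "continuous_on ?S (\<lambda>x. (1 - (2 * r x - 1) * r x, direction m x))"
      by (intro continuous_on_Pair continuous_on_diff continuous_on_mult continuous_on_const r_cont dir_cont) auto
    ultimately have "continuous_map (top_of_set ?S) (top_of_set (?I \<times> W i)) (\<lambda>x. (1 - (2 * r x - 1) * r x, direction m x))"
      unfolding continuous_map_subtopology_eu by blast
    from continuous_map_compose[OF this \<kappa>[OF i]]
    show "continuous_map (top_of_set ?S) E (\<lambda>x. \<kappa> i (1 - (2 * r x - 1) * r x, direction m x))"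
      by (simp only: o_def)
    fix x assume "x \<in> V i" and half: "r x = 1/2"
    then have "direction m x \<in> W i"
      using dirW[OF i, of x] by (simp add: V_def)
    then show "\<tau>0 i (dbl x) = \<kappa> i (1 - (2 * r x - 1) * r x, direction m x)"
      using \<tau>0_bd[OF i] dbl_half[OF half] by (simp add: half W_def)
  qed (intro r_cont continuous_on_const)+
  have p_s1: "p (s1 i x) = \<phi> (\<lambda>j. \<mu> x * x j)" if i: "i < k" and x: "x \<in> V i" for i x
  proof (cases "r x \<le> 1/2")
    case True
    then have "dbl x \<in> {x \<in> disc m. 0 < T0 i x}"
      using x dbl_disc by (auto simp: V_def T_def split: if_splits)
    then have "\<tau>0 i (dbl x) \<in> topspace ?F"
      using funcset_mem[OF continuous_map_funspace[OF \<tau>0[OF i]]] unfolding topspace_euclidean_subtopology by blast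
    then show ?thesis
      using True by (simp add: s1_def \<mu>_def)
  next
    case False
    then have "p (s1 i x) = \<phi> (\<lambda>j. (2 * r x - 1) * r x * direction m x j)"
      using p\<kappa>[OF i time dirW, of x] i x by (simp add: s1_def V_def)
    also have "(\<lambda>j. (2 * r x - 1) * r x * direction m x j) = (\<lambda>j. \<mu> x * x j)"
      using dir_scale[of x] False by (auto simp: \<mu>_def mult.assoc)
    finally show ?thesis .
  qed
  have V_disc: "V i \<subseteq> disc m" for i
    by (auto simp: V_def)
  \<comment> \<open>The homotopy that scales by \<open>\<nu>\<close> has reached \<open>\<phi>\<close> at time \<open>1 - r x\<close>. Evaluating its lift at that time, and not
    at time \<open>1\<close>, leaves the boundary values unchanged.\<close>
  define \<nu> where "\<nu> z = min 1 (\<mu> (snd z) + 2 * fst z)" for z :: "real \<times> (nat \<Rightarrow> real)"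
  have \<mu>_le: "0 \<le> \<mu> x \<and> \<mu> x \<le> 1" if "x \<in> disc m" for x
    using r_disc[OF that] by (simp add: \<mu>_def)
  have "\<exists>K. continuous_map (top_of_set (?I \<times> V i)) E K \<and> (\<forall>x\<in>V i. K (0, x) = s1 i x) \<and>
      (\<forall>a\<in>?I. \<forall>x\<in>V i. p (K (a, x)) = \<phi> (\<lambda>j. \<nu> (a, x) * x j))" if i: "i < k" for i
  proof -
    have h: "continuous_map (prod_topology (top_of_set ?I) (top_of_set (V i))) B (\<lambda>z. \<phi> (\<lambda>j. \<nu> z * snd z j))"
      unfolding prod_topology_subtopology_eu
    proof (rule radial)
      show "?I \<times> V i \<subseteq> ?I \<times> disc m"
        using V_disc by blast
      show "continuous_on (?I \<times> V i) \<nu>"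
        unfolding \<nu>_def \<mu>_def
        by (intro continuous_on_min continuous_on_max continuous_on_add continuous_on_diff continuous_on_mult_left
            continuous_on_const r_snd fst_cont)
      show "0 \<le> \<nu> z \<and> \<nu> z \<le> 1" if "z \<in> ?I \<times> V i" for z
        using that \<mu>_le V_disc by (force simp: \<nu>_def)
    qed
    have "\<forall>y\<in>topspace (top_of_set (V i)). \<phi> (\<lambda>j. \<nu> (0, y) * snd (0::real, y) j) = p (s1 i y)"
      using p_s1[OF i] \<mu>_le V_disc[of i] by (auto simp: \<nu>_def min_absorb2)
    with lift[of "V i", unfolded lifts_homotopies_def] s1_cont[OF i] h show ?thesis
      unfolding prod_topology_subtopology_eu topspace_euclidean_subtopology by fastforce
  qed
  then obtain K where K: "\<And>i. i < k \<Longrightarrow> continuous_map (top_of_set (?I \<times> V i)) E (K i)"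
    and K0: "\<And>i x. \<lbrakk>i < k; x \<in> V i\<rbrakk> \<Longrightarrow> K i (0, x) = s1 i x"
    and pK: "\<And>i a x. \<lbrakk>i < k; a \<in> ?I; x \<in> V i\<rbrakk> \<Longrightarrow> p (K i (a, x)) = \<phi> (\<lambda>j. \<nu> (a, x) * x j)"
    by metis
  show ?thesis
  proof (rule that[of T "\<lambda>i x. K i (1 - r x, x)"])
    fix i assume i: "i < k"
    have "continuous_map (top_of_set (V i)) (top_of_set (?I \<times> V i)) (\<lambda>x. (1 - r x, x))"
      unfolding continuous_map_subtopology_eu using r_disc V_disc[of i]
      by (auto intro!: continuous_on_Pair continuous_on_diff continuous_on_const continuous_on_id r_cont)
    from continuous_map_compose[OF this K[OF i]]
    show "continuous_map (top_of_set {x \<in> disc m. 0 < T i x}) E (\<lambda>x. K i (1 - r x, x))"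
      by (simp add: o_def V_def)
  next
    fix i x assume i: "i < k" and x: "x \<in> disc m" "0 < T i x"
    then have "x \<in> V i" "1 - r x \<in> ?I"
      using r_disc[of x] by (auto simp: V_def)
    then have "p (K i (1 - r x, x)) = \<phi> (\<lambda>j. \<nu> (1 - r x, x) * x j)"
      by (intro pK i)
    moreover have "\<nu> (1 - r x, x) = 1"
      using r_disc[of x] x(1) by (auto simp: \<nu>_def \<mu>_def)
    ultimately show "p (K i (1 - r x, x)) = \<phi> x"
      by simp
  next
    fix i x assume i: "i < k" and x: "x \<in> disc_boundary m"
    have T: "T i x = t i x"
      using r_bd[OF x] direction_boundary[OF x] by (simp add: T_def)
    then show "T i x = t i x" .
    assume pos: "0 < t i x"
    then have "x \<in> V i" "x \<in> W i"
      using T r_bd[OF x] x by (auto simp: V_def W_def)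
    then show "K i (1 - r x, x) = \<sigma> i x"
      using K0[OF i, of x] \<kappa>0[OF i, of x] r_bd[OF x] direction_boundary[OF x] by (simp add: s1_def)
  qed (use T_cont T_nonneg T_cover in blast)+
qed

section \<open>Orbits and homotopy lifting on fixed points\<close>

lemma open_map_prod:
  assumes f: "open_map X X' f" and g: "open_map Y Y' g"
  shows "open_map (prod_topology X Y) (prod_topology X' Y') (\<lambda>(x, y). (f x, g y))"
  unfolding open_map_def
proof (intro allI impI)
  fix W assume W: "openin (prod_topology X Y) W"
  show "openin (prod_topology X' Y') ((\<lambda>(x, y). (f x, g y)) ` W)"
    unfolding openin_prod_topology_alt
  proof (intro allI impI)
    fix x' y' assume "(x', y') \<in> (\<lambda>(x, y). (f x, g y)) ` W"
    then obtain x y where "(x, y) \<in> W" and xy: "x' = f x" "y' = g y"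
      by auto
    then obtain U V where UV: "openin X U" "openin Y V" "x \<in> U" "y \<in> V" "U \<times> V \<subseteq> W"
      using W unfolding openin_prod_topology_alt by meson
    have "f ` U \<times> g ` V \<subseteq> (\<lambda>(x, y). (f x, g y)) ` W"
      using UV(5) by force
    moreover have "openin X' (f ` U)" "openin Y' (g ` V)"
      using f g UV by (auto simp: open_map_def)
    ultimately show "\<exists>U V. openin X' U \<and> openin Y' V \<and> x' \<in> U \<and> y' \<in> V \<and> U \<times> V \<subseteq> (\<lambda>(x, y). (f x, g y)) ` W"
      using UV xy by blast
  qed
qed

lemma quotient_map_prod_open:
  assumes "continuous_map X X' f" "open_map X X' f" "f ` topspace X = topspace X'"
    and "continuous_map Y Y' g" "open_map Y Y' g" "g ` topspace Y = topspace Y'"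
  shows "quotient_map (prod_topology X Y) (prod_topology X' Y') (\<lambda>(x, y). (f x, g y))"
proof (rule continuous_open_imp_quotient_map)
  show "continuous_map (prod_topology X Y) (prod_topology X' Y') (\<lambda>(x, y). (f x, g y))"
    using assms(1,4) by (simp add: case_prod_unfold continuous_map_paired continuous_map_prod_top)
      (intro conjI continuous_map_compose[OF continuous_map_fst, unfolded o_def]
        continuous_map_compose[OF continuous_map_snd, unfolded o_def])
  show "open_map (prod_topology X Y) (prod_topology X' Y') (\<lambda>(x, y). (f x, g y))"
    by (rule open_map_prod[OF assms(2,5)])
  show "(\<lambda>(x, y). (f x, g y)) ` topspace (prod_topology X Y) = topspace (prod_topology X' Y')"
    unfolding topspace_prod_topology assms(3,6)[symmetric] by force
qed

definition orbit_product :: "'g top_group \<Rightarrow> 'g set \<Rightarrow> 'y topology \<Rightarrow> ('g, 'g set \<times> 'y) gspace" where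
  "orbit_product G H Y =
     \<lparr>topo = prod_topology (orbit_topology G H) Y, act = (\<lambda>g (c, y). (g <#\<^bsub>G\<^esub> c, y))\<rparr>"

text \<open>
  The equivariant extension of a map \<open>\<phi>\<close> into \<open>H\<close>-fixed points, \<open>(g H, y) \<mapsto> g \<cdot> \<phi> y\<close>; the choice of the
  representative \<open>g\<close> does not matter because \<open>\<phi> y\<close> is fixed by \<open>H\<close>.
\<close>

definition orbit_extension ::
  "'g top_group \<Rightarrow> 'g set \<Rightarrow> ('g, 'a) gspace \<Rightarrow> ('y \<Rightarrow> 'a) \<Rightarrow> 'g set \<times> 'y \<Rightarrow> 'a" where
  "orbit_extension G H X \<phi> = (\<lambda>(c, y). act X (SOME g. g \<in> carrier G \<and> g <#\<^bsub>G\<^esub> H = c) (\<phi> y))"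

lemma G_cell_orbit_product: "G_cell G H n = orbit_product G H (top_of_set (disc n))"
proof -
  have "disc n \<subseteq> {x. \<forall>i\<ge>n. x i = 0}"
    by (auto simp: disc_L2_set)
  then show ?thesis
    by (simp add: G_cell_def orbit_product_def Euclidean_space_top_of_set subtopology_subtopology inf_absorb2)
qed

lemma act_in: "G_space G X \<Longrightarrow> topological_group G \<Longrightarrow> g \<in> carrier G \<Longrightarrow> x \<in> topspace (topo X) \<Longrightarrow> act X g x \<in> topspace (topo X)"
  using continuous_map_funspace[of "prod_topology (gtop G) (topo X)" "topo X" "\<lambda>(g, x). act X g x"]
  by (auto simp: G_space_def topological_group_def Pi_iff)

context
  fixes G :: "'g top_group" and H :: "'g set"
  assumes G: "topological_group G" and H: "subgroup H G" and H_closed: "closedin (gtop G) H"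
begin

lemma grp: "group G" and topspace_gtop: "topspace (gtop G) = carrier G"
  using G by (simp_all add: topological_group_def)

lemma topspace_orbit_topology: "topspace (orbit_topology G H) = lcosets\<^bsub>G\<^esub> H"
proof -
  have "openin (orbit_topology G H) (lcosets\<^bsub>G\<^esub> H)"
    unfolding openin_orbit_topology[OF grp H]
    using group.lcosets_part_G[OF grp H] openin_topspace[of "gtop G"] topspace_gtop by simp
  moreover have "topspace (orbit_topology G H) \<subseteq> lcosets\<^bsub>G\<^esub> H"
    using openin_topspace[of "orbit_topology G H"] unfolding openin_orbit_topology[OF grp H] by simp
  ultimately show ?thesis
    using openin_subset by blast
qed

lemma coset_eq_iff:
  assumes "a \<in> carrier G" "b \<in> carrier G"
  shows "a <#\<^bsub>G\<^esub> H = b <#\<^bsub>G\<^esub> H \<longleftrightarrow> inv\<^bsub>G\<^esub> a \<otimes>\<^bsub>G\<^esub> b \<in> H"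
proof
  assume "a <#\<^bsub>G\<^esub> H = b <#\<^bsub>G\<^esub> H"
  then have "b \<in> a <#\<^bsub>G\<^esub> H"
    using group.lcos_self[OF grp assms(2) H] by simp
  then show "inv\<^bsub>G\<^esub> a \<otimes>\<^bsub>G\<^esub> b \<in> H"
    by (rule subgroup.lcos_module_imp[OF H grp assms(1)])
next
  assume "inv\<^bsub>G\<^esub> a \<otimes>\<^bsub>G\<^esub> b \<in> H"
  then have "b \<in> a <#\<^bsub>G\<^esub> H"
    by (rule subgroup.lcos_module_rev[OF H grp assms])
  then show "a <#\<^bsub>G\<^esub> H = b <#\<^bsub>G\<^esub> H"
    using group.l_repr_independence[OF grp _ assms(1) H] by blast
qed

lemma coset_assoc:
  assumes "a \<in> carrier G" "b \<in> carrier G"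
  shows "a <#\<^bsub>G\<^esub> (b <#\<^bsub>G\<^esub> H) = (a \<otimes>\<^bsub>G\<^esub> b) <#\<^bsub>G\<^esub> H"
  using group.lcos_m_assoc[OF grp subgroup.subset[OF H] assms] .

lemma coset_self: "\<one>\<^bsub>G\<^esub> <#\<^bsub>G\<^esub> H = H"
  using group.lcos_mult_one[OF grp subgroup.subset[OF H]] .

lemma coset_in: "a \<in> carrier G \<Longrightarrow> a <#\<^bsub>G\<^esub> H \<in> lcosets\<^bsub>G\<^esub> H"
  by (auto simp: LCOSETS_def)

lemma coset_cases:
  assumes "c \<in> lcosets\<^bsub>G\<^esub> H"
  obtains g where "g \<in> carrier G" "c = g <#\<^bsub>G\<^esub> H"
  using assms by (auto simp: LCOSETS_def)

lemma subgroup_in_cosets: "H \<in> lcosets\<^bsub>G\<^esub> H"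
  using coset_in[of "\<one>\<^bsub>G\<^esub>"] coset_self group.is_monoid[OF grp] by (simp add: monoid.one_closed)

lemma Union_cosets:
  assumes "S \<subseteq> lcosets\<^bsub>G\<^esub> H"
  shows "\<Union>S = {g \<in> carrier G. g <#\<^bsub>G\<^esub> H \<in> S}"
proof (intro equalityI subsetI)
  fix g assume "g \<in> \<Union>S"
  then obtain c where c: "c \<in> S" "g \<in> c"
    by blast
  then obtain a where a: "a \<in> carrier G" "c = a <#\<^bsub>G\<^esub> H"
    using assms coset_cases by blast
  have g: "g \<in> carrier G"
    using subgroup.elemlcos_carrier[OF H grp a(1)] c(2) a(2) by blast
  moreover have "a <#\<^bsub>G\<^esub> H = g <#\<^bsub>G\<^esub> H"
    using group.l_repr_independence[OF grp _ a(1) H] c(2) a(2) by blast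
  ultimately show "g \<in> {g \<in> carrier G. g <#\<^bsub>G\<^esub> H \<in> S}"
    using c a by simp
next
  fix g assume "g \<in> {g \<in> carrier G. g <#\<^bsub>G\<^esub> H \<in> S}"
  then show "g \<in> \<Union>S"
    using group.lcos_self[OF grp _ H] by blast
qed

lemma continuous_map_coset: "continuous_map (gtop G) (orbit_topology G H) (\<lambda>g. g <#\<^bsub>G\<^esub> H)"
  unfolding continuous_map_def
proof (intro conjI allI impI)
  show "(\<lambda>g. g <#\<^bsub>G\<^esub> H) \<in> topspace (gtop G) \<rightarrow> topspace (orbit_topology G H)"
    by (simp add: topspace_orbit_topology topspace_gtop coset_in)
  fix S assume "openin (orbit_topology G H) S"
  then show "openin (gtop G) {g \<in> topspace (gtop G). g <#\<^bsub>G\<^esub> H \<in> S}"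
    unfolding openin_orbit_topology[OF grp H] topspace_gtop using Union_cosets by auto
qed

text \<open>The saturation of an open set \<open>U\<close> is the union of its right translates by elements of \<open>H\<close>.\<close>

lemma open_map_coset: "open_map (gtop G) (orbit_topology G H) (\<lambda>g. g <#\<^bsub>G\<^esub> H)"
  unfolding open_map_def
proof (intro allI impI)
  fix U assume U: "openin (gtop G) U"
  then have UG: "U \<subseteq> carrier G"
    using openin_subset topspace_gtop by blast
  have sub: "(\<lambda>g. g <#\<^bsub>G\<^esub> H) ` U \<subseteq> lcosets\<^bsub>G\<^esub> H"
    using UG coset_in by blast
  interpret gr: group G
    by (rule grp)
  have HG: "h \<in> carrier G" if "h \<in> H" for h
    using subgroup.mem_carrier[OF H that] .
  have trans: "continuous_map (gtop G) (gtop G) (\<lambda>g. g \<otimes>\<^bsub>G\<^esub> h)" if "h \<in> H" for h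
  proof -
    have "continuous_map (gtop G) (prod_topology (gtop G) (gtop G)) (\<lambda>g. (g, h))"
      using HG[OF that] by (intro continuous_map_pairedI) (auto simp: topspace_gtop)
    moreover have "continuous_map (prod_topology (gtop G) (gtop G)) (gtop G) (\<lambda>(x, y). x \<otimes>\<^bsub>G\<^esub> y)"
      using G by (simp add: topological_group_def)
    ultimately have "continuous_map (gtop G) (gtop G) ((\<lambda>(x, y). x \<otimes>\<^bsub>G\<^esub> y) \<circ> (\<lambda>g. (g, h)))"
      by (rule continuous_map_compose)
    then show ?thesis
      by (simp add: o_def)
  qed
  have "\<Union>((\<lambda>g. g <#\<^bsub>G\<^esub> H) ` U) = (\<Union>h\<in>H. {g \<in> topspace (gtop G). g \<otimes>\<^bsub>G\<^esub> h \<in> U})"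
  proof -
    have "(g <#\<^bsub>G\<^esub> H \<in> (\<lambda>g. g <#\<^bsub>G\<^esub> H) ` U) \<longleftrightarrow> (\<exists>h\<in>H. g \<otimes>\<^bsub>G\<^esub> h \<in> U)" if g: "g \<in> carrier G" for g
    proof
      assume "g <#\<^bsub>G\<^esub> H \<in> (\<lambda>g. g <#\<^bsub>G\<^esub> H) ` U"
      then obtain u where u: "u \<in> U" "g <#\<^bsub>G\<^esub> H = u <#\<^bsub>G\<^esub> H"
        by blast
      then have "inv\<^bsub>G\<^esub> g \<otimes>\<^bsub>G\<^esub> u \<in> H"
        using coset_eq_iff g UG by blast
      moreover have "g \<otimes>\<^bsub>G\<^esub> (inv\<^bsub>G\<^esub> g \<otimes>\<^bsub>G\<^esub> u) = u"
        using g u(1) UG by (auto simp: gr.m_assoc[symmetric])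
      ultimately show "\<exists>h\<in>H. g \<otimes>\<^bsub>G\<^esub> h \<in> U"
        using u(1) by metis
    next
      assume "\<exists>h\<in>H. g \<otimes>\<^bsub>G\<^esub> h \<in> U"
      then obtain h where h: "h \<in> H" "g \<otimes>\<^bsub>G\<^esub> h \<in> U"
        by blast
      have "inv\<^bsub>G\<^esub> g \<otimes>\<^bsub>G\<^esub> (g \<otimes>\<^bsub>G\<^esub> h) = h"
        using g HG[OF h(1)] by (simp add: gr.m_assoc[symmetric])
      then have "g <#\<^bsub>G\<^esub> H = (g \<otimes>\<^bsub>G\<^esub> h) <#\<^bsub>G\<^esub> H"
        using coset_eq_iff[OF g, of "g \<otimes>\<^bsub>G\<^esub> h"] h UG by auto
      then show "g <#\<^bsub>G\<^esub> H \<in> (\<lambda>g. g <#\<^bsub>G\<^esub> H) ` U"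
        using h(2) by blast
    qed
    then show ?thesis
      unfolding Union_cosets[OF sub] topspace_gtop by blast
  qed
  moreover have "openin (gtop G) (\<Union>h\<in>H. {g \<in> topspace (gtop G). g \<otimes>\<^bsub>G\<^esub> h \<in> U})"
    by (intro openin_Union ballI) (auto intro: openin_continuous_map_preimage[OF trans U])
  ultimately show "openin (orbit_topology G H) ((\<lambda>g. g <#\<^bsub>G\<^esub> H) ` U)"
    unfolding openin_orbit_topology[OF grp H] using sub by simp
qed

lemma coset_image: "(\<lambda>g. g <#\<^bsub>G\<^esub> H) ` topspace (gtop G) = topspace (orbit_topology G H)"
  by (auto simp: topspace_gtop topspace_orbit_topology LCOSETS_def)

text \<open>
  Products of quotient maps are not quotient maps in general, but products of open surjections are. Hence
  continuity of maps on \<open>G/H \<times> Y\<close> can be tested on \<open>G \<times> Y\<close>, for every space \<open>Y\<close>.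
\<close>

lemma quotient_map_coset_prod:
  "quotient_map (prod_topology (gtop G) Y) (prod_topology (orbit_topology G H) Y) (\<lambda>(g, y). (g <#\<^bsub>G\<^esub> H, y))"
  using quotient_map_prod_open[OF continuous_map_coset open_map_coset coset_image, of Y Y "\<lambda>y. y"]
  by (simp add: open_map_def)

text \<open>Two elements lie in different cosets when their quotient avoids the closed set \<open>H\<close>, an open condition on the pair.\<close>

lemma Hausdorff_orbit_topology: "Hausdorff_space (orbit_topology G H)"
  unfolding Hausdorff_space_def topspace_orbit_topology
proof (intro allI impI, elim conjE)
  fix c d assume cd: "c \<in> lcosets\<^bsub>G\<^esub> H" "d \<in> lcosets\<^bsub>G\<^esub> H" "c \<noteq> d"
  obtain a b where a: "a \<in> carrier G" "c = a <#\<^bsub>G\<^esub> H" and b: "b \<in> carrier G" "d = b <#\<^bsub>G\<^esub> H"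
    using cd by (metis coset_cases)
  let ?GG = "prod_topology (gtop G) (gtop G)"
  have "continuous_map ?GG (gtop G) (\<lambda>z. inv\<^bsub>G\<^esub> (fst z))"
    using G by (intro continuous_map_compose[OF continuous_map_fst, unfolded o_def]) (simp add: topological_group_def)
  then have "continuous_map ?GG ?GG (\<lambda>z. (inv\<^bsub>G\<^esub> (fst z), snd z))"
    by (intro continuous_map_pairedI continuous_map_snd)
  moreover have "continuous_map ?GG (gtop G) (\<lambda>(x, y). x \<otimes>\<^bsub>G\<^esub> y)"
    using G by (simp add: topological_group_def)
  ultimately have "continuous_map ?GG (gtop G) ((\<lambda>(x, y). x \<otimes>\<^bsub>G\<^esub> y) \<circ> (\<lambda>z. (inv\<^bsub>G\<^esub> (fst z), snd z)))"
    by (rule continuous_map_compose)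
  then have div: "continuous_map ?GG (gtop G) (\<lambda>z. inv\<^bsub>G\<^esub> (fst z) \<otimes>\<^bsub>G\<^esub> snd z)"
    by (simp add: o_def)
  have "openin ?GG {z \<in> topspace ?GG. inv\<^bsub>G\<^esub> (fst z) \<otimes>\<^bsub>G\<^esub> snd z \<in> topspace (gtop G) - H}"
    by (rule openin_continuous_map_preimage[OF div]) (use H_closed in auto)
  moreover have "(a, b) \<in> {z \<in> topspace ?GG. inv\<^bsub>G\<^esub> (fst z) \<otimes>\<^bsub>G\<^esub> snd z \<in> topspace (gtop G) - H}"
    using a b cd(3) coset_eq_iff[OF a(1) b(1)] grp
    by (auto simp: topspace_gtop intro!: monoid.m_closed[OF group.is_monoid] group.inv_closed)
  ultimately obtain U V where UV: "openin (gtop G) U" "openin (gtop G) V" "a \<in> U" "b \<in> V"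
    and sub: "U \<times> V \<subseteq> {z \<in> topspace ?GG. inv\<^bsub>G\<^esub> (fst z) \<otimes>\<^bsub>G\<^esub> snd z \<in> topspace (gtop G) - H}"
    unfolding openin_prod_topology_alt by meson
  have disj: "u <#\<^bsub>G\<^esub> H \<noteq> w <#\<^bsub>G\<^esub> H" if "u \<in> U" "w \<in> V" for u w
  proof -
    have "(u, w) \<in> {z \<in> topspace ?GG. inv\<^bsub>G\<^esub> (fst z) \<otimes>\<^bsub>G\<^esub> snd z \<in> topspace (gtop G) - H}"
      using sub that by blast
    then show ?thesis
      using coset_eq_iff[of u w] by (auto simp: topspace_gtop)
  qed
  let ?q = "\<lambda>g. g <#\<^bsub>G\<^esub> H"
  have "openin (orbit_topology G H) (?q ` U)" "openin (orbit_topology G H) (?q ` V)"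
    using open_map_coset UV by (auto simp: open_map_def)
  moreover have "disjnt (?q ` U) (?q ` V)"
    using disj by (auto simp: disjnt_def)
  ultimately show "\<exists>U V. openin (orbit_topology G H) U \<and> openin (orbit_topology G H) V \<and> c \<in> U \<and> d \<in> V \<and> disjnt U V"
    using UV a b by blast
qed

lemma G_space_orbit_product:
  assumes "Hausdorff_space Y"
  shows "G_space G (orbit_product G H Y)"
proof -
  let ?O = "orbit_topology G H"
  let ?q = "\<lambda>(g, z). (g, (\<lambda>(a, y). (a <#\<^bsub>G\<^esub> H, y)) z)"
  have q: "quotient_map (prod_topology (gtop G) (prod_topology (gtop G) Y))
      (prod_topology (gtop G) (prod_topology ?O Y)) ?q"
  proof -
    have "open_map (prod_topology (gtop G) Y) (prod_topology ?O Y) (\<lambda>(a, y). (a <#\<^bsub>G\<^esub> H, y))"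
      using open_map_prod[OF open_map_coset, of Y Y "\<lambda>y. y"] by (simp add: open_map_def)
    from quotient_map_prod_open[OF _ _ _ quotient_imp_continuous_map[OF quotient_map_coset_prod] this
        quotient_imp_surjective_map[OF quotient_map_coset_prod], of "gtop G" "gtop G" "\<lambda>g. g"]
    show ?thesis
      by (simp add: open_map_def)
  qed
  let ?P = "prod_topology (gtop G) (prod_topology (gtop G) Y)"
  have "continuous_map ?P (prod_topology (gtop G) (gtop G)) (\<lambda>w. (fst w, fst (snd w)))"
    by (intro continuous_map_pairedI continuous_map_fst continuous_map_compose[OF continuous_map_snd continuous_map_fst, unfolded o_def])
  moreover have "continuous_map (prod_topology (gtop G) (gtop G)) (gtop G) (\<lambda>(x, y). x \<otimes>\<^bsub>G\<^esub> y)"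
    using G by (simp add: topological_group_def)
  ultimately have "continuous_map ?P (gtop G) ((\<lambda>(x, y). x \<otimes>\<^bsub>G\<^esub> y) \<circ> (\<lambda>w. (fst w, fst (snd w))))"
    by (rule continuous_map_compose)
  from continuous_map_compose[OF this continuous_map_coset]
  have "continuous_map ?P ?O (\<lambda>w. (fst w \<otimes>\<^bsub>G\<^esub> fst (snd w)) <#\<^bsub>G\<^esub> H)"
    by (simp add: o_def)
  then have "continuous_map ?P (prod_topology ?O Y) (\<lambda>w. ((fst w \<otimes>\<^bsub>G\<^esub> fst (snd w)) <#\<^bsub>G\<^esub> H, snd (snd w)))"
    by (intro continuous_map_pairedI continuous_map_compose[OF continuous_map_snd continuous_map_snd, unfolded o_def])
  then have "continuous_map ?P (prod_topology ?O Y) ((\<lambda>(g, c, y). (g <#\<^bsub>G\<^esub> c, y)) \<circ> ?q)"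
    by (rule continuous_map_eq) (auto simp: topspace_gtop coset_assoc)
  from continuous_compose_quotient_map[OF q this]
  have "continuous_map (prod_topology (gtop G) (prod_topology ?O Y)) (prod_topology ?O Y) (\<lambda>(g, c, y). (g <#\<^bsub>G\<^esub> c, y))" .
  moreover have "Hausdorff_space (prod_topology ?O Y)"
    using Hausdorff_orbit_topology assms by (simp add: Hausdorff_space_prod_topology)
  moreover have "\<one>\<^bsub>G\<^esub> <#\<^bsub>G\<^esub> c = c" if "c \<in> lcosets\<^bsub>G\<^esub> H" for c
    using that by (rule coset_cases) (simp add: coset_assoc group.is_monoid[OF grp] monoid.one_closed monoid.l_one)
  moreover have "(g \<otimes>\<^bsub>G\<^esub> h) <#\<^bsub>G\<^esub> c = g <#\<^bsub>G\<^esub> (h <#\<^bsub>G\<^esub> c)"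
    if "c \<in> lcosets\<^bsub>G\<^esub> H" "g \<in> carrier G" "h \<in> carrier G" for c g h
    using that(1) by (rule coset_cases)
      (simp add: coset_assoc that group.is_monoid[OF grp] monoid.m_closed monoid.m_assoc)
  ultimately show ?thesis
    by (auto simp: G_space_def orbit_product_def topspace_orbit_topology case_prod_unfold)
qed

lemma orbit_extension_coset:
  assumes X: "G_space G X" and g: "g \<in> carrier G" and y: "\<phi> y \<in> fixed_points X H"
  shows "orbit_extension G H X \<phi> (g <#\<^bsub>G\<^esub> H, y) = act X g (\<phi> y)"
proof -
  define a where "a = (SOME a. a \<in> carrier G \<and> a <#\<^bsub>G\<^esub> H = g <#\<^bsub>G\<^esub> H)"
  have a: "a \<in> carrier G" "g <#\<^bsub>G\<^esub> H = a <#\<^bsub>G\<^esub> H"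
    unfolding a_def using someI[of "\<lambda>a. a \<in> carrier G \<and> a <#\<^bsub>G\<^esub> H = g <#\<^bsub>G\<^esub> H" g] g by auto
  define h where "h = inv\<^bsub>G\<^esub> g \<otimes>\<^bsub>G\<^esub> a"
  have h: "h \<in> H"
    using coset_eq_iff[OF g a(1)] a(2) by (simp add: h_def)
  have hG: "h \<in> carrier G"
    using subgroup.mem_carrier[OF H h] .
  interpret gr: group G
    by (rule grp)
  have "a = g \<otimes>\<^bsub>G\<^esub> h"
    unfolding h_def using a(1) g by (simp add: gr.m_assoc[symmetric])
  moreover have "\<phi> y \<in> topspace (topo X)" "act X h (\<phi> y) = \<phi> y"
    using y h by (auto simp: fixed_points_def)
  ultimately have "act X a (\<phi> y) = act X g (\<phi> y)"
    using X g hG by (simp add: G_space_def)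
  then show ?thesis
    by (simp add: orbit_extension_def a_def)
qed

lemma orbit_extension_subgroup:
  assumes X: "G_space G X" and y: "\<phi> y \<in> fixed_points X H"
  shows "orbit_extension G H X \<phi> (H, y) = \<phi> y"
proof -
  have "\<one>\<^bsub>G\<^esub> \<in> carrier G"
    using group.is_monoid[OF grp] by (simp add: monoid.one_closed)
  from orbit_extension_coset[where \<phi> = \<phi>, OF X this y] show ?thesis
    using X y by (simp add: coset_self G_space_def fixed_points_def)
qed

lemma continuous_map_orbit_extension:
  assumes X: "G_space G X" and \<phi>: "continuous_map Y (topo X) \<phi>"
    and fixed: "\<And>y. y \<in> topspace Y \<Longrightarrow> \<phi> y \<in> fixed_points X H"
  shows "continuous_map (prod_topology (orbit_topology G H) Y) (topo X) (orbit_extension G H X \<phi>)"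
proof (rule continuous_compose_quotient_map[OF quotient_map_coset_prod])
  have "continuous_map (prod_topology (gtop G) Y) (prod_topology (gtop G) (topo X)) (\<lambda>z. (fst z, \<phi> (snd z)))"
    by (intro continuous_map_pairedI continuous_map_fst continuous_map_compose[OF continuous_map_snd \<phi>, unfolded o_def])
  moreover have "continuous_map (prod_topology (gtop G) (topo X)) (topo X) (\<lambda>(g, x). act X g x)"
    using X by (simp add: G_space_def)
  ultimately have "continuous_map (prod_topology (gtop G) Y) (topo X) ((\<lambda>(g, x). act X g x) \<circ> (\<lambda>z. (fst z, \<phi> (snd z))))"
    by (rule continuous_map_compose)
  then show "continuous_map (prod_topology (gtop G) Y) (topo X) (orbit_extension G H X \<phi> \<circ> (\<lambda>(g, y). (g <#\<^bsub>G\<^esub> H, y)))"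
    by (rule continuous_map_eq) (auto simp: orbit_extension_coset[OF X] fixed topspace_gtop)
qed

lemma orbit_extension_act:
  assumes X: "G_space G X" and g: "g \<in> carrier G" and c: "c \<in> lcosets\<^bsub>G\<^esub> H" and y: "\<phi> y \<in> fixed_points X H"
  shows "orbit_extension G H X \<phi> (g <#\<^bsub>G\<^esub> c, y) = act X g (orbit_extension G H X \<phi> (c, y))"
  using c
proof (rule coset_cases)
  fix a assume a: "a \<in> carrier G" "c = a <#\<^bsub>G\<^esub> H"
  have "g \<otimes>\<^bsub>G\<^esub> a \<in> carrier G"
    using g a group.is_monoid[OF grp] by (simp add: monoid.m_closed)
  then show ?thesis
    using X g a y by (simp add: coset_assoc orbit_extension_coset[OF X] G_space_def fixed_points_def)
qed

lemma G_map_orbit_extension: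
  assumes X: "G_space G X" and \<phi>: "continuous_map Y (topo X) \<phi>"
    and fixed: "\<And>y. y \<in> topspace Y \<Longrightarrow> \<phi> y \<in> fixed_points X H"
  shows "G_map G (orbit_product G H Y) X (orbit_extension G H X \<phi>)"
  unfolding G_map_def equivariant_def
  using continuous_map_orbit_extension[OF assms] orbit_extension_act[where \<phi> = \<phi>, OF X] fixed
  by (auto simp: orbit_product_def topspace_orbit_topology)

text \<open>
  A homotopy of \<open>Y\<close> in \<open>H\<close>-fixed points extends to an equivariant homotopy of \<open>G/H \<times> Y\<close>. Its equivariant
  lift, restricted to the coset \<open>H\<close>, consists of \<open>H\<close>-fixed points because \<open>H\<close> fixes that coset.
\<close>

lemma fixed_points_lift_homotopies:
  assumes E: "G_space G E" and B: "G_space G B" and fib: "G_fibration G E B p" and Y: "Hausdorff_space Y"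
  shows "lifts_homotopies Y (subtopology (topo E) (fixed_points E H)) (subtopology (topo B) (fixed_points B H)) p"
  unfolding lifts_homotopies_def
proof (intro allI impI)
  let ?I = "top_of_set {0..1::real}"
  let ?O = "orbit_topology G H"
  fix f h
  assume f: "continuous_map Y (subtopology (topo E) (fixed_points E H)) f"
    and h: "continuous_map (prod_topology ?I Y) (subtopology (topo B) (fixed_points B H)) h"
    and start: "\<forall>y\<in>topspace Y. h (0, y) = p (f y)"
  let ?P = "orbit_product G H Y"
  let ?f = "orbit_extension G H E f"
  let ?h = "\<lambda>(t, c, y). orbit_extension G H B h (c, (t, y))"
  have f_fix: "f y \<in> fixed_points E H" if "y \<in> topspace Y" for y
    using f that by (auto simp: continuous_map_in_subtopology)
  have h_fix: "h z \<in> fixed_points B H" if "z \<in> topspace (prod_topology ?I Y)" for z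
    using h that by (auto simp: continuous_map_in_subtopology)
  have hc: "continuous_map (prod_topology ?I Y) (topo B) h"
    using h by (simp add: continuous_map_in_subtopology)
  have p: "G_map G E B p"
    using fib by (simp add: G_fibration_def)
  have F: "G_map G ?P E ?f"
    using f f_fix by (intro G_map_orbit_extension E) (auto simp: continuous_map_in_subtopology)
  have "continuous_map (prod_topology ?I (prod_topology ?O Y)) (prod_topology ?O (prod_topology ?I Y)) (\<lambda>w. (fst (snd w), (fst w, snd (snd w))))"
    by (intro continuous_map_pairedI continuous_map_fst continuous_map_compose[OF continuous_map_snd continuous_map_fst, unfolded o_def]
        continuous_map_compose[OF continuous_map_snd continuous_map_snd, unfolded o_def])
  from continuous_map_compose[OF this continuous_map_orbit_extension[OF B hc h_fix]]
  have "continuous_map (prod_topology ?I (prod_topology ?O Y)) (topo B) ?h"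
    by (simp add: o_def case_prod_unfold)
  then have h_map: "G_map G (cylinder ?P) B ?h"
    unfolding G_map_def equivariant_def using orbit_extension_act[where \<phi> = h, OF B] h_fix
    by (auto simp: cylinder_def orbit_product_def topspace_orbit_topology)
  have start': "\<forall>y\<in>topspace (topo ?P). ?h (0, y) = p (?f y)"
  proof
    fix z assume "z \<in> topspace (topo ?P)"
    then obtain c y where z: "z = (c, y)" "c \<in> lcosets\<^bsub>G\<^esub> H" "y \<in> topspace Y"
      by (auto simp: orbit_product_def topspace_orbit_topology)
    then obtain g where g: "g \<in> carrier G" "c = g <#\<^bsub>G\<^esub> H"
      by (metis coset_cases)
    have "p (act E g (f y)) = act B g (p (f y))"
      using p g(1) f_fix[OF z(3)] by (simp add: G_map_def equivariant_def fixed_points_def)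
    then show "?h (0, z) = p (?f z)"
      using z g h_fix[of "(0, y)"] f_fix[OF z(3)] start
      by (simp add: orbit_extension_coset[where \<phi> = f, OF E] orbit_extension_coset[where \<phi> = h, OF B])
  qed
  have ghlp: "has_GHLP G E B p ?P"
    by (rule G_fibration_has_GHLP[OF G E B fib G_space_orbit_product[OF Y]])
  obtain k where k: "G_map G (cylinder ?P) E k"
    and k0: "\<forall>y\<in>topspace (topo ?P). k (0, y) = ?f y"
    and pk: "\<forall>z\<in>topspace (topo (cylinder ?P)). p (k z) = ?h z"
    using ghlp[unfolded has_GHLP_def, rule_format, OF F h_map start'[rule_format]] by blast
  have kc: "continuous_map (prod_topology ?I (prod_topology ?O Y)) (topo E) k"
    using k by (simp add: G_map_def cylinder_def orbit_product_def)
  have HH: "a <#\<^bsub>G\<^esub> H = H" if "a \<in> H" for a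
    using group.lcos_mult_one[OF grp subgroup.subset[OF H]] coset_eq_iff[of "\<one>\<^bsub>G\<^esub>" a] that
      subgroup.mem_carrier[OF H that] grp
    by (simp add: group.is_monoid monoid.one_closed monoid.l_one group.inv_closed monoid.inv_one)
  have k_fix: "k (t, H, y) \<in> fixed_points E H" if "t \<in> {0..1}" "y \<in> topspace Y" for t y
    unfolding fixed_points_def
  proof (intro CollectI conjI ballI)
    have in_top: "(t, H, y) \<in> topspace (prod_topology ?I (prod_topology ?O Y))"
      using that subgroup_in_cosets by (simp add: topspace_orbit_topology)
    then show "k (t, H, y) \<in> topspace (topo E)"
      using funcset_mem[OF continuous_map_funspace[OF kc]] by blast
    fix a assume a: "a \<in> H"
    have "k (act (cylinder ?P) a (t, H, y)) = act E a (k (t, H, y))"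
      using k subgroup.mem_carrier[OF H a] in_top
      unfolding G_map_def equivariant_def by (simp add: cylinder_def orbit_product_def)
    then show "act E a (k (t, H, y)) = k (t, H, y)"
      by (simp add: cylinder_def orbit_product_def HH[OF a])
  qed
  have "continuous_map (prod_topology ?I Y) (prod_topology ?I (prod_topology ?O Y)) (\<lambda>w. (fst w, (H, snd w)))"
    using subgroup_in_cosets
    by (intro continuous_map_pairedI continuous_map_fst continuous_map_snd) (auto simp: topspace_orbit_topology)
  from continuous_map_compose[OF this kc]
  have "continuous_map (prod_topology ?I Y) (topo E) (\<lambda>(t, y). k (t, H, y))"
    by (simp add: o_def case_prod_unfold)
  then have "continuous_map (prod_topology ?I Y) (subtopology (topo E) (fixed_points E H)) (\<lambda>(t, y). k (t, H, y))"
    using k_fix by (auto simp: continuous_map_in_subtopology)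
  moreover have "k (0, H, y) = f y" if "y \<in> topspace Y" for y
    using k0 that subgroup_in_cosets orbit_extension_subgroup[where \<phi> = f, OF E f_fix[OF that]]
    by (simp add: orbit_product_def topspace_orbit_topology)
  moreover have "p (k (t, H, y)) = h (t, y)" if "t \<in> {0..1}" "y \<in> topspace Y" for t y
    using pk that subgroup_in_cosets orbit_extension_subgroup[where \<phi> = h, OF B h_fix[of "(t, y)"]]
    by (simp add: cylinder_def orbit_product_def topspace_orbit_topology)
  ultimately show "\<exists>k. continuous_map (prod_topology ?I Y) (subtopology (topo E) (fixed_points E H)) k \<and>
      (\<forall>y\<in>topspace Y. k (0, y) = f y) \<and> (\<forall>t\<in>{0..1}. \<forall>y\<in>topspace Y. p (k (t, y)) = h (t, y))"
    by (intro exI[of _ "\<lambda>(t, y). k (t, H, y)"]) auto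
qed

end

section \<open>Equivariant obstruction theory\<close>

text \<open>
  The criterion is stated for maps on an open subset because partial lifts are defined on open sets only;
  a weak topology restricts to open subsets.
\<close>

lemma attached_cells_continuous_map:
  assumes closed_iff: "\<forall>S\<subseteq>N. closedin (subtopology X N) S \<longleftrightarrow>
           closedin (subtopology X A) (S \<inter> A) \<and>
           (\<forall>(H, \<Phi>)\<in>C. closedin (D H) {z \<in> topspace (D H). \<Phi> z \<in> S})"
    and N: "N \<subseteq> topspace X" and AN: "A \<subseteq> N"
    and \<Phi>: "\<And>H \<Phi>. (H, \<Phi>) \<in> C \<Longrightarrow> continuous_map (D H) (subtopology X N) \<Phi>"
    and U: "openin (subtopology X N) U"
    and gA: "continuous_map (subtopology X (A \<inter> U)) Y g"
    and gC: "\<And>H \<Phi>. (H, \<Phi>) \<in> C \<Longrightarrow>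
        continuous_map (subtopology (D H) {z \<in> topspace (D H). \<Phi> z \<in> U}) Y (\<lambda>z. g (\<Phi> z))"
    and gU: "g \<in> U \<rightarrow> topspace Y"
  shows "continuous_map (subtopology X U) Y g"
  unfolding continuous_map_def
proof (intro conjI allI impI)
  have UN: "U \<subseteq> N"
    using openin_subset[OF U] by simp
  have tU: "topspace (subtopology X U) = U"
    using UN N by auto
  show "g \<in> topspace (subtopology X U) \<rightarrow> topspace Y"
    unfolding tU by (rule gU)
  fix V assume V: "openin Y V"
  define W where "W = {x \<in> U. g x \<in> V}"
  have "closedin (subtopology X N) (N - W)"
  proof (rule closed_iff[rule_format, THEN iffD2], simp, intro conjI ballI)
    have "openin (subtopology X A) (A \<inter> U)"
    proof -
      have "openin (subtopology (subtopology X N) A) (U \<inter> A)"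
        using U by (rule openin_subtopology_Int)
      then show ?thesis
        using AN by (simp add: subtopology_subtopology inf_absorb1 inf_absorb2 Int_commute)
    qed
    moreover have "openin (subtopology X (A \<inter> U)) {x \<in> topspace (subtopology X (A \<inter> U)). g x \<in> V}"
      by (rule openin_continuous_map_preimage[OF gA V])
    moreover have "subtopology X (A \<inter> U) = subtopology (subtopology X A) (A \<inter> U)"
      by (simp add: subtopology_subtopology)
    ultimately have "openin (subtopology X A) {x \<in> topspace (subtopology X (A \<inter> U)). g x \<in> V}"
      using openin_trans_full by metis
    moreover have "{x \<in> topspace (subtopology X (A \<inter> U)). g x \<in> V} = A \<inter> W"
      using AN N by (auto simp: W_def)
    ultimately have "closedin (subtopology X A) (topspace (subtopology X A) - A \<inter> W)"
      by (metis openin_closedin_eq)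
    moreover have "topspace (subtopology X A) - A \<inter> W = (N - W) \<inter> A"
      using AN N by auto
    ultimately show "closedin (subtopology X A) ((N - W) \<inter> A)"
      by simp
  next
    fix c assume "c \<in> C"
    then obtain H \<Phi> where c: "c = (H, \<Phi>)" "(H, \<Phi>) \<in> C"
      by (cases c) auto
    let ?U = "{z \<in> topspace (D H). \<Phi> z \<in> U}"
    have "openin (D H) ?U"
      by (rule openin_continuous_map_preimage[OF \<Phi>[OF c(2)] U])
    moreover have "openin (subtopology (D H) ?U) {z \<in> topspace (subtopology (D H) ?U). g (\<Phi> z) \<in> V}"
      by (rule openin_continuous_map_preimage[OF gC[OF c(2)] V])
    ultimately have "openin (D H) {z \<in> topspace (subtopology (D H) ?U). g (\<Phi> z) \<in> V}"
      using openin_trans_full by blast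
    then have "closedin (D H) (topspace (D H) - {z \<in> topspace (subtopology (D H) ?U). g (\<Phi> z) \<in> V})"
      by blast
    moreover have "topspace (D H) - {z \<in> topspace (subtopology (D H) ?U). g (\<Phi> z) \<in> V}
        = {z \<in> topspace (D H). \<Phi> z \<in> N - W}"
      using continuous_map_funspace[OF \<Phi>[OF c(2)]] by (auto simp: W_def Pi_iff)
    ultimately show "case c of (H, \<Phi>) \<Rightarrow> closedin (D H) {z \<in> topspace (D H). \<Phi> z \<in> N - W}"
      by (simp add: c(1))
  qed
  then have "openin (subtopology X N) (topspace (subtopology X N) - (N - W))"
    by blast
  moreover have "topspace (subtopology X N) - (N - W) = W"
    using N UN by (auto simp: W_def)
  ultimately have "openin (subtopology (subtopology X N) U) (W \<inter> U)"
    by (metis openin_subtopology_Int)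
  then show "openin (subtopology X U) {x \<in> topspace (subtopology X U). g x \<in> V}"
  proof -
    assume "openin (subtopology (subtopology X N) U) (W \<inter> U)"
    moreover have "W \<inter> U = {x \<in> U. g x \<in> V}"
      by (auto simp: W_def)
    ultimately show ?thesis
      unfolding tU using UN by (simp add: subtopology_subtopology inf_absorb2)
  qed
qed

text \<open>
  Up to scaling of the functions \<open>t\<^sub>i\<close>, an equivariant section over \<open>A\<close> of the \<open>k\<close>-fold fibrewise join of
  the pullback of \<open>p\<close> along \<open>f\<close>.
\<close>

definition partial_lifts ::
  "'g top_group \<Rightarrow> ('g, 'x) gspace \<Rightarrow> ('g, 'e) gspace \<Rightarrow> ('e \<Rightarrow> 'b) \<Rightarrow> ('x \<Rightarrow> 'b) \<Rightarrow> nat \<Rightarrow>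
     'x set \<Rightarrow> (nat \<Rightarrow> 'x \<Rightarrow> real) \<Rightarrow> (nat \<Rightarrow> 'x \<Rightarrow> 'e) \<Rightarrow> bool" where
  "partial_lifts G X E p f k A t \<sigma> \<longleftrightarrow>
     (\<forall>x\<in>A. \<exists>i<k. 0 < t i x) \<and>
     (\<forall>i<k. continuous_map (subtopology (topo X) A) euclideanreal (t i) \<and>
        (\<forall>x\<in>A. 0 \<le> t i x \<and> (\<forall>g\<in>carrier G. t i (act X g x) = t i x)) \<and>
        G_map G (gsubspace X {x \<in> A. 0 < t i x}) E (\<sigma> i) \<and>
        (\<forall>x\<in>A. 0 < t i x \<longrightarrow> p (\<sigma> i x) = f x))"

lemma Hausdorff_top_of_set: "Hausdorff_space (top_of_set (S :: (nat \<Rightarrow> real) set))"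
proof (rule Hausdorff_space_subtopology)
  have "Hausdorff_space (powertop_real (UNIV :: nat set))"
    by (simp add: Hausdorff_space_product_topology)
  then show "Hausdorff_space (euclidean :: (nat \<Rightarrow> real) topology)"
    by (simp add: euclidean_product_topology)
qed

text \<open>
  On each cell \<open>G/H \<times> D\<^sup>m\<close> the data on the coset \<open>H\<close> are extended over the disc by \<open>lift_extension\<close>, applied
  to the restriction of \<open>p\<close> to \<open>H\<close>-fixed points, and then over the cell by equivariance.
\<close>

lemma partial_lifts_attach:
  assumes G: "topological_group G" and X: "G_space G X" and E: "G_space G E" and B: "G_space G B"
    and fib: "G_fibration G E B p" and f: "G_map G X B f"
    and conn: "\<And>H b. subgroup H G \<Longrightarrow> b \<in> fixed_points B H \<Longrightarrow> k_connected (int s - 1) (fixed_fibre E p H b)"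
    and dim: "m < k * (s + 1)"
    and attach: "attaches_G_cells G X m A N" and AN: "A \<subseteq> N"
    and invA: "invariant G X A" and invN: "invariant G X N"
    and lifts: "partial_lifts G X E p f k A t \<sigma>"
  shows "\<exists>t' \<sigma>'. partial_lifts G X E p f k N t' \<sigma>'"
proof -
  let ?X = "topo X" and ?E = "topo E" and ?B = "topo B"
  let ?D = "\<lambda>H. prod_topology (orbit_topology G H) (top_of_set (disc m))"
  obtain C where cells: "\<forall>(H, \<Phi>)\<in>C. subgroup H G \<and> closedin (gtop G) H \<and>
           G_map G (G_cell G H m) (gsubspace X N) \<Phi> \<and>
           \<Phi> ` ((lcosets\<^bsub>G\<^esub> H) \<times> disc_boundary m) \<subseteq> A"
    and bij: "bij_betw (\<lambda>((H, \<Phi>), z). \<Phi> z)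
          (Sigma C (\<lambda>(H, \<Phi>). (lcosets\<^bsub>G\<^esub> H) \<times> (disc m - disc_boundary m))) (N - A)"
    and closed_iff: "\<forall>S\<subseteq>N. closedin (subtopology ?X N) S \<longleftrightarrow>
           closedin (subtopology ?X A) (S \<inter> A) \<and>
           (\<forall>(H, \<Phi>)\<in>C. closedin (topo (G_cell G H m)) {z \<in> topspace (topo (G_cell G H m)). \<Phi> z \<in> S})"
    using attach unfolding attaches_G_cells_def by (elim exE conjE) (rule that)
  have C: "subgroup H G \<and> closedin (gtop G) H \<and> G_map G (G_cell G H m) (gsubspace X N) \<Phi> \<and>
      \<Phi> ` ((lcosets\<^bsub>G\<^esub> H) \<times> disc_boundary m) \<subseteq> A" if "(H, \<Phi>) \<in> C" for H \<Phi>
    using bspec[OF cells that] by (simp only: prod.case)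
  have topo_cell: "topo (G_cell G H m) = ?D H" for H
    by (simp add: G_cell_orbit_product orbit_product_def)
  have NX: "N \<subseteq> topspace ?X" and AX: "A \<subseteq> topspace ?X"
    using invN AN by (auto simp: invariant_def)
  have grp: "group G"
    using G by (simp add: topological_group_def)
  have bd: "disc_boundary m \<subseteq> disc m"
    by (auto simp: disc_L2_set disc_boundary_L2_set)
  have t: "continuous_map (subtopology ?X A) euclideanreal (t i)"
    and t_nonneg: "\<And>x. x \<in> A \<Longrightarrow> 0 \<le> t i x"
    and t_act: "\<And>x g. x \<in> A \<Longrightarrow> g \<in> carrier G \<Longrightarrow> t i (act X g x) = t i x"
    and \<sigma>: "continuous_map (subtopology ?X {x \<in> A. 0 < t i x}) ?E (\<sigma> i)"
    and \<sigma>_act: "\<And>x g. x \<in> A \<Longrightarrow> 0 < t i x \<Longrightarrow> g \<in> carrier G \<Longrightarrow> \<sigma> i (act X g x) = act E g (\<sigma> i x)"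
    and p\<sigma>: "\<And>x. x \<in> A \<Longrightarrow> 0 < t i x \<Longrightarrow> p (\<sigma> i x) = f x" if "i < k" for i
    using lifts that AX unfolding partial_lifts_def G_map_def equivariant_def gsubspace_def by auto
  have t_cover: "\<exists>i<k. 0 < t i x" if "x \<in> A" for x
    using lifts that unfolding partial_lifts_def by blast
  have p: "continuous_map ?E ?B p" "\<And>g e. g \<in> carrier G \<Longrightarrow> e \<in> topspace ?E \<Longrightarrow> p (act E g e) = act B g (p e)"
    using fib by (auto simp: G_fibration_def G_map_def equivariant_def)
  have fc: "continuous_map ?X ?B f" and f_act: "\<And>g x. g \<in> carrier G \<Longrightarrow> x \<in> topspace ?X \<Longrightarrow> f (act X g x) = act B g (f x)"
    using f by (auto simp: G_map_def equivariant_def)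

  have \<Phi>c: "continuous_map (?D H) (subtopology ?X N) \<Phi>"
    and \<Phi>_act: "\<And>g a y. g \<in> carrier G \<Longrightarrow> a \<in> lcosets\<^bsub>G\<^esub> H \<Longrightarrow> y \<in> disc m \<Longrightarrow> \<Phi> (g <#\<^bsub>G\<^esub> a, y) = act X g (\<Phi> (a, y))"
    and \<Phi>N: "\<And>a y. a \<in> lcosets\<^bsub>G\<^esub> H \<Longrightarrow> y \<in> disc m \<Longrightarrow> \<Phi> (a, y) \<in> N"
    and \<Phi>A: "\<And>a y. a \<in> lcosets\<^bsub>G\<^esub> H \<Longrightarrow> y \<in> disc_boundary m \<Longrightarrow> \<Phi> (a, y) \<in> A"
    and HG: "subgroup H G" and Hc: "closedin (gtop G) H"
    and Htop: "topspace (orbit_topology G H) = lcosets\<^bsub>G\<^esub> H" and Hin: "H \<in> lcosets\<^bsub>G\<^esub> H"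
    if c: "(H, \<Phi>) \<in> C" for H \<Phi>
  proof -
    note C' = C[OF c]
    show sub: "subgroup H G" and cl: "closedin (gtop G) H"
      using C' by auto
    show top: "topspace (orbit_topology G H) = lcosets\<^bsub>G\<^esub> H" and "H \<in> lcosets\<^bsub>G\<^esub> H"
      using topspace_orbit_topology[OF G sub cl] subgroup_in_cosets[OF G sub cl] by auto
    show cont: "continuous_map (?D H) (subtopology ?X N) \<Phi>"
      using C' by (simp add: G_map_def topo_cell gsubspace_def)
    show "\<Phi> (g <#\<^bsub>G\<^esub> a, y) = act X g (\<Phi> (a, y))" if "g \<in> carrier G" "a \<in> lcosets\<^bsub>G\<^esub> H" "y \<in> disc m" for g a y
    proof -
      have "equivariant G (G_cell G H m) (gsubspace X N) \<Phi>"
        using C' by (simp add: G_map_def)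
      then have "\<Phi> (act (G_cell G H m) g (a, y)) = act (gsubspace X N) g (\<Phi> (a, y))"
        using that top unfolding equivariant_def topo_cell by simp
      then show ?thesis
        by (simp add: G_cell_def gsubspace_def)
    qed
    show "\<Phi> (a, y) \<in> N" if "a \<in> lcosets\<^bsub>G\<^esub> H" "y \<in> disc m" for a y
      using funcset_mem[OF continuous_map_funspace[OF cont], of "(a, y)"] that top by simp
    show "\<Phi> (a, y) \<in> A" if "a \<in> lcosets\<^bsub>G\<^esub> H" "y \<in> disc_boundary m" for a y
      using C' that by blast
  qed
  have \<Phi>_fixed: "\<Phi> (H, y) \<in> fixed_points X H" if c: "(H, \<Phi>) \<in> C" and y: "y \<in> disc m" for H \<Phi> y
    unfolding fixed_points_def
  proof (intro CollectI conjI ballI)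
    show "\<Phi> (H, y) \<in> topspace ?X"
      using \<Phi>N[OF c Hin[OF c] y] NX by blast
    fix h assume h: "h \<in> H"
    interpret gr: group G by (rule grp)
    have hG: "h \<in> carrier G"
      using subgroup.mem_carrier[OF HG[OF c] h] .
    have "h <#\<^bsub>G\<^esub> H = H"
      using coset_eq_iff[OF G HG[OF c] Hc[OF c] gr.one_closed hG] coset_self[OF G HG[OF c] Hc[OF c]] h hG by simp
    then show "act X h (\<Phi> (H, y)) = \<Phi> (H, y)"
      using \<Phi>_act[OF c hG Hin[OF c] y] by simp
  qed

  have cell: "\<exists>T \<tau>. (\<forall>i<k. continuous_on (disc m) (T i) \<and>
       continuous_map (top_of_set {x \<in> disc m. 0 < T i x}) (subtopology ?E (fixed_points E H)) (\<tau> i) \<and>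
       (\<forall>x\<in>disc m. 0 \<le> T i x \<and> (0 < T i x \<longrightarrow> p (\<tau> i x) = f (\<Phi> (H, x)))) \<and>
       (\<forall>x\<in>disc_boundary m. T i x = t i (\<Phi> (H, x)) \<and> (0 < T i x \<longrightarrow> \<tau> i x = \<sigma> i (\<Phi> (H, x))))) \<and>
       (\<forall>x\<in>disc m. \<exists>i<k. 0 < T i x)" if c: "(H, \<Phi>) \<in> C" for H \<Phi>
  proof -
    note HG = HG[OF c] and Hc = Hc[OF c] and Hin = Hin[OF c] and Htop = Htop[OF c]
    let ?EH = "subtopology ?E (fixed_points E H)" and ?BH = "subtopology ?B (fixed_points B H)"
    let ?\<phi> = "\<lambda>x. f (\<Phi> (H, x))"
    have incl: "continuous_map (top_of_set S) (subtopology ?X N) (\<lambda>x. \<Phi> (H, x))" if "S \<subseteq> disc m" for S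
    proof -
      have "continuous_map (top_of_set S) (top_of_set (disc m)) (\<lambda>x. x)"
        using that by (auto simp: continuous_map_subtopology_eu continuous_on_id)
      then have "continuous_map (top_of_set S) (?D H) (\<lambda>x. (H, x))"
        using Hin by (intro continuous_map_pairedI) (simp_all add: Htop)
      from continuous_map_compose[OF this \<Phi>c[OF c]] show ?thesis
        by (simp only: o_def)
    qed
    have inclA: "continuous_map (top_of_set S) (subtopology ?X A') (\<lambda>x. \<Phi> (H, x))"
      if "S \<subseteq> disc m" "\<And>x. x \<in> S \<Longrightarrow> \<Phi> (H, x) \<in> A'" for S A'
      using incl[OF that(1)] that(2) by (auto simp: continuous_map_in_subtopology)
    have f_fixed: "f x \<in> fixed_points B H" if "x \<in> fixed_points X H" for x
      using that f_act[of _ x] subgroup.mem_carrier[OF HG] continuous_map_funspace[OF fc]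
      by (fastforce simp: fixed_points_def Pi_iff)
    have \<phi>: "continuous_map (top_of_set (disc m)) ?BH ?\<phi>"
      using continuous_map_compose[OF continuous_map_into_fulltopology[OF incl[OF subset_refl]] fc]
        f_fixed[OF \<Phi>_fixed[OF c]] by (simp add: continuous_map_in_subtopology o_def image_subset_iff)
    have zero: "(\<lambda>_. 0) \<in> disc m"
      by (simp add: disc_L2_set L2_set_def)
    have "subtopology ?EH {e. p e = ?\<phi> (\<lambda>_. 0)} = fixed_fibre E p H (?\<phi> (\<lambda>_. 0))"
      unfolding fixed_fibre_def subtopology_subtopology by (rule arg_cong[where f = "subtopology ?E"]) auto
    then have conn': "k_connected (int s - 1) (subtopology ?EH {e. p e = ?\<phi> (\<lambda>_. 0)})"
      using conn[OF HG f_fixed[OF \<Phi>_fixed[OF c zero]]] by simp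
    have \<sigma>_fixed: "\<sigma> i x \<in> fixed_points E H" if i: "i < k" and x: "x \<in> fixed_points X H" "x \<in> A" "0 < t i x" for i x
    proof -
      have "\<sigma> i x \<in> topspace ?E"
        using funcset_mem[OF continuous_map_funspace[OF \<sigma>[OF i]], of x] x AX by auto
      then show ?thesis
        using x \<sigma>_act[OF i x(2,3)] subgroup.mem_carrier[OF HG] by (force simp: fixed_points_def)
    qed
    let ?t = "\<lambda>i x. t i (\<Phi> (H, x))" and ?\<sigma> = "\<lambda>i x. \<sigma> i (\<Phi> (H, x))"
    have bA: "\<Phi> (H, x) \<in> A" "\<Phi> (H, x) \<in> fixed_points X H" if "x \<in> disc_boundary m" for x
      using \<Phi>A[OF c Hin that] \<Phi>_fixed[OF c] bd that by auto
    have 1: "continuous_on (disc_boundary m) (?t i)" if i: "i < k" for i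
      using continuous_map_compose[OF inclA[OF bd bA(1)] t[OF i]] by (simp add: o_def)
    have 2: "continuous_map (top_of_set {x \<in> disc_boundary m. 0 < ?t i x}) ?EH (?\<sigma> i)" if i: "i < k" for i
    proof -
      have "continuous_map (top_of_set {x \<in> disc_boundary m. 0 < ?t i x}) (subtopology ?X {x \<in> A. 0 < t i x}) (\<lambda>x. \<Phi> (H, x))"
        using bd bA(1) by (intro inclA) auto
      from continuous_map_compose[OF this \<sigma>[OF i]]
      show ?thesis
        using \<sigma>_fixed[OF i bA(2,1)] by (auto simp: continuous_map_in_subtopology o_def)
    qed
    have lift: "lifts_homotopies (top_of_set V) ?EH ?BH p" for V :: "(nat \<Rightarrow> real) set"
      by (rule fixed_points_lift_homotopies[OF G HG Hc E B fib Hausdorff_top_of_set])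
    show ?thesis
    proof (rule lift_extension[OF lift \<phi> conn' dim 1, where \<sigma> = ?\<sigma>])
      fix T \<tau>
      assume a: "\<And>i. i < k \<Longrightarrow> continuous_on (disc m) (T i)"
        "\<And>i x. i < k \<Longrightarrow> x \<in> disc m \<Longrightarrow> 0 \<le> T i x"
        "\<And>x. x \<in> disc m \<Longrightarrow> \<exists>i<k. 0 < T i x"
        "\<And>i. i < k \<Longrightarrow> continuous_map (top_of_set {x \<in> disc m. 0 < T i x}) ?EH (\<tau> i)"
        "\<And>i x. i < k \<Longrightarrow> x \<in> disc m \<Longrightarrow> 0 < T i x \<Longrightarrow> p (\<tau> i x) = ?\<phi> x"
        "\<And>i x. i < k \<Longrightarrow> x \<in> disc_boundary m \<Longrightarrow> T i x = ?t i x"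
        "\<And>i x. i < k \<Longrightarrow> x \<in> disc_boundary m \<Longrightarrow> 0 < ?t i x \<Longrightarrow> \<tau> i x = ?\<sigma> i x"
      show ?thesis
        by (rule exI[of _ T], rule exI[of _ \<tau>]) (use a in \<open>simp (no_asm_simp)\<close>)
    qed (use 2 bA t_nonneg t_cover p\<sigma> in auto)
  qed
  define good where "good c T \<tau> \<longleftrightarrow> (\<forall>i<k. continuous_on (disc m) (T i) \<and>
       continuous_map (top_of_set {x \<in> disc m. 0 < T i x}) (subtopology ?E (fixed_points E (fst c))) (\<tau> i) \<and>
       (\<forall>x\<in>disc m. 0 \<le> T i x \<and> (0 < T i x \<longrightarrow> p (\<tau> i x) = f (snd c (fst c, x)))) \<and>
       (\<forall>x\<in>disc_boundary m. T i x = t i (snd c (fst c, x)) \<and> (0 < T i x \<longrightarrow> \<tau> i x = \<sigma> i (snd c (fst c, x))))) \<and>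
       (\<forall>x\<in>disc m. \<exists>i<k. 0 < T i x)" for c T \<tau>
  have "\<exists>T \<tau>. good c T \<tau>" if "c \<in> C" for c
    using cell[of "fst c" "snd c"] that by (simp add: good_def)
  then obtain T \<tau> where good: "\<And>c. c \<in> C \<Longrightarrow> good c (T c) (\<tau> c)"
    by metis
  have T: "continuous_on (disc m) (T (H, \<Phi>) i)"
    and \<tau>: "continuous_map (top_of_set {x \<in> disc m. 0 < T (H, \<Phi>) i x}) (subtopology ?E (fixed_points E H)) (\<tau> (H, \<Phi>) i)"
    and T_nonneg: "\<And>x. x \<in> disc m \<Longrightarrow> 0 \<le> T (H, \<Phi>) i x"
    and p\<tau>: "\<And>x. x \<in> disc m \<Longrightarrow> 0 < T (H, \<Phi>) i x \<Longrightarrow> p (\<tau> (H, \<Phi>) i x) = f (\<Phi> (H, x))"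
    and T_bd: "\<And>x. x \<in> disc_boundary m \<Longrightarrow> T (H, \<Phi>) i x = t i (\<Phi> (H, x))"
    and \<tau>_bd: "\<And>x. x \<in> disc_boundary m \<Longrightarrow> 0 < T (H, \<Phi>) i x \<Longrightarrow> \<tau> (H, \<Phi>) i x = \<sigma> i (\<Phi> (H, x))"
    if "(H, \<Phi>) \<in> C" "i < k" for H \<Phi> i
    using good[OF that(1)] that(2) unfolding good_def fst_conv snd_conv by blast+
  have T_cover: "\<exists>i<k. 0 < T (H, \<Phi>) i x" if "(H, \<Phi>) \<in> C" "x \<in> disc m" for H \<Phi> x
    using good[OF that(1)] that(2) unfolding good_def by blast
  have \<tau>_fixed: "\<tau> (H, \<Phi>) i x \<in> fixed_points E H" if "(H, \<Phi>) \<in> C" "i < k" "x \<in> disc m" "0 < T (H, \<Phi>) i x" for H \<Phi> i x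
    using continuous_map_funspace[OF \<tau>[OF that(1,2)]] that(3,4) by auto

  let ?S = "Sigma C (\<lambda>(H, \<Phi>). (lcosets\<^bsub>G\<^esub> H) \<times> (disc m - disc_boundary m))"
  \<comment> \<open>Every point outside \<open>A\<close> is the image of exactly one interior point of one cell.\<close>
  define pre where "pre = inv_into ?S (\<lambda>((H, \<Phi>), z). \<Phi> z)"
  have pre: "pre (\<Phi> (a, y)) = ((H, \<Phi>), (a, y))" "\<Phi> (a, y) \<in> N - A"
    if "(H, \<Phi>) \<in> C" "a \<in> lcosets\<^bsub>G\<^esub> H" "y \<in> disc m" "y \<notin> disc_boundary m" for H \<Phi> a y
  proof -
    have mem: "((H, \<Phi>), (a, y)) \<in> ?S"
      using that by auto
    from inv_into_f_f[OF bij_betw_imp_inj_on[OF bij] this] show "pre (\<Phi> (a, y)) = ((H, \<Phi>), (a, y))"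
      by (simp add: pre_def)
    from bij_betwE[OF bij] mem show "\<Phi> (a, y) \<in> N - A"
      by fastforce
  qed
  have N_cases: "x \<in> A \<or> (\<exists>H \<Phi> a y. (H, \<Phi>) \<in> C \<and> a \<in> lcosets\<^bsub>G\<^esub> H \<and> y \<in> disc m \<and> x = \<Phi> (a, y))" if "x \<in> N" for x
  proof (cases "x \<in> A")
    case False
    then have "x \<in> (\<lambda>((H, \<Phi>), z). \<Phi> z) ` ?S"
      using that bij_betw_imp_surj_on[OF bij] by blast
    then show ?thesis
      by fastforce
  qed simp
  define t' where "t' i x = (if x \<in> A then t i x else case pre x of (c, (a, y)) \<Rightarrow> T c i y)" for i x
  define \<sigma>' where "\<sigma>' i x = (if x \<in> A then \<sigma> i x
      else case pre x of ((H, \<Phi>), z) \<Rightarrow> orbit_extension G H E (\<tau> (H, \<Phi>) i) z)" for i x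
  have t'_cell: "t' i (\<Phi> (a, y)) = T (H, \<Phi>) i y"
    if c: "(H, \<Phi>) \<in> C" and i: "i < k" and a: "a \<in> lcosets\<^bsub>G\<^esub> H" and y: "y \<in> disc m" for H \<Phi> i a y
  proof (cases "y \<in> disc_boundary m")
    case True
    obtain g where g: "g \<in> carrier G" "a = g <#\<^bsub>G\<^esub> H"
      using coset_cases[OF G HG[OF c] Hc[OF c] a] by blast
    have "t i (\<Phi> (a, y)) = t i (\<Phi> (H, y))"
      using \<Phi>_act[OF c g(1) Hin[OF c] y] t_act[OF i \<Phi>A[OF c Hin[OF c] True] g(1)] g(2) by simp
    then show ?thesis
      using \<Phi>A[OF c a True] T_bd[OF c i True] by (simp add: t'_def)
  next
    case False
    then show ?thesis
      using pre[OF c a y] by (simp add: t'_def)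
  qed
  have \<sigma>'_cell: "\<sigma>' i (\<Phi> (a, y)) = orbit_extension G H E (\<tau> (H, \<Phi>) i) (a, y)"
    if c: "(H, \<Phi>) \<in> C" and i: "i < k" and a: "a \<in> lcosets\<^bsub>G\<^esub> H" and y: "y \<in> disc m" "0 < T (H, \<Phi>) i y" for H \<Phi> i a y
  proof (cases "y \<in> disc_boundary m")
    case True
    obtain g where g: "g \<in> carrier G" "a = g <#\<^bsub>G\<^esub> H"
      using coset_cases[OF G HG[OF c] Hc[OF c] a] by blast
    have "\<sigma> i (\<Phi> (a, y)) = act E g (\<sigma> i (\<Phi> (H, y)))"
      using \<Phi>_act[OF c g(1) Hin[OF c] y(1)] \<sigma>_act[OF i \<Phi>A[OF c Hin[OF c] True] _ g(1)] g(2) T_bd[OF c i True] y(2) by simp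
    moreover have "orbit_extension G H E (\<tau> (H, \<Phi>) i) (a, y) = act E g (\<tau> (H, \<Phi>) i y)"
      unfolding g(2) by (rule orbit_extension_coset[where \<phi> = "\<tau> (H, \<Phi>) i", OF G HG[OF c] Hc[OF c] E g(1) \<tau>_fixed[OF c i y]])
    ultimately show ?thesis
      using \<Phi>A[OF c a True] \<tau>_bd[OF c i True y(2)] by (simp add: \<sigma>'_def)
  next
    case False
    then show ?thesis
      using pre[OF c a y(1)] by (simp add: \<sigma>'_def)
  qed
  have t'_cont: "continuous_map (subtopology ?X N) euclideanreal (t' i)" if i: "i < k" for i
  proof (rule attached_cells_continuous_map[OF closed_iff[unfolded topo_cell] NX AN \<Phi>c])
    show "openin (subtopology ?X N) N"
      using NX openin_topspace[of "subtopology ?X N"] by (simp add: inf_absorb2)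
    have "continuous_map (subtopology ?X A) euclideanreal (t' i)"
      using t[OF i] by (rule continuous_map_eq) (simp add: t'_def)
    then show "continuous_map (subtopology ?X (A \<inter> N)) euclideanreal (t' i)"
      using AN by (simp add: inf_absorb1)
    fix H \<Phi> assume c: "(H, \<Phi>) \<in> C"
    have "continuous_map (?D H) euclideanreal (\<lambda>z. T (H, \<Phi>) i (snd z))"
      using T[OF c i] by (intro continuous_map_compose[OF continuous_map_snd, unfolded o_def]) simp
    then have "continuous_map (?D H) euclideanreal (\<lambda>z. t' i (\<Phi> z))"
      by (rule continuous_map_eq) (auto simp: t'_cell[OF c i] Htop[OF c])
    then show "continuous_map (subtopology (?D H) {z \<in> topspace (?D H). \<Phi> z \<in> N}) euclideanreal (\<lambda>z. t' i (\<Phi> z))"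
      by (rule continuous_map_from_subtopology)
  qed auto
  have \<sigma>'_E: "\<sigma>' i x \<in> topspace ?E" if i: "i < k" and x: "x \<in> N" "0 < t' i x" for i x
  proof (cases "x \<in> A")
    case True
    then show ?thesis
      using funcset_mem[OF continuous_map_funspace[OF \<sigma>[OF i]], of x] x AX by (auto simp: \<sigma>'_def t'_def)
  next
    case False
    then obtain H \<Phi> a y where c: "(H, \<Phi>) \<in> C" "a \<in> lcosets\<^bsub>G\<^esub> H" "y \<in> disc m" "x = \<Phi> (a, y)"
      using N_cases[OF x(1)] by blast
    have pos: "0 < T (H, \<Phi>) i y"
      using x(2) t'_cell[OF c(1) i c(2,3)] c(4) by simp
    obtain g where g: "g \<in> carrier G" "a = g <#\<^bsub>G\<^esub> H"
      using coset_cases[OF G HG[OF c(1)] Hc[OF c(1)] c(2)] by blast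
    note fxd = \<tau>_fixed[OF c(1) i c(3) pos]
    have "\<sigma>' i x = act E g (\<tau> (H, \<Phi>) i y)"
      unfolding c(4) \<sigma>'_cell[OF c(1) i c(2,3) pos] unfolding g(2)
      by (rule orbit_extension_coset[where \<phi> = "\<tau> (H, \<Phi>) i", OF G HG[OF c(1)] Hc[OF c(1)] E g(1) fxd])
    then show ?thesis
      using act_in[OF E G g(1)] fxd by (simp add: fixed_points_def)
  qed
  have \<sigma>'_cont: "continuous_map (subtopology ?X {x \<in> N. 0 < t' i x}) ?E (\<sigma>' i)" if i: "i < k" for i
  proof (rule attached_cells_continuous_map[OF closed_iff[unfolded topo_cell] NX AN \<Phi>c])
    have "openin (subtopology ?X N) {x \<in> topspace (subtopology ?X N). t' i x \<in> {0<..}}"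
      by (rule openin_continuous_map_preimage[OF t'_cont[OF i]]) simp
    moreover have "{x \<in> topspace (subtopology ?X N). t' i x \<in> {0<..}} = {x \<in> N. 0 < t' i x}"
      using NX by auto
    ultimately show "openin (subtopology ?X N) {x \<in> N. 0 < t' i x}"
      by simp
    have "A \<inter> {x \<in> N. 0 < t' i x} = {x \<in> A. 0 < t i x}"
      using AN by (auto simp: t'_def)
    moreover have "continuous_map (subtopology ?X {x \<in> A. 0 < t i x}) ?E (\<sigma>' i)"
      using \<sigma>[OF i] by (rule continuous_map_eq) (simp add: \<sigma>'_def)
    ultimately show "continuous_map (subtopology ?X (A \<inter> {x \<in> N. 0 < t' i x})) ?E (\<sigma>' i)"
      by simp
    show "\<sigma>' i \<in> {x \<in> N. 0 < t' i x} \<rightarrow> topspace ?E"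
      using \<sigma>'_E[OF i] by blast
    fix H \<Phi> assume c: "(H, \<Phi>) \<in> C"
    let ?V = "{x \<in> disc m. 0 < T (H, \<Phi>) i x}"
    have V: "{z \<in> topspace (?D H). \<Phi> z \<in> {x \<in> N. 0 < t' i x}} = (lcosets\<^bsub>G\<^esub> H) \<times> ?V"
      using t'_cell[OF c i] \<Phi>N[OF c] by (auto simp: Htop[OF c])
    have "subtopology (?D H) ((lcosets\<^bsub>G\<^esub> H) \<times> ?V) = prod_topology (orbit_topology G H) (top_of_set ?V)"
    proof -
      have "subtopology (?D H) ((lcosets\<^bsub>G\<^esub> H) \<times> ?V)
          = prod_topology (subtopology (orbit_topology G H) (lcosets\<^bsub>G\<^esub> H)) (subtopology (top_of_set (disc m)) ?V)"
        by (simp add: prod_topology_subtopology subtopology_subtopology Times_Int_Times Int_commute)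
      also have "subtopology (orbit_topology G H) (lcosets\<^bsub>G\<^esub> H) = orbit_topology G H"
        using subtopology_topspace[of "orbit_topology G H"] by (simp add: Htop[OF c])
      also have "subtopology (top_of_set (disc m)) ?V = top_of_set ?V"
        unfolding subtopology_subtopology by (rule arg_cong[where f = top_of_set]) auto
      finally show ?thesis .
    qed
    moreover have "continuous_map (prod_topology (orbit_topology G H) (top_of_set ?V)) ?E (orbit_extension G H E (\<tau> (H, \<Phi>) i))"
      using \<tau>[OF c i] \<tau>_fixed[OF c i]
      by (intro continuous_map_orbit_extension[OF G HG[OF c] Hc[OF c] E]) (auto simp: continuous_map_in_subtopology)
    ultimately have "continuous_map (subtopology (?D H) ((lcosets\<^bsub>G\<^esub> H) \<times> ?V)) ?E (orbit_extension G H E (\<tau> (H, \<Phi>) i))"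
      by simp
    then have "continuous_map (subtopology (?D H) ((lcosets\<^bsub>G\<^esub> H) \<times> ?V)) ?E (\<lambda>z. \<sigma>' i (\<Phi> z))"
      by (rule continuous_map_eq) (auto simp: \<sigma>'_cell[OF c i] Htop[OF c])
    then show "continuous_map (subtopology (?D H) {z \<in> topspace (?D H). \<Phi> z \<in> {x \<in> N. 0 < t' i x}}) ?E (\<lambda>z. \<sigma>' i (\<Phi> z))"
      unfolding V .
  qed
  have pointwise: "0 \<le> t' i x \<and> (\<forall>g\<in>carrier G. t' i (act X g x) = t' i x) \<and>
      (0 < t' i x \<longrightarrow> p (\<sigma>' i x) = f x \<and> (\<forall>g\<in>carrier G. \<sigma>' i (act X g x) = act E g (\<sigma>' i x)))"
    if i: "i < k" and x: "x \<in> N" for i x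
  proof (cases "x \<in> A")
    case True
    then have "act X g x \<in> A" if "g \<in> carrier G" for g
      using invA that by (auto simp: invariant_def)
    then show ?thesis
      using True t_nonneg[OF i] t_act[OF i] \<sigma>_act[OF i] p\<sigma>[OF i] by (simp add: t'_def \<sigma>'_def)
  next
    case False
    then obtain H \<Phi> a y where c: "(H, \<Phi>) \<in> C" and a: "a \<in> lcosets\<^bsub>G\<^esub> H" and y: "y \<in> disc m" and xa: "x = \<Phi> (a, y)"
      using N_cases[OF x] by blast
    note HGc = G HG[OF c] Hc[OF c]
    obtain b where b: "b \<in> carrier G" "a = b <#\<^bsub>G\<^esub> H"
      using coset_cases[OF HGc a] by blast
    interpret gr: group G by (rule grp)
    have ga: "g <#\<^bsub>G\<^esub> a \<in> lcosets\<^bsub>G\<^esub> H" if "g \<in> carrier G" for g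
      unfolding b(2) coset_assoc[OF HGc that b(1)] by (rule coset_in[OF HGc]) (use that b in simp)
    have gx: "act X g x = \<Phi> (g <#\<^bsub>G\<^esub> a, y)" if "g \<in> carrier G" for g
      using \<Phi>_act[OF c that a y] by (simp add: xa)
    have tx: "t' i x = T (H, \<Phi>) i y"
      using t'_cell[OF c i a y] by (simp add: xa)
    have "t' i (act X g x) = t' i x" if "g \<in> carrier G" for g
      using t'_cell[OF c i ga[OF that] y] gx[OF that] tx by simp
    moreover have "p (\<sigma>' i x) = f x \<and> (\<forall>g\<in>carrier G. \<sigma>' i (act X g x) = act E g (\<sigma>' i x))" if "0 < t' i x"
    proof -
      have pos: "0 < T (H, \<Phi>) i y"
        using that tx by simp
      note fxd = \<tau>_fixed[OF c i y pos]
      have \<sigma>x: "\<sigma>' i x = orbit_extension G H E (\<tau> (H, \<Phi>) i) (a, y)"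
        using \<sigma>'_cell[OF c i a y pos] by (simp add: xa)
      have "\<sigma>' i x = act E b (\<tau> (H, \<Phi>) i y)"
        unfolding \<sigma>x unfolding b(2) by (rule orbit_extension_coset[where \<phi> = "\<tau> (H, \<Phi>) i", OF HGc E b(1) fxd])
      then have "p (\<sigma>' i x) = act B b (f (\<Phi> (H, y)))"
        using p(2)[OF b(1)] fxd p\<tau>[OF c i y pos] by (simp add: fixed_points_def)
      also have "\<dots> = f (act X b (\<Phi> (H, y)))"
        using f_act[OF b(1)] \<Phi>N[OF c Hin[OF c] y] NX by auto
      also have "act X b (\<Phi> (H, y)) = x"
        using \<Phi>_act[OF c b(1) Hin[OF c] y] by (simp add: xa b(2))
      finally have "p (\<sigma>' i x) = f x" .
      moreover have "\<sigma>' i (act X g x) = act E g (\<sigma>' i x)" if g: "g \<in> carrier G" for g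
        unfolding gx[OF g] \<sigma>'_cell[OF c i ga[OF g] y pos] \<sigma>x
        by (rule orbit_extension_act[where \<phi> = "\<tau> (H, \<Phi>) i", OF HGc E g a fxd])
      ultimately show ?thesis
        by blast
    qed
    ultimately show ?thesis
      using tx T_nonneg[OF c i y] by simp
  qed
  have cover: "\<exists>i<k. 0 < t' i x" if x: "x \<in> N" for x
  proof (cases "x \<in> A")
    case True
    then show ?thesis
      using t_cover by (simp add: t'_def)
  next
    case False
    then obtain H \<Phi> a y where c: "(H, \<Phi>) \<in> C" and a: "a \<in> lcosets\<^bsub>G\<^esub> H" and y: "y \<in> disc m" and xa: "x = \<Phi> (a, y)"
      using N_cases[OF x] by blast
    then show ?thesis
      using T_cover[OF c y] t'_cell[OF c _ a y] by metis
  qed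
  have "partial_lifts G X E p f k N t' \<sigma>'"
    unfolding partial_lifts_def G_map_def equivariant_def gsubspace_def
    using cover t'_cont \<sigma>'_cont pointwise by simp
  then show ?thesis
    by blast
qed

lemma partial_lifts_skeleton:
  assumes G: "topological_group G" and X: "G_CW_complex G X sk" and E: "G_space G E" and B: "G_space G B"
    and fib: "G_fibration G E B p" and f: "G_map G X B f"
    and conn: "\<And>H b. subgroup H G \<Longrightarrow> b \<in> fixed_points B H \<Longrightarrow> k_connected (int s - 1) (fixed_fibre E p H b)"
    and dim: "n < k * (s + 1)"
  shows "\<exists>t \<sigma>. partial_lifts G X E p f k (sk n) t \<sigma>"
proof -
  have X': "G_space G X" "skeleton_below sk n \<subseteq> sk n" "invariant G X (sk n)"
    "attaches_G_cells G X n (skeleton_below sk n) (sk n)" for n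
    using X by (simp_all add: G_CW_complex_def)
  have below: "invariant G X (skeleton_below sk n)" for n
    using X'(3) by (simp add: skeleton_below_def) (simp add: invariant_def)
  have step: "\<exists>t' \<sigma>'. partial_lifts G X E p f k (sk n) t' \<sigma>'"
    if "\<exists>t \<sigma>. partial_lifts G X E p f k (skeleton_below sk n) t \<sigma>" "n < k * (s + 1)" for n
    using that(1) partial_lifts_attach[OF G X'(1) E B fib f conn that(2) X'(4,2) below X'(3)] by blast
  show ?thesis
    using dim
  proof (induction n)
    case 0
    have "partial_lifts G X E p f k {} (\<lambda>_ _. 0) (\<lambda>_ _. undefined)"
      by (simp add: partial_lifts_def gsubspace_def G_map_def equivariant_def)
    then show ?case
      using 0 by (intro step) (auto simp: skeleton_below_def)
  next
    case (Suc n)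
    then show ?case
      by (intro step) (auto simp: skeleton_below_def)
  qed
qed

lemma topspace_eq_skeleton:
  assumes X: "G_CW_complex G X sk" and dim: "CW_dim sk = enat n"
  shows "topspace (topo X) = sk n"
proof -
  have step: "sk (Suc j) = sk j" if "n \<le> j" for j
  proof (rule ccontr)
    assume "sk (Suc j) \<noteq> sk j"
    then have "enat (Suc j) \<le> CW_dim sk"
      unfolding CW_dim_def by (intro SUP_upper) (simp add: skeleton_below_def)
    then show False
      using dim that by simp
  qed
  have mono: "sk j \<subseteq> sk (Suc j)" for j
  proof -
    have "skeleton_below sk (Suc j) \<subseteq> sk (Suc j)"
      using X by (simp only: G_CW_complex_def)
    then show ?thesis
      by (simp add: skeleton_below_def)
  qed
  have "sk j \<subseteq> sk n" for j
  proof (cases "j \<le> n")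
    case True
    then show ?thesis
      using lift_Suc_mono_le[of sk, OF mono] by blast
  next
    case False
    then have "n \<le> j"
      by simp
    then have "sk j = sk n"
      by (induction j rule: dec_induct) (simp_all add: step)
    then show ?thesis
      by simp
  qed
  then show ?thesis
    using X unfolding G_CW_complex_def by blast
qed

section \<open>The bound on the sectional category\<close>

text \<open>
  If \<open>h\<close> is a homotopy inverse of \<open>f\<close>, then a partial lift \<open>\<sigma>\<^sub>i\<close> of \<open>f\<close> gives the map \<open>\<sigma>\<^sub>i \<circ> h\<close>, and
  composing it with \<open>p\<close> yields \<open>f \<circ> h\<close>, which is homotopic to the identity.
\<close>

lemma secat_le:
  fixes B :: "('g, 'b) gspace"
  assumes G: "topological_group G" and X: "G_CW_complex G X sk" and E: "G_space G E" and B: "G_space G B"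
    and fib: "G_fibration G E B p" and equiv: "G_homotopy_equivalent G X B"
    and conn: "\<And>H b. subgroup H G \<Longrightarrow> b \<in> fixed_points B H \<Longrightarrow> k_connected (int s - 1) (fixed_fibre E p H b)"
    and n: "CW_dim sk = enat n" and dim: "n < k * (s + 1)"
  shows "secat G E B p \<le> enat k"
proof -
  obtain f h where f: "G_map G X B f" and h: "G_map G B X h" and hom: "G_homotopic G B B (f \<circ> h) (\<lambda>y. y)"
    using equiv unfolding G_homotopy_equivalent_def by blast
  obtain t \<sigma> where lifts: "partial_lifts G X E p f k (topspace (topo X)) t \<sigma>"
    using partial_lifts_skeleton[OF G X E B fib f conn dim] topspace_eq_skeleton[OF X n] by auto
  have hc: "continuous_map (topo B) (topo X) h"
    and h_act: "\<And>g b. g \<in> carrier G \<Longrightarrow> b \<in> topspace (topo B) \<Longrightarrow> h (act B g b) = act X g (h b)"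
    using h by (auto simp: G_map_def equivariant_def)
  have hX: "h b \<in> topspace (topo X)" if "b \<in> topspace (topo B)" for b
    using funcset_mem[OF continuous_map_funspace[OF hc] that] .
  define U where "U i = {b \<in> topspace (topo B). 0 < t i (h b)}" for i
  have "(\<Union>i<k. U i) = topspace (topo B)"
    using lifts hX unfolding partial_lifts_def U_def by blast
  moreover have "openin (topo B) (U i) \<and> invariant G B (U i) \<and>
      (\<exists>s. G_map G (gsubspace B (U i)) E s \<and> G_homotopic G (gsubspace B (U i)) B (p \<circ> s) (\<lambda>x. x))" if i: "i < k" for i
  proof (intro conjI exI)
    have t: "continuous_map (topo X) euclideanreal (t i)"
      and t_act: "\<And>x g. x \<in> topspace (topo X) \<Longrightarrow> g \<in> carrier G \<Longrightarrow> t i (act X g x) = t i x"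
      and \<sigma>: "G_map G (gsubspace X {x \<in> topspace (topo X). 0 < t i x}) E (\<sigma> i)"
      and p\<sigma>: "\<And>x. x \<in> topspace (topo X) \<Longrightarrow> 0 < t i x \<Longrightarrow> p (\<sigma> i x) = f x"
      using lifts i unfolding partial_lifts_def by auto
    have "continuous_map (topo B) euclideanreal (\<lambda>b. t i (h b))"
      using continuous_map_compose[OF hc t] by (simp add: o_def)
    from openin_continuous_map_preimage[OF this, of "{0<..}"] show "openin (topo B) (U i)"
      by (simp add: U_def)
    show inv: "invariant G B (U i)"
      using act_in[OF B G] h_act hX t_act by (auto simp: invariant_def U_def)
    have UB: "U i \<subseteq> topspace (topo B)"
      by (auto simp: U_def)
    show "G_map G (gsubspace B (U i)) E (\<sigma> i \<circ> h)"
      unfolding G_map_def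
    proof
      have "continuous_map (subtopology (topo B) (U i)) (subtopology (topo X) {x \<in> topspace (topo X). 0 < t i x}) h"
        using hX by (auto simp: continuous_map_in_subtopology U_def intro: continuous_map_from_subtopology hc)
      moreover have "continuous_map (subtopology (topo X) {x \<in> topspace (topo X). 0 < t i x}) (topo E) (\<sigma> i)"
        using \<sigma> by (simp add: G_map_def gsubspace_def)
      ultimately show "continuous_map (topo (gsubspace B (U i))) (topo E) (\<sigma> i \<circ> h)"
        by (simp add: gsubspace_def continuous_map_compose)
      show "equivariant G (gsubspace B (U i)) E (\<sigma> i \<circ> h)"
        using \<sigma> hX h_act by (auto simp: G_map_def equivariant_def gsubspace_def U_def)
    qed
    have "homotopic_with (equivariant G (gsubspace B (U i)) B) (topo B) (topo B) (f \<circ> h) (\<lambda>y. y)"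
      by (rule homotopic_with_mono[OF hom[unfolded G_homotopic_def]])
        (use UB in \<open>auto simp: equivariant_def gsubspace_def\<close>)
    then have "homotopic_with (equivariant G (gsubspace B (U i)) B) (topo (gsubspace B (U i))) (topo B) (f \<circ> h) (\<lambda>y. y)"
      unfolding gsubspace_def by (simp add: homotopic_from_subtopology)
    then show "G_homotopic G (gsubspace B (U i)) B (p \<circ> (\<sigma> i \<circ> h)) (\<lambda>x. x)"
      unfolding G_homotopic_def
    proof (rule homotopic_with_eq)
      show "(p \<circ> (\<sigma> i \<circ> h)) b = (f \<circ> h) b" if "b \<in> topspace (topo (gsubspace B (U i)))" for b
        using that p\<sigma> hX by (simp add: gsubspace_def U_def)
      fix q q' :: "'b \<Rightarrow> 'b"
      assume eq: "\<And>b. b \<in> topspace (topo (gsubspace B (U i))) \<Longrightarrow> q b = q' b"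
      have closed: "act B g b \<in> topspace (topo (gsubspace B (U i)))"
        if "g \<in> carrier G" "b \<in> topspace (topo (gsubspace B (U i)))" for g b
        using that inv UB by (auto simp: gsubspace_def invariant_def)
      have "act (gsubspace B (U i)) = act B"
        by (simp add: gsubspace_def)
      then show "equivariant G (gsubspace B (U i)) B q = equivariant G (gsubspace B (U i)) B q'"
        unfolding equivariant_def by (intro ball_cong refl) (simp only: eq closed)
    qed simp
  qed
  moreover have "1 \<le> k"
    using dim by (cases k) auto
  ultimately show ?thesis
    unfolding secat_def by (intro Inf_lower CollectI exI[of _ k] conjI refl exI[of _ U]) auto
qed

theorem theorem2p16:
  fixes G :: "'g top_group"
    and E :: "('g, 'e) gspace"
    and B :: "('g, 'b) gspace"
    and p :: "'e \<Rightarrow> 'b"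
    and sk :: "nat \<Rightarrow> 'b set"
    and s :: nat
  assumes "compact_Lie_group G"
    and "G_space G E"
    and "G_CW_complex G B sk"
    and "CW_dim sk \<ge> 2"
    and "G_fibration G E B p"
    and "\<And>H b. subgroup H G \<Longrightarrow> b \<in> fixed_points B H \<Longrightarrow>
           k_connected (int s - 1) (fixed_fibre E p H b)"
    and "hdim TYPE('x) G B \<noteq> \<infinity>"
  shows "ereal_of_enat (secat G E B p)
           < (ereal_of_enat (hdim TYPE('x) G B) + 1) / (ereal (real s) + 1) + 1"
proof -
  let ?D = "{CW_dim sk | (X' :: ('g, 'x) gspace) sk. G_CW_complex G X' sk \<and> G_homotopy_equivalent G X' B}"
  have "?D \<noteq> {}"
  proof
    assume "?D = {}"
    then have "hdim TYPE('x) G B = Inf {}"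
      by (simp only: hdim_def)
    then show False
      using assms(7) by (simp add: Inf_enat_def)
  qed
  then obtain d where "d \<in> ?D"
    by (meson ex_in_conv)
  then have "hdim TYPE('x) G B \<in> ?D"
    unfolding hdim_def by (rule wellorder_InfI)
  then obtain X' :: "('g, 'x) gspace" and sk'
    where X': "G_CW_complex G X' sk'" "G_homotopy_equivalent G X' B" and dim: "hdim TYPE('x) G B = CW_dim sk'"
    by blast
  obtain n where n: "CW_dim sk' = enat n"
    using assms(7) dim by auto
  \<comment> \<open>The quotient \<open>(n + 1) / (s + 1)\<close>, rounded up.\<close>
  define k where "k = (n + s + 1) div (s + 1)"
  have "n < k * (s + 1)" "k * (s + 1) \<le> n + s + 1"
    using div_mult_mod_eq[of "n + s + 1" "s + 1"] mod_less_divisor[of "s + 1" "n + s + 1"]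
    unfolding k_def by linarith+
  have "topological_group G"
    using assms(1) by (simp add: compact_Lie_group_def Lie_group_def)
  moreover have "G_space G B"
    using assms(3) by (simp add: G_CW_complex_def)
  ultimately have "secat G E B p \<le> enat k"
    using assms(2,5,6) X' n \<open>n < k * (s + 1)\<close> by (intro secat_le)
  then have "ereal_of_enat (secat G E B p) \<le> ereal (real k)"
    using ereal_of_enat_le_iff[of "secat G E B p" "enat k"] by simp
  also have "real k < (real n + 1) / (real s + 1) + 1"
  proof -
    have "real k * (real s + 1) \<le> real n + real s + 1"
      using of_nat_mono[OF \<open>k * (s + 1) \<le> n + s + 1\<close>, where 'a = real] by (simp add: algebra_simps)
    then show ?thesis
      by (simp add: field_simps)
  qed
  then have "ereal (real k) < ereal ((real n + 1) / (real s + 1) + 1)"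
    by simp
  also have "\<dots> = (ereal_of_enat (hdim TYPE('x) G B) + 1) / (ereal (real s) + 1) + 1"
    by (simp add: dim n one_ereal_def)
  finally show ?thesis .
qed

end
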